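(* Let $r\ge 35$ and $t\ge 1$ be integers and set $\gamma=\gamma(r)=\frac{1}{8r2^r}$. Then there exists an $n_0=n_0(\gamma)$ such that the following holds. Assume that $n\ge n_0$ and that $G$ is an $n$-vertex graph with minimum degree $\delta(G)\ge \left(\frac12+3\gamma^{1/3}\right)n$. If $H\in\mathcal{H}_{r,t}$ is a graph on $n$ vertices, then $H\subset G$, i.e. $G$ contains a (spanning) subgraph isomorphic to $H$.
   Context: All graphs are finite and simple. $\Delta$ and $\delta$ denote maximum and minimum degree, $|H|$ the number of vertices. For disjoint $X,Y\subset V(H)$, $H[X]$ is the induced subgraph on $X$ and $H[X,Y]$ is the bipartite subgraph of all edges of $H$ with one endpoint in $X$ and the other in $Y$. An $r$-regular (non-bipartite) graph $U$ is a Ramanujan graph if $\lambda\le 2\sqrt{r-1}$, where $\lambda$ is the second largest in absolute value of the eigenvalues (with multiplicity) of the adjacency matrix of $U$, the largest being $r$. The bipartite graphs $F_i$: given an $r$-regular Ramanujan graph $U$ on $k$ vertices, $r\ge 35$, let $F$ be the $(r+1)$-regular bipartite graph with vertex classes $V_1=\{x_1:x\in V(U)\}$ and $V_2=\{x_2:x\in V(U)\}$ (two disjoint copies of $V(U)$), whose edges are $x_1y_2$ and $x_2y_1$ for every $xy\in E(U)$, and $x_1x_2$ for every $x\in V(U)$. Fix an infinite sequence of $r$-regular Ramanujan graphs on $k_1<k_2<\cdots$ vertices and let $F_i$ be the resulting bipartite graph on $2k_i$ vertices. The class $\mathcal{H}_{r,t}$ (for integers $r\ge 35$, $t\ge1$,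 with $\gamma=1/(8r2^r)$): given a sufficiently large $n$, let $i$ be such that $k_i$ is the largest with $2k_i\le\gamma n$. The $n$-vertex elements of $\mathcal{H}_{r,t}$ are the bipartite graphs $H=(A,B;E)$ such that: (1) $V(H)=A\cup B$ (disjoint vertex classes) and $|H|=n$; (2) there is $S\subset V(H)$, $S=S_A\,\dot\cup\,S_B$, with $|S_A|=|S_B|=k_i$; (3) $H[S_A]$ and $H[S_B]$ have no edges, and $H[S_A,S_B]=F_i$ (up to isomorphism, with $S_A,S_B$ playing the roles of the two vertex classes); (4) $D:=\Delta(H)=O(r2^r)$, with a fixed absolute implied constant; (5) $H-S$ has exactly $|S|$ components, all isomorphic; each component is a tree consisting of a path on $t$ vertices one of whose endpoints, the last vertex, has $D-1$ leaves attached to it; the other endpoint of the path is called the first vertex (if $t=1$, the first and last vertices coincide); (6) every $x\in S$ has a unique neighbor in $V(H)-S$, which is the first vertex of one of the tree components of $H-S$, and every first vertex has exactly one neighbor in $S$. *)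

theory Defs
  imports
    "HOL-Analysis.Analysis"
    "HOL-Computational_Algebra.Computational_Algebra"
    "Jordan_Normal_Form.Char_Poly"
    "Graph_Theory.Graph_Theory"
begin

text \<open>
  A finite simple graph is a \<open>pair_graph\<close>: a finite, loop-free, symmetric digraph whose arcs are
  pairs of vertices, so that every edge is represented by its two arcs. Thus \<open>out_degree\<close> is the
  usual degree, and \<open>sccs\<close> is the set of connected components.
\<close>

definition max_degree :: "'a pair_pre_digraph \<Rightarrow> nat" where
  "max_degree G = Max (out_degree G ` pverts G)"

definition min_degree :: "'a pair_pre_digraph \<Rightarrow> nat" where
  "min_degree G = Min (out_degree G ` pverts G)"

definition regular :: "nat \<Rightarrow> 'a pair_pre_digraph \<Rightarrow> bool" where
  "regular r G \<longleftrightarrow> (\<forall>v \<in> pverts G. out_degree G v = r)"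

definition bipartition :: "'a pair_pre_digraph \<Rightarrow> 'a set \<Rightarrow> 'a set \<Rightarrow> bool" where
  "bipartition G A B \<longleftrightarrow>
     pverts G = A \<union> B \<and> A \<inter> B = {} \<and> parcs G \<subseteq> A \<times> B \<union> B \<times> A"

definition bip_subgraph :: "'a pair_pre_digraph \<Rightarrow> 'a set \<Rightarrow> 'a set \<Rightarrow> 'a pair_pre_digraph" where
  "bip_subgraph G X Y =
     \<lparr>pverts = X \<union> Y, parcs = parcs G \<inter> (X \<times> Y \<union> Y \<times> X)\<rparr>"

definition iso_onto ::
  "('a, 'b, 'c, 'd) digraph_isomorphism \<Rightarrow> ('a, 'b) pre_digraph \<Rightarrow> ('c, 'd) pre_digraph \<Rightarrow> bool" where
  "iso_onto h G H \<longleftrightarrow> pre_digraph.digraph_isomorphism G h \<and> H = app_iso h G"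

definition adj_matrix :: "'a pair_pre_digraph \<Rightarrow> 'a list \<Rightarrow> real mat" where
  "adj_matrix G vs = mat (length vs) (length vs)
     (\<lambda>(i, j). if (vs ! i, vs ! j) \<in> parcs G then 1 else 0)"

text \<open>
  The characteristic polynomial does not depend on the enumeration of the vertices, and it splits
  over the reals because the matrix is symmetric: the multiset below consists of all eigenvalues
  with their multiplicities.
\<close>

definition adj_eigenvalues :: "'a pair_pre_digraph \<Rightarrow> real multiset" where
  "adj_eigenvalues G =
     proots (char_poly (adj_matrix G (SOME vs. distinct vs \<and> set vs = pverts G)))"

definition second_abs_eigenvalue :: "'a pair_pre_digraph \<Rightarrow> real" where
  "second_abs_eigenvalue G =
     rev (sorted_list_of_multiset (image_mset abs (adj_eigenvalues G))) ! 1"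

definition ramanujan :: "nat \<Rightarrow> 'a pair_pre_digraph \<Rightarrow> bool" where
  "ramanujan r U \<longleftrightarrow>
     pair_graph U \<and> regular r U \<and> (\<nexists>A B. bipartition U A B) \<and>
     second_abs_eigenvalue U \<le> 2 * sqrt (real r - 1)"

definition ramanujan_seq :: "nat \<Rightarrow> (nat \<Rightarrow> 'a pair_pre_digraph) \<Rightarrow> bool" where
  "ramanujan_seq r U \<longleftrightarrow>
     (\<forall>i. ramanujan r (U i)) \<and> strict_mono (\<lambda>i. card (pverts (U i)))"

text \<open>The copies \<open>x\<^sub>1\<close> and \<open>x\<^sub>2\<close> of a vertex \<open>x\<close> are \<open>Inl x\<close> and \<open>Inr x\<close>.\<close>

definition F_graph :: "'a pair_pre_digraph \<Rightarrow> ('a + 'a) pair_pre_digraph" where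
  "F_graph U =
     (let E = {(Inl x, Inr y) | x y. (x, y) \<in> parcs U} \<union> {(Inl x, Inr x) | x. x \<in> pverts U}
      in \<lparr>pverts = Inl ` pverts U \<union> Inr ` pverts U, parcs = E \<union> E\<inverse>\<rparr>)"

text \<open>
  For \<open>t \<ge> 1\<close>: the path \<open>0, \<dots>, t - 1\<close> with leaves \<open>t, \<dots>, t + m - 1\<close> attached to its last vertex
  \<open>t - 1\<close>. The first vertex is \<open>0\<close>.
\<close>

definition broom :: "nat \<Rightarrow> nat \<Rightarrow> nat pair_pre_digraph" where
  "broom t m =
     (let E = {(i, Suc i) | i. Suc i < t} \<union> {(t - 1, j) | j. t \<le> j \<and> j < t + m}
      in \<lparr>pverts = {..<t + m}, parcs = E \<union> E\<inverse>\<rparr>)"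

definition gam :: "nat \<Rightarrow> real" where
  "gam r = 1 / (8 * real r * 2 ^ r)"

text \<open>
  \<open>H_class C r t U n\<close> consists of the \<open>n\<close>-vertex elements of the class built from the sequence
  \<open>U\<close> of \<open>r\<close>-regular Ramanujan graphs; \<open>C\<close> is the implied constant of \<open>\<Delta>(H) = O(r 2\<^sup>r)\<close>.
  The function \<open>first\<close> selects the first vertex of each component of \<open>H - S\<close>. It has to be chosen
  once for all conditions, since for \<open>t = 2\<close> the component alone does not determine it.
\<close>

definition H_class ::
  "real \<Rightarrow> nat \<Rightarrow> nat \<Rightarrow> (nat \<Rightarrow> 'c pair_pre_digraph) \<Rightarrow> nat \<Rightarrow> 'b pair_pre_digraph set" where
  "H_class C r t U n = {H. pair_graph H \<and> card (pverts H) = n \<and>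
     (\<exists>A B. bipartition H A B) \<and>
     real (max_degree H) \<le> C * real r * 2 ^ r \<and>
     (\<exists>i S\<^sub>A S\<^sub>B.
        let k = (\<lambda>j. card (pverts (U j)));
            S = S\<^sub>A \<union> S\<^sub>B;
            comps = pre_digraph.sccs (with_proj H \<restriction> (pverts H - S))
        in
          2 * real (k i) \<le> gam r * real n \<and>
          (\<forall>j. 2 * real (k j) \<le> gam r * real n \<longrightarrow> k j \<le> k i) \<and>
          S \<subseteq> pverts H \<and> S\<^sub>A \<inter> S\<^sub>B = {} \<and> card S\<^sub>A = k i \<and> card S\<^sub>B = k i \<and>
          arcs (with_proj H \<restriction> S\<^sub>A) = {} \<and> arcs (with_proj H \<restriction> S\<^sub>B) = {} \<and>
          (\<exists>h. iso_onto h (with_proj (F_graph (U i))) (with_proj (bip_subgraph H S\<^sub>A S\<^sub>B)) \<and>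
               iso_verts h ` Inl ` pverts (U i) = S\<^sub>A \<and>
               iso_verts h ` Inr ` pverts (U i) = S\<^sub>B) \<and>
          card comps = card S \<and>
          (\<exists>first.
             (\<forall>K \<in> comps. \<exists>h. iso_onto h (with_proj (broom t (max_degree H - 1))) K \<and>
                               iso_verts h 0 = first K) \<and>
             (\<forall>x \<in> S. \<exists>K \<in> comps. {y \<in> pverts H - S. (x, y) \<in> parcs H} = {first K}) \<and>
             (\<forall>K \<in> comps. \<exists>!x. x \<in> S \<and> (x, first K) \<in> parcs H)))}"

end

theory Submission
  imports Defs "HOL-Real_Asymp.Real_Asymp"
begin

text \<open>
  A graph \<open>H\<close> of the class consists of an \<open>(r + 1)\<close>-regular bipartite graph on a set \<open>S\<close> with
  \<open>card S \<le> gam r * n\<close>, and of one broom hanging from each vertex of \<open>S\<close>. If \<open>d\<close> is the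
  number of leaves of a broom, then \<open>n = card S * (1 + t + d)\<close>, where \<open>d\<close> is bounded and \<open>t\<close> is
  arbitrary. Every vertex of \<open>G\<close> has at least \<open>(1/2 + \<eta>) * n\<close> neighbours, where
  \<open>\<eta> = 3 * root 3 (gam r)\<close>; so \<open>card S\<close> is much smaller than \<open>\<eta> * n\<close>, which in turn is a lower
  bound for the number of common neighbours of any two vertices. The embedding has two stages.

  First, the bipartite graph is embedded somewhere in \<open>G\<close> (\<open>embed_bipartite\<close>). The argument is
  that of Fox and Sudakov: dependent random choice yields a set \<open>A\<close> in which almost all sequences
  of \<open>r + 1\<close> vertices have many common neighbours; one side goes into \<open>A\<close>, so that
  all neighbourhoods of vertices of the other side receive such images, and the other side follows
  greedily. Since the two sides together have at most \<open>n / (8 * r * 2 ^ r)\<close> vertices, there is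
  enough room.

  Secondly, the brooms are attached to the image of \<open>S\<close>, which is an arbitrary set of roots, so
  that they use up all remaining vertices (\<open>attach_brooms\<close>). The tool is that a large vertex set can
  be split into equal parts in which every vertex has the expected number of neighbours, up to a
  small error, as soon as the parts have size at least a constant times \<open>ln n\<close>
  (\<open>equitable_partition\<close>). In place of probability, the choices are made one by one by the method
  of multiplicative weights (\<open>multiplicative_weights\<close>). There are three cases.

  \<^item> \<open>card S\<close> is large and \<open>t \<ge> 2\<close>: the remaining vertices are split into layers of size
    \<open>card S\<close>, one layer for each vertex of the broom. Any two layers have a perfect matching, by the
    theorem of Hall and the surplus in the degrees. Only the first vertices of the paths are
    chosen differently, as common neighbours of the roots and the second vertices
    (\<open>brooms_by_layers\<close>).

  \<^item> \<open>card S\<close> is large and \<open>t = 1\<close>: now the centres of the stars must themselves be neighbours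
    of the roots, and a vertex may have very few neighbours within the neighbourhood of a root. The
    centres are drawn from a distribution which favours the neighbours of such vertices
    (\<open>balanced_donor\<close>); again the theorem of Hall distributes the leaves (\<open>stars_at_roots\<close>).

  \<^item> \<open>card S\<close> is at most a constant times \<open>ln n\<close>: then the leaves are few and the paths are long.
    Last vertices and leaves are chosen greedily, the rest is split into \<open>card S\<close> parts,
    and each part is traversed by a Hamiltonian path between prescribed ends
    (\<open>brooms_by_hamilton_paths\<close>).
\<close>

section \<open>Systems of distinct representatives\<close>

text \<open>
  Hall's theorem, by the induction of Halmos and Vaughan: if some proper nonempty subfamily is
  tight, its representatives and those of the remaining sets (minus the union of the tight family)
  are found separately; otherwise any representative of one set can be removed without violating
  the condition for the others.
\<close>

theorem hall:
  assumes "finite I" and "\<And>i. i \<in> I \<Longrightarrow> finite (A i)"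
    and "\<And>J. J \<subseteq> I \<Longrightarrow> card J \<le> card (\<Union>(A ` J))"
  shows "\<exists>R. inj_on R I \<and> (\<forall>i\<in>I. R i \<in> A i)"
  using assms
proof (induction "card I" arbitrary: I A rule: less_induct)
  case less
  note fin = less.prems(1) and finA = less.prems(2) and hc = less.prems(3)
  show ?case
  proof (cases "I = {}")
    case True
    then show ?thesis by simp
  next
    case False
    then obtain x where x: "x \<in> I" by blast
    show ?thesis
    proof (cases "\<exists>J. J \<subset> I \<and> J \<noteq> {} \<and> card J = card (\<Union>(A ` J))")
      case True
      then obtain J where J: "J \<subset> I" "J \<noteq> {}" "card J = card (\<Union>(A ` J))" by blast
      have finJ: "finite J" using J fin by (meson finite_subset psubsetE)
      let ?U = "\<Union>(A ` J)"
      have finU: "finite ?U" using finJ finA J by auto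
      have "\<exists>R. inj_on R J \<and> (\<forall>i\<in>J. R i \<in> A i)"
      proof (rule less.hyps)
        show "card J < card I" by (rule psubset_card_mono[OF fin J(1)])
        show "finite J" by (rule finJ)
        show "finite (A i)" if "i \<in> J" for i using that J(1) finA by blast
        show "card K \<le> card (\<Union>(A ` K))" if "K \<subseteq> J" for K using that J(1) hc by blast
      qed
      then obtain R1 where R1: "inj_on R1 J" "\<forall>i\<in>J. R1 i \<in> A i" by blast
      have "\<exists>R. inj_on R (I - J) \<and> (\<forall>i\<in>I - J. R i \<in> A i - ?U)"
      proof (rule less.hyps)
        show "card (I - J) < card I" using J fin by (intro psubset_card_mono) auto
        show "finite (I - J)" using fin by simp
        show "finite (A i - ?U)" if "i \<in> I - J" for i using finA that by simp
        fix K assume K: "K \<subseteq> I - J"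
        have finK: "finite K" using K fin finite_subset by blast
        have finKU: "finite (\<Union>(A ` K))" using finK finA K by auto
        have "card (K \<union> J) \<le> card (\<Union>(A ` (K \<union> J)))" using K J by (intro hc) auto
        also have "\<Union>(A ` (K \<union> J)) = (\<Union>i\<in>K. A i - ?U) \<union> ?U" by auto
        also have "card \<dots> = card (\<Union>i\<in>K. A i - ?U) + card ?U"
          using finU finKU by (intro card_Un_disjoint) (auto intro: rev_finite_subset[OF finKU])
        finally show "card K \<le> card (\<Union>i\<in>K. A i - ?U)"
          using J(3) K finK finJ by (subst (asm) card_Un_disjoint) auto
      qed
      then obtain R2 where R2: "inj_on R2 (I - J)" "\<forall>i\<in>I - J. R2 i \<in> A i - ?U" by blast
      let ?R = "\<lambda>i. if i \<in> J then R1 i else R2 i"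
      have "?R i \<noteq> ?R j" if "i \<in> J" "j \<in> I - J" for i j
        using R1(2) R2(2) that by (metis DiffD2 UN_I)
      then have "inj_on ?R I"
        using inj_onD[OF R1(1)] inj_onD[OF R2(1)] by (intro inj_onI) (metis DiffI)
      moreover have "\<forall>i\<in>I. ?R i \<in> A i" using R1 R2 by auto
      ultimately show ?thesis by blast
    next
      case False
      have "card {x} \<le> card (\<Union>(A ` {x}))" using x by (intro hc) auto
      then obtain a where a: "a \<in> A x" by fastforce
      have "\<exists>R. inj_on R (I - {x}) \<and> (\<forall>i\<in>I - {x}. R i \<in> A i - {a})"
      proof (rule less.hyps)
        show "card (I - {x}) < card I" using x fin by (meson card_Diff1_less)
        show "finite (I - {x})" using fin by simp
        show "finite (A i - {a})" if "i \<in> I - {x}" for i using finA that by simp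
        fix K assume K: "K \<subseteq> I - {x}"
        show "card K \<le> card (\<Union>i\<in>K. A i - {a})"
        proof (cases "K = {}")
          case False
          have finK: "finite K" using K fin finite_subset by blast
          have fU: "finite (\<Union>(A ` K))" using finK finA K by auto
          have "card K \<noteq> card (\<Union>(A ` K))" using K x False \<open>\<nexists>J. _ J\<close> by blast
          moreover have "card K \<le> card (\<Union>(A ` K))" using K by (intro hc) auto
          ultimately have "card K < card (\<Union>(A ` K))" by simp
          moreover have "card (\<Union>(A ` K)) \<le> card (insert a (\<Union>i\<in>K. A i - {a}))"
            by (intro card_mono) (auto intro: rev_finite_subset[OF fU])
          moreover have "card (insert a (\<Union>i\<in>K. A i - {a})) \<le> Suc (card (\<Union>i\<in>K. A i - {a}))"
            by (rule card_insert_le_m1) simp_all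
          ultimately show ?thesis by linarith
        qed simp
      qed
      then obtain R where R: "inj_on R (I - {x})" "\<forall>i\<in>I - {x}. R i \<in> A i - {a}" by blast
      then have "inj_on (R(x := a)) I" by (auto simp: inj_on_def)
      moreover have "\<forall>i\<in>I. (R(x := a)) i \<in> A i" using R a by auto
      ultimately show ?thesis by blast
    qed
  qed
qed

text \<open>The greedy choice of distinct vertices from sets that are never exhausted.\<close>

lemma sdr_of_large_sets:
  assumes "finite I" and "\<And>i. i \<in> I \<Longrightarrow> finite (A i)" and "\<And>i. i \<in> I \<Longrightarrow> card I \<le> card (A i)"
  shows "\<exists>R. inj_on R I \<and> (\<forall>i\<in>I. R i \<in> A i)"
proof (rule hall)
  fix J assume J: "J \<subseteq> I"
  show "card J \<le> card (\<Union>(A ` J))"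
  proof (cases "J = {}")
    case False
    then obtain i where i: "i \<in> J" by blast
    have "card J \<le> card I" using J assms(1) by (intro card_mono)
    also have "\<dots> \<le> card (A i)" using i J assms(3) by blast
    also have "\<dots> \<le> card (\<Union>(A ` J))"
      using i J assms finite_subset[OF J] by (intro card_mono) auto
    finally show ?thesis .
  qed simp
qed (use assms in auto)

text \<open>
  A set of more than half of the left side sees the whole right side, because every vertex there
  misses at most half of the left side.
\<close>

lemma perfect_matching_of_half_degrees:
  assumes "sym E" and "finite X" and "finite Y" and "card X = card Y"
    and X: "\<And>x. x \<in> X \<Longrightarrow> card Y \<le> 2 * card (E `` {x} \<inter> Y)"
    and Y: "\<And>y. y \<in> Y \<Longrightarrow> card X \<le> 2 * card (E `` {y} \<inter> X)"
  shows "\<exists>f. bij_betw f X Y \<and> (\<forall>x\<in>X. (x, f x) \<in> E)"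
proof -
  have "\<exists>f. inj_on f X \<and> (\<forall>x\<in>X. f x \<in> E `` {x} \<inter> Y)"
  proof (rule hall)
    fix J assume J: "J \<subseteq> X"
    let ?U = "\<Union>x\<in>J. E `` {x} \<inter> Y"
    have finJ: "finite J" using J assms finite_subset by blast
    have finU: "finite ?U" using assms(3) by (auto intro: rev_finite_subset)
    show "card J \<le> card ?U"
    proof (cases "2 * card J \<le> card X")
      case True
      show ?thesis
      proof (cases "J = {}")
        case False
        then obtain x where x: "x \<in> J" by blast
        have "card Y \<le> 2 * card (E `` {x} \<inter> Y)" using X x J by blast
        moreover have "card (E `` {x} \<inter> Y) \<le> card ?U"
          using x finU by (intro card_mono) auto
        ultimately show ?thesis using True assms(4) by linarith
      qed simp
    next
      case False
      have "Y \<subseteq> ?U"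
      proof
        fix y assume y: "y \<in> Y"
        have "(E `` {y} \<inter> X) \<inter> J \<noteq> {}"
        proof
          assume "(E `` {y} \<inter> X) \<inter> J = {}"
          then have "card (E `` {y} \<inter> X) + card J = card ((E `` {y} \<inter> X) \<union> J)"
            using assms finJ by (intro card_Un_disjoint[symmetric]) auto
          also have "\<dots> \<le> card X" using J assms by (intro card_mono) auto
          finally show False using Y[OF y] False by linarith
        qed
        then show "y \<in> ?U" using y \<open>sym E\<close> by (auto dest: symD)
      qed
      then have "card Y \<le> card ?U" using finU by (intro card_mono)
      then show ?thesis using card_mono[OF assms(2) J] assms(4) by linarith
    qed
  qed (use assms in auto)
  then obtain f where f: "inj_on f X" "\<forall>x\<in>X. f x \<in> E `` {x} \<inter> Y" by blast
  have "f ` X = Y"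
    using f assms by (intro card_subset_eq) (auto simp: card_image)
  with f show ?thesis by (auto simp: bij_betw_def)
qed

section \<open>Derandomised concentration\<close>

lemma exp_le_quadratic:
  fixes x :: real
  assumes "\<bar>x\<bar> \<le> 1"
  shows "exp x \<le> 1 + x + x\<^sup>2"
proof (cases "x \<ge> 0")
  case True
  then show ?thesis using assms exp_bound[of x] by simp
next
  case False
  have "1 \<le> (1 - x) * (1 + x + x\<^sup>2)"
  proof -
    have "(1 - x) * (1 + x + x\<^sup>2) = 1 - x * x\<^sup>2" by (simp add: algebra_simps power2_eq_square)
    moreover have "x * x\<^sup>2 \<le> 0" using False by (intro mult_nonpos_nonneg) auto
    ultimately show ?thesis by simp
  qed
  also have "\<dots> \<le> exp (- x) * (1 + x + x\<^sup>2)"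
    using exp_ge_add_one_self[of "- x"] assms by (intro mult_right_mono) auto
  finally show ?thesis by (simp add: exp_minus field_simps)
qed

text \<open>
  The method of multiplicative weights, which replaces a Chernoff bound and a union bound. A state
  is built in \<open>m\<close> steps, and each step changes the account \<open>A v\<close> of every test \<open>v\<close> by at
  most \<open>1\<close>. The hypothesis asks that, for every nonnegative weighting of the tests, some step has
  nonnegative weighted gain; it holds as soon as a random step has mean gain zero at every test.
  With \<open>\<lambda> = \<epsilon> / 2\<close> and the weights \<open>exp (- \<lambda> * A v)\<close>, the potential \<open>\<Sum>v. exp (- \<lambda> * A v)\<close> then
  grows by a factor of at most \<open>1 + \<lambda>\<^sup>2\<close> per step, so that no account ends far below zero.
  The steps may depend on the history, for instance in order to avoid vertices used before.
\<close>

lemma multiplicative_weights: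
  fixes Q :: "nat \<Rightarrow> 's \<Rightarrow> ('i \<Rightarrow> real) \<Rightarrow> bool"
  assumes fin: "finite I" and \<epsilon>: "0 < \<epsilon>" "\<epsilon> \<le> 1"
    and m: "4 * ln (real (card I)) \<le> \<epsilon>\<^sup>2 * real m"
    and start: "Q 0 s\<^sub>0 (\<lambda>_. 0)"
    and step: "\<And>j s A y. j < m \<Longrightarrow> Q j s A \<Longrightarrow> (\<And>v. v \<in> I \<Longrightarrow> 0 \<le> y v) \<Longrightarrow>
      \<exists>s' g. Q (Suc j) s' (\<lambda>v. A v + g v) \<and> (\<forall>v\<in>I. \<bar>g v\<bar> \<le> 1) \<and> 0 \<le> (\<Sum>v\<in>I. y v * g v)"
  shows "\<exists>s A. Q m s A \<and> (\<forall>v\<in>I. - (\<epsilon> * real m) \<le> A v)"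
proof -
  define l where "l = \<epsilon> / 2"
  have l: "0 < l" "l \<le> 1" using \<epsilon> by (auto simp: l_def)
  have "\<exists>s A. Q j s A \<and> (\<Sum>v\<in>I. exp (- l * A v)) \<le> real (card I) * (1 + l\<^sup>2) ^ j" if "j \<le> m" for j
    using that
  proof (induction j)
    case 0
    then show ?case using start by (intro exI[of _ s\<^sub>0] exI[of _ "\<lambda>_. 0"]) simp
  next
    case (Suc j)
    then obtain s A where sA: "Q j s A" "(\<Sum>v\<in>I. exp (- l * A v)) \<le> real (card I) * (1 + l\<^sup>2) ^ j"
      by auto
    obtain s' g where g: "Q (Suc j) s' (\<lambda>v. A v + g v)" "\<forall>v\<in>I. \<bar>g v\<bar> \<le> 1"
      "0 \<le> (\<Sum>v\<in>I. exp (- l * A v) * g v)"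
      using step[OF _ sA(1), of "\<lambda>v. exp (- l * A v)"] Suc.prems by auto
    have "(\<Sum>v\<in>I. exp (- l * (A v + g v))) \<le> (\<Sum>v\<in>I. exp (- l * A v) * (1 - l * g v + l\<^sup>2))"
    proof (rule sum_mono)
      fix v assume v: "v \<in> I"
      have le: "\<bar>- l * g v\<bar> \<le> 1" using g(2) v l by (auto simp: abs_mult intro: mult_le_one)
      have "(l * g v)\<^sup>2 \<le> l\<^sup>2"
        using g(2) v l by (auto simp: power_mult_distrib abs_le_square_iff[symmetric]
            intro!: mult_left_le simp flip: abs_square_le_1)
      then have "exp (- l * g v) \<le> 1 - l * g v + l\<^sup>2"
        using exp_le_quadratic[OF le] by simp
      then have "exp (- l * A v) * exp (- l * g v) \<le> exp (- l * A v) * (1 - l * g v + l\<^sup>2)"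
        by (intro mult_left_mono) auto
      then show "exp (- l * (A v + g v)) \<le> exp (- l * A v) * (1 - l * g v + l\<^sup>2)"
        by (simp only: distrib_left exp_add)
    qed
    also have "\<dots> = (1 + l\<^sup>2) * (\<Sum>v\<in>I. exp (- l * A v)) - l * (\<Sum>v\<in>I. exp (- l * A v) * g v)"
      by (simp add: algebra_simps sum.distrib sum_subtractf sum_distrib_left)
    also have "\<dots> \<le> (1 + l\<^sup>2) * (\<Sum>v\<in>I. exp (- l * A v))" using g(3) l by simp
    also have "\<dots> \<le> (1 + l\<^sup>2) * (real (card I) * (1 + l\<^sup>2) ^ j)"
      using sA(2) by (intro mult_left_mono) auto
    finally show ?case using g(1) by (intro exI[of _ s'] exI[of _ "\<lambda>v. A v + g v"])
        (simp add: algebra_simps)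
  qed
  then obtain s A where sA: "Q m s A" "(\<Sum>v\<in>I. exp (- l * A v)) \<le> real (card I) * (1 + l\<^sup>2) ^ m"
    by blast
  have "- (\<epsilon> * real m) \<le> A v" if v: "v \<in> I" for v
  proof -
    have c: "0 < real (card I)" using v fin card_gt_0_iff by auto
    have "exp (- l * A v) \<le> (\<Sum>v\<in>I. exp (- l * A v))" using v fin by (intro member_le_sum) auto
    also note sA(2)
    also have "real (card I) * (1 + l\<^sup>2) ^ m \<le> exp (ln (real (card I))) * exp (l\<^sup>2) ^ m"
      using c by (intro mult_mono power_mono) auto
    also have "\<dots> = exp (ln (real (card I)) + l\<^sup>2 * real m)"
      by (simp add: exp_add exp_of_nat_mult mult.commute)
    finally have "- l * A v \<le> ln (real (card I)) + l\<^sup>2 * real m" by simp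
    also have "\<dots> \<le> l * (\<epsilon> * real m)"
      using m by (simp add: l_def power2_eq_square field_simps)
    finally have "l * (- (\<epsilon> * real m)) \<le> l * A v" by simp
    then show ?thesis using l by (simp only: mult_le_cancel_left_pos)
  qed
  then show ?thesis using sA(1) by blast
qed

lemma bij_betw_shift_mod:
  assumes "0 < (q::nat)"
  shows "bij_betw (\<lambda>s. (s + k) mod q) {..<q} {..<q}"
proof -
  have *: "x = y" if "x \<le> y" "y < q" "(y + k) mod q = (x + k) mod q" for x y
  proof -
    have "q dvd (y + k) - (x + k)" using that by (subst mod_eq_dvd_iff_nat[symmetric]) auto
    then have "q dvd y - x" by simp
    then show ?thesis using that by (auto dest: dvd_imp_le)
  qed
  have inj: "inj_on (\<lambda>s. (s + k) mod q) {..<q}"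
  proof (rule inj_onI)
    fix x y assume "x \<in> {..<q}" "y \<in> {..<q}" "(x + k) mod q = (y + k) mod q"
    then show "x = y" using *[of x y] *[of y x] by (cases "x \<le> y") auto
  qed
  then have "(\<lambda>s. (s + k) mod q) ` {..<q} = {..<q}"
    using assms by (intro card_subset_eq) (auto simp: card_image)
  with inj show ?thesis by (simp add: bij_betw_def)
qed

text \<open>
  A set of \<open>q * M\<close> vertices is cut into \<open>M\<close> blocks of size \<open>q\<close>. Each block is shifted cyclically
  by some amount, and the part \<open>p\<close> collects the vertices that arrive at position \<open>p\<close>. Over all
  shifts of a block, the mean number of neighbours of a vertex at position \<open>p\<close> is its density in
  the block. So suitable shifts spread every neighbourhood evenly.
\<close>

lemma equitable_partition:
  fixes E :: "('a \<times> 'a) set"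
  assumes fin: "finite X" and X: "card X = q * M" and q: "q > 0"
    and W: "finite W" and \<epsilon>: "0 < \<epsilon>" "\<epsilon> \<le> 1"
    and M: "4 * ln (real (card W * q)) \<le> \<epsilon>\<^sup>2 * real M"
  obtains P where "\<And>p. p < q \<Longrightarrow> P p \<subseteq> X" and "(\<Union>p<q. P p) = X"
    and "\<And>p p'. p < q \<Longrightarrow> p' < q \<Longrightarrow> p \<noteq> p' \<Longrightarrow> P p \<inter> P p' = {}"
    and "\<And>p. p < q \<Longrightarrow> card (P p) = M"
    and "\<And>v p. v \<in> W \<Longrightarrow> p < q \<Longrightarrow>
      real (card (E `` {v} \<inter> X)) / real q - \<epsilon> * real M \<le> real (card (E `` {v} \<inter> P p))"
proof -
  obtain e where e: "bij_betw e {..<q * M} X"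
    using ex_bij_betw_nat_finite[OF fin] X by (auto simp: atLeast0LessThan)
  define b where "b i p = e (i * q + p)" for i p
  have idx: "i * q + p < q * M" if "i < M" "p < q" for i p
  proof -
    have "i * q + p < i * q + q" using that by simp
    also have "\<dots> = (i + 1) * q" by simp
    also have "\<dots> \<le> M * q" using that by (intro mult_right_mono) auto
    finally show ?thesis by (simp add: mult.commute)
  qed
  have b_inj: "i = i' \<and> p = p'" if "b i p = b i' p'" "i < M" "p < q" "i' < M" "p' < q" for i p i' p'
  proof -
    have "i * q + p = i' * q + p'"
      using that(1) idx[OF that(2,3)] idx[OF that(4,5)] e unfolding b_def bij_betw_def
      by (intro inj_onD[of e]) auto
    moreover have "(i * q + p) div q = i" "(i * q + p) mod q = p"
      "(i' * q + p') div q = i'" "(i' * q + p') mod q = p'"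
      using that by auto
    ultimately show ?thesis by metis
  qed
  have b_in: "b i p \<in> X" if "i < M" "p < q" for i p
    using idx[OF that] e unfolding b_def bij_betw_def by auto
  have b_surj: "\<exists>i<M. \<exists>p<q. x = b i p" if x: "x \<in> X" for x
  proof -
    obtain k where k: "k < q * M" "x = e k" using x e by (auto simp: bij_betw_def)
    have "k div q < M" using k q by (simp add: less_mult_imp_div_less mult.commute)
    moreover have "k mod q < q" using q by simp
    moreover have "x = b (k div q) (k mod q)" using k by (simp add: b_def)
    ultimately show ?thesis by blast
  qed
  define N where "N v i = card {p. p < q \<and> (v, b i p) \<in> E}" for v i
  define G where "G s = (\<lambda>i (v, p). of_bool ((v, b i ((p + s i) mod q)) \<in> E) - real (N v i) / real q)"
    for s :: "nat \<Rightarrow> nat"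
  define Q where "Q j s A \<longleftrightarrow> A = (\<lambda>vp. \<Sum>i<j. G s i vp)" for j s A
  let ?I = "W \<times> {..<q}"
  have N_le: "N v i \<le> q" for v i
    unfolding N_def using card_mono[of "{..<q}" "{p. p < q \<and> (v, b i p) \<in> E}"] by auto
  have shift_sum: "(\<Sum>s<q. f ((p + s) mod q)) = (\<Sum>s<q. f s)" for f :: "nat \<Rightarrow> real" and p
    by (rule sum.reindex_bij_betw) (use bij_betw_shift_mod[OF q, of p] in \<open>simp add: add.commute\<close>)
  have "\<exists>s A. Q M s A \<and> (\<forall>v\<in>?I. - (\<epsilon> * real M) \<le> A v)"
  proof (rule multiplicative_weights)
    show "finite ?I" using W by simp
    show "4 * ln (real (card ?I)) \<le> \<epsilon>\<^sup>2 * real M" using M by (simp add: card_cartesian_product)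
    show "Q 0 (\<lambda>_. 0) (\<lambda>_. 0)" by (simp add: Q_def)
    fix j s A and y :: "'a \<times> nat \<Rightarrow> real"
    assume j: "j < M" and Q: "Q j s A" and y: "\<And>v. v \<in> ?I \<Longrightarrow> 0 \<le> y v"
    have mean: "(\<Sum>t<q. G (s(j := t)) j vp) = 0" for vp
    proof -
      obtain v p where vp: "vp = (v, p)" by force
      have "(\<Sum>t<q. of_bool ((v, b j ((p + t) mod q)) \<in> E)) = (\<Sum>t<q. of_bool ((v, b j t) \<in> E) :: real)"
        by (rule shift_sum)
      also have "\<dots> = real (N v j)"
        by (auto simp: N_def of_bool_def sum.If_cases intro!: arg_cong[of _ _ card])
      finally show ?thesis using q by (simp add: vp G_def sum_subtractf)
    qed
    have "(\<Sum>t<q. \<Sum>vp\<in>?I. y vp * G (s(j := t)) j vp) = (\<Sum>vp\<in>?I. y vp * (\<Sum>t<q. G (s(j := t)) j vp))"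
      by (subst sum.swap) (simp add: sum_distrib_left)
    also have "\<dots> = 0" using mean by simp
    finally have z: "(\<Sum>t<q. \<Sum>vp\<in>?I. y vp * G (s(j := t)) j vp) = 0" .
    have "\<exists>t<q. 0 \<le> (\<Sum>vp\<in>?I. y vp * G (s(j := t)) j vp)"
    proof (rule ccontr)
      assume "\<not> ?thesis"
      then have "(\<Sum>t<q. \<Sum>vp\<in>?I. y vp * G (s(j := t)) j vp) < (\<Sum>t<q. 0)"
        using q by (intro sum_strict_mono) (auto simp: not_le)
      then show False using z by simp
    qed
    then obtain t where t: "0 \<le> (\<Sum>vp\<in>?I. y vp * G (s(j := t)) j vp)" by blast
    have "(\<Sum>i<j. G (s(j := t)) i vp) = (\<Sum>i<j. G s i vp)" for vp
      by (intro sum.cong) (auto simp: G_def split: prod.splits)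
    then have "Q (Suc j) (s(j := t)) (\<lambda>vp. A vp + G (s(j := t)) j vp)"
      using Q by (simp add: Q_def fun_eq_iff)
    moreover have "\<bar>G (s(j := t)) j vp\<bar> \<le> 1" for vp
    proof -
      obtain v p where vp: "vp = (v, p)" by force
      have "real (N v j) / real q \<le> 1" "0 \<le> real (N v j) / real q" using N_le q by auto
      then show ?thesis by (auto simp: G_def vp)
    qed
    ultimately show "\<exists>s' g. Q (Suc j) s' (\<lambda>v. A v + g v) \<and> (\<forall>v\<in>?I. \<bar>g v\<bar> \<le> 1) \<and>
        0 \<le> (\<Sum>v\<in>?I. y v * g v)" using t by blast
  qed (use \<epsilon> in auto)
  then obtain s where s: "\<And>v p. v \<in> W \<Longrightarrow> p < q \<Longrightarrow> - (\<epsilon> * real M) \<le> (\<Sum>i<M. G s i (v, p))"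
    unfolding Q_def by fastforce
  define P where "P p = (\<lambda>i. b i ((p + s i) mod q)) ` {..<M}" for p
  have inj: "inj_on (\<lambda>i. b i ((p + s i) mod q)) {..<M}" for p
    using b_inj q by (auto intro!: inj_onI)
  have mod_surj: "\<exists>p<q. (p + k) mod q = r" if "r < q" for k r
    using bij_betw_shift_mod[OF q, of k] that unfolding bij_betw_def
    by (metis (no_types, lifting) imageE lessThan_iff)
  show thesis
  proof (rule that)
    show sub: "P p \<subseteq> X" if "p < q" for p using b_in q by (auto simp: P_def)
    show "(\<Union>p<q. P p) = X"
    proof
      show "X \<subseteq> (\<Union>p<q. P p)"
      proof
        fix x assume "x \<in> X"
        then obtain i r where ir: "i < M" "r < q" "x = b i r" using b_surj by blast
        obtain p where "p < q" "(p + s i) mod q = r" using mod_surj[OF ir(2)] by blast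
        then show "x \<in> (\<Union>p<q. P p)" using ir by (auto simp: P_def)
      qed
    qed (use sub in auto)
    show "P p \<inter> P p' = {}" if pp: "p < q" "p' < q" "p \<noteq> p'" for p p'
    proof (rule ccontr)
      assume "P p \<inter> P p' \<noteq> {}"
      then obtain i i' where i: "i < M" "i' < M" "b i ((p + s i) mod q) = b i' ((p' + s i') mod q)"
        by (auto simp: P_def)
      then have "i = i'" "(p + s i) mod q = (p' + s i') mod q" using b_inj q by auto
      then have "p = p'"
        using inj_onD[OF bij_betw_imp_inj_on[OF bij_betw_shift_mod[OF q, of "s i"]], of p p'] pp
        by blast
      then show False using pp by simp
    qed
    show "card (P p) = M" if "p < q" for p by (simp add: P_def card_image[OF inj])
    fix v p assume v: "v \<in> W" and p: "p < q"
    have "(\<Sum>i<M. N v i) = card (E `` {v} \<inter> X)"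
    proof -
      have "E `` {v} \<inter> X = (\<lambda>(i, p). b i p) ` (SIGMA i:{..<M}. {p. p < q \<and> (v, b i p) \<in> E})"
      proof safe
        fix x assume "x \<in> X" "(v, x) \<in> E"
        then show "x \<in> (\<lambda>(i, p). b i p) ` (SIGMA i:{..<M}. {p. p < q \<and> (v, b i p) \<in> E})"
          using b_surj[of x] by force
      qed (use b_in in auto)
      moreover have "inj_on (\<lambda>(i, p). b i p) (SIGMA i:{..<M}. {p. p < q \<and> (v, b i p) \<in> E})"
        using b_inj by (auto intro!: inj_onI)
      ultimately show ?thesis by (simp add: card_image card_SigmaI N_def)
    qed
    moreover have "(\<Sum>i<M. of_bool ((v, b i ((p + s i) mod q)) \<in> E) :: real) = real (card (E `` {v} \<inter> P p))"
    proof -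
      have "E `` {v} \<inter> P p = (\<lambda>i. b i ((p + s i) mod q)) ` {i. i < M \<and> (v, b i ((p + s i) mod q)) \<in> E}"
        by (auto simp: P_def)
      then have "card (E `` {v} \<inter> P p) = card {i. i < M \<and> (v, b i ((p + s i) mod q)) \<in> E}"
        using inj by (auto simp: card_image inj_on_def)
      then show ?thesis
        by (auto simp: of_bool_def sum.If_cases intro!: arg_cong[of _ _ card])
    qed
    ultimately have "(\<Sum>i<M. G s i (v, p)) =
        real (card (E `` {v} \<inter> P p)) - real (card (E `` {v} \<inter> X)) / real q"
      by (simp add: G_def sum_subtractf sum_divide_distrib[symmetric] flip: of_nat_sum)
    with s[OF v p] show "real (card (E `` {v} \<inter> X)) / real q - \<epsilon> * real M \<le> real (card (E `` {v} \<inter> P p))"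
      by simp
  qed
qed

section \<open>Hamiltonian paths between prescribed ends\<close>

text \<open>
  Reversing the segment between two steps of a path replaces these steps by the edges that join
  their first vertices and their last vertices.
\<close>

lemma rotate_bad_step:
  assumes E: "sym E" and xs: "distinct xs" "successively (\<lambda>x y. (x, y) \<in> insert (u, v) (insert (v, u) E)) xs"
    and i: "Suc i < length xs" "xs ! i = u" "xs ! Suc i = v"
    and k: "Suc k < length xs" "k \<noteq> i" "(u, xs ! k) \<in> E" "(v, xs ! Suc k) \<in> E"
  shows "\<exists>ys. distinct ys \<and> set ys = set xs \<and> hd ys = hd xs \<and> last ys = last xs \<and>
    successively (\<lambda>x y. (x, y) \<in> E) ys"
proof -
  let ?S = "successively (\<lambda>x y. (x, y) \<in> E)"
  have step: "(xs ! l, xs ! Suc l) \<in> E" if l: "Suc l < length xs" "l \<noteq> i" for l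
  proof -
    have "(xs ! l, xs ! Suc l) \<in> insert (u, v) (insert (v, u) E)"
      using xs(2) l by (auto simp: successively_conv_nth)
    moreover have "xs ! l \<noteq> u" using l i xs(1) nth_eq_iff_index_eq by fastforce
    moreover have "\<not> (xs ! l = v \<and> xs ! Suc l = u)"
    proof
      assume "xs ! l = v \<and> xs ! Suc l = u"
      then have "l = Suc i" "Suc l = i"
        using i l xs(1) nth_eq_iff_index_eq[of xs l "Suc i"] nth_eq_iff_index_eq[of xs "Suc l" i] by auto
      then show False by simp
    qed
    ultimately show ?thesis by auto
  qed
  \<comment> \<open>The segment \<open>R\<close> starts after the first vertex of the earlier step and ends with that of the later one.\<close>
  define j1 where "j1 = Suc (min k i)"
  define j2 where "j2 = Suc (max k i)"
  have j: "j1 < j2" "j2 < length xs" "0 < j1" using i k by (auto simp: j1_def j2_def)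
  define P where "P = take j1 xs"
  define R where "R = take (j2 - j1) (drop j1 xs)"
  define T where "T = drop j2 xs"
  have dec: "xs = P @ R @ T"
    using j by (simp add: P_def R_def T_def flip: drop_drop)
      (metis append_take_drop_id drop_drop le_add_diff_inverse2 less_imp_le)
  have ne: "P \<noteq> []" "R \<noteq> []" "T \<noteq> []" using j by (auto simp: P_def R_def T_def)
  have ends: "last P = xs ! (min k i)" "hd R = xs ! j1" "last R = xs ! (max k i)" "hd T = xs ! j2"
    using j ne by (auto simp: P_def R_def T_def last_conv_nth hd_conv_nth j1_def j2_def min_absorb2)
  have S: "?S P" "?S R" "?S T"
    using j step by (auto simp: successively_conv_nth P_def R_def T_def j1_def j2_def)
  have "(last P, last R) \<in> E \<and> (hd R, hd T) \<in> E"
  proof (cases "k < i")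
    case True
    then show ?thesis using ends k i E by (auto simp: j1_def j2_def dest: symD)
  next
    case False
    then show ?thesis using ends k i E by (auto simp: j1_def j2_def dest: symD)
  qed
  moreover have "?S (rev R)"
    using S(2) E by (auto simp: successively_rev elim!: successively_mono dest: symD)
  ultimately have "?S (P @ rev R @ T)"
    using S ne by (auto simp: successively_append_iff hd_rev last_rev)
  moreover have "distinct (P @ rev R @ T)" "set (P @ rev R @ T) = set xs"
    "hd (P @ rev R @ T) = hd xs" "last (P @ rev R @ T) = last xs"
    using xs(1) ne unfolding dec by auto
  ultimately show ?thesis by blast
qed

text \<open>
  The positions of neighbours of \<open>xs ! i\<close> and the positions just before neighbours of
  \<open>xs ! Suc i\<close> are too many to be disjoint.
\<close>

lemma crossing_neighbours:
  assumes "finite V" and xs: "distinct xs" "set xs = V"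
    and i: "Suc i < length xs" "(xs ! i, xs ! i) \<notin> E" "(xs ! Suc i, xs ! Suc i) \<notin> E"
    and deg: "card V + 1 \<le> card (E `` {xs ! i} \<inter> V) + card (E `` {xs ! Suc i} \<inter> V)"
  obtains k where "Suc k < length xs" "k \<noteq> i" "(xs ! i, xs ! k) \<in> E" "(xs ! Suc i, xs ! Suc k) \<in> E"
proof -
  let ?n = "length xs" and ?u = "xs ! i" and ?v = "xs ! Suc i"
  have n: "card V = ?n" using xs distinct_card by blast
  define Au where "Au = {k. Suc k < ?n \<and> (?u, xs ! k) \<in> E}"
  define Bv where "Bv = {k. Suc k < ?n \<and> (?v, xs ! Suc k) \<in> E}"
  have fin: "finite Au" "finite Bv"
    unfolding Au_def Bv_def by (rule finite_subset[of _ "{..<?n}"]; auto)+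
  have "E `` {?u} \<inter> V \<subseteq> insert (last xs) ((!) xs ` Au)"
  proof
    fix x assume x: "x \<in> E `` {?u} \<inter> V"
    then obtain k where k: "k < ?n" "x = xs ! k" using xs by (auto simp: in_set_conv_nth)
    show "x \<in> insert (last xs) ((!) xs ` Au)"
    proof (cases "Suc k < ?n")
      case False
      then have "k = ?n - 1" using k by simp
      then show ?thesis using k by (cases "xs = []") (auto simp: last_conv_nth)
    qed (use x k in \<open>auto simp: Au_def\<close>)
  qed
  then have "card (E `` {?u} \<inter> V) \<le> card (insert (last xs) ((!) xs ` Au))"
    using fin by (intro card_mono) auto
  also have "\<dots> \<le> Suc (card Au)"
    using fin card_image_le[of Au "(!) xs"] card_insert_if[of "(!) xs ` Au" "last xs"] by (auto split: if_splits)
  finally have u: "card (E `` {?u} \<inter> V) \<le> Suc (card Au)" .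
  have "E `` {?v} \<inter> V \<subseteq> insert (xs ! 0) ((\<lambda>k. xs ! Suc k) ` Bv)"
  proof
    fix x assume x: "x \<in> E `` {?v} \<inter> V"
    then obtain k where k: "k < ?n" "x = xs ! k" using xs by (auto simp: in_set_conv_nth)
    show "x \<in> insert (xs ! 0) ((\<lambda>k. xs ! Suc k) ` Bv)"
      using x k by (cases k) (auto simp: Bv_def)
  qed
  then have "card (E `` {?v} \<inter> V) \<le> card (insert (xs ! 0) ((\<lambda>k. xs ! Suc k) ` Bv))"
    using fin by (intro card_mono) auto
  also have "\<dots> \<le> Suc (card Bv)"
    using fin card_image_le[of Bv "\<lambda>k. xs ! Suc k"]
      card_insert_if[of "(\<lambda>k. xs ! Suc k) ` Bv" "xs ! 0"] by (auto split: if_splits)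
  finally have v: "card (E `` {?v} \<inter> V) \<le> Suc (card Bv)" .
  have "Au \<inter> Bv \<noteq> {}"
  proof
    assume "Au \<inter> Bv = {}"
    then have "card Au + card Bv = card (Au \<union> Bv)" using fin by (simp add: card_Un_disjoint)
    also have "Au \<union> Bv \<subseteq> {..<?n - 1} - {i}" using i by (auto simp: Au_def Bv_def)
    then have "card (Au \<union> Bv) \<le> card ({..<?n - 1} - {i})" by (intro card_mono) auto
    also have "\<dots> = ?n - 2" using i by (subst card_Diff_singleton) auto
    finally show False using u v deg n i by linarith
  qed
  then obtain k where k: "k \<in> Au" "k \<in> Bv" by blast
  moreover from this have "k \<noteq> i" using i by (auto simp: Au_def)
  ultimately show thesis by (intro that[of k]) (auto simp: Au_def Bv_def)
qed

text \<open>
  The theorem of Ore on Hamilton-connected graphs, in the form of Dirac, by the closure argument of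
  Bondy and Chvatal: if two vertices are not adjacent, the edge between them is added and the
  induction hypothesis gives a Hamiltonian path. If this path uses the new edge, a second step with
  which it can be exchanged exists by the condition on the degrees.
\<close>

theorem hamilton_connected:
  assumes "finite V" and "sym E" and "\<And>v. v \<in> V \<Longrightarrow> (v, v) \<notin> E"
    and "\<And>v. v \<in> V \<Longrightarrow> card V + 1 \<le> 2 * card (E `` {v} \<inter> V)"
    and "a \<in> V" and "b \<in> V" and "a \<noteq> b"
  shows "\<exists>xs. distinct xs \<and> set xs = V \<and> hd xs = a \<and> last xs = b \<and> successively (\<lambda>x y. (x, y) \<in> E) xs"
  using assms(2-4)
proof (induction "card {(x, y). x \<in> V \<and> y \<in> V \<and> x \<noteq> y \<and> (x, y) \<notin> E}" arbitrary: E rule: less_induct)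
  case less
  note E = less.prems
  show ?case
  proof (cases "\<exists>u v. u \<in> V \<and> v \<in> V \<and> u \<noteq> v \<and> (u, v) \<notin> E")
    case False
    obtain zs where zs: "distinct zs" "set zs = V - {a, b}"
      using finite_distinct_list[of "V - {a, b}"] assms(1) by auto
    let ?xs = "a # zs @ [b]"
    have xs: "distinct ?xs" "set ?xs = V" using zs assms by auto
    have "successively (\<lambda>x y. (x, y) \<in> E) ?xs"
      unfolding successively_conv_nth
    proof (intro allI impI)
      fix l assume l: "Suc l < length ?xs"
      then have "?xs ! l \<noteq> ?xs ! Suc l"
        using nth_eq_iff_index_eq[OF xs(1), of l "Suc l"] by auto
      moreover have "?xs ! l \<in> V" "?xs ! Suc l \<in> V"
        using l nth_mem[of l ?xs] nth_mem[of "Suc l" ?xs] unfolding xs(2)[symmetric] by auto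
      ultimately show "(?xs ! l, ?xs ! Suc l) \<in> E" using False by blast
    qed
    then show ?thesis using xs by (intro exI[of _ ?xs]) auto
  next
    case True
    then obtain u v where uv: "u \<in> V" "v \<in> V" "u \<noteq> v" "(u, v) \<notin> E" by blast
    define E' where "E' = insert (u, v) (insert (v, u) E)"
    have symE': "sym E'" using E(1) by (auto simp: E'_def sym_def)
    have fin: "finite {(x, y). x \<in> V \<and> y \<in> V \<and> x \<noteq> y \<and> (x, y) \<notin> E}"
      by (rule finite_subset[of _ "V \<times> V"]) (use assms(1) in auto)
    have lt: "card {(x, y). x \<in> V \<and> y \<in> V \<and> x \<noteq> y \<and> (x, y) \<notin> E'}
        < card {(x, y). x \<in> V \<and> y \<in> V \<and> x \<noteq> y \<and> (x, y) \<notin> E}"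
      using uv by (intro psubset_card_mono[OF fin]) (auto simp: E'_def)
    have deg': "card V + 1 \<le> 2 * card (E' `` {x} \<inter> V)" if "x \<in> V" for x
    proof -
      have "card (E `` {x} \<inter> V) \<le> card (E' `` {x} \<inter> V)"
        using assms(1) by (intro card_mono) (auto simp: E'_def)
      then show ?thesis using E(3)[OF that] by linarith
    qed
    have irr': "(x, x) \<notin> E'" if "x \<in> V" for x using E(2)[OF that] uv by (auto simp: E'_def)
    obtain xs where xs: "distinct xs" "set xs = V" "hd xs = a" "last xs = b"
      "successively (\<lambda>x y. (x, y) \<in> E') xs"
      using less.hyps[OF lt symE' irr' deg'] by blast
    show ?thesis
    proof (cases "successively (\<lambda>x y. (x, y) \<in> E) xs")
      case False
      then obtain i where i: "Suc i < length xs" "(xs ! i, xs ! Suc i) \<notin> E"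
        by (auto simp: successively_conv_nth)
      then have "(xs ! i, xs ! Suc i) \<in> E'" using xs(5) by (auto simp: successively_conv_nth)
      then have uv': "(xs ! i = u \<and> xs ! Suc i = v) \<or> (xs ! i = v \<and> xs ! Suc i = u)"
        using i by (auto simp: E'_def)
      have "E' = insert (xs ! i, xs ! Suc i) (insert (xs ! Suc i, xs ! i) E)"
        using uv' by (auto simp: E'_def)
      then have succ: "successively (\<lambda>x y. (x, y) \<in> insert (xs ! i, xs ! Suc i) (insert (xs ! Suc i, xs ! i) E)) xs"
        using xs(5) by simp
      have inV: "xs ! i \<in> V" "xs ! Suc i \<in> V" using uv' uv by auto
      obtain k where "Suc k < length xs" "k \<noteq> i" "(xs ! i, xs ! k) \<in> E" "(xs ! Suc i, xs ! Suc k) \<in> E"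
      proof (rule crossing_neighbours[OF assms(1) xs(1,2) i(1), where E = E])
        show "card V + 1 \<le> card (E `` {xs ! i} \<inter> V) + card (E `` {xs ! Suc i} \<inter> V)"
          using E(3)[OF inV(1)] E(3)[OF inV(2)] by linarith
      qed (use E(2) inV in auto)
      from rotate_bad_step[OF E(1) xs(1) succ i(1) refl refl this] xs show ?thesis by auto
    qed (use xs in auto)
  qed
qed

section \<open>Attaching brooms to prescribed roots\<close>

text \<open>
  The second index of \<open>\<tau>\<close> numbers the vertices of each broom as in the standard broom: the path
  comes first, and \<open>\<tau> j 0\<close> is joined to the root \<open>\<phi> j\<close>.
\<close>

definition brooms_at ::
  "('a \<times> 'a) set \<Rightarrow> 'a set \<Rightarrow> 'j set \<Rightarrow> ('j \<Rightarrow> 'a) \<Rightarrow> nat \<Rightarrow> nat \<Rightarrow> ('j \<Rightarrow> nat \<Rightarrow> 'a) \<Rightarrow> bool" where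
  "brooms_at E X J \<phi> t d \<tau> \<longleftrightarrow>
     inj_on (\<lambda>(j, i). \<tau> j i) (J \<times> {..<t + d}) \<and>
     (\<forall>j\<in>J. \<forall>i<t + d. \<tau> j i \<in> X) \<and>
     (\<forall>j\<in>J. (\<phi> j, \<tau> j 0) \<in> E \<and> (\<forall>i. Suc i < t \<longrightarrow> (\<tau> j i, \<tau> j (Suc i)) \<in> E) \<and>
        (\<forall>i. t \<le> i \<longrightarrow> i < t + d \<longrightarrow> (\<tau> j (t - 1), \<tau> j i) \<in> E))"

lemma card_Int_lower_bound:
  assumes "finite V" and "A \<subseteq> V" and "B \<subseteq> V"
  shows "card A + card B \<le> card V + card (A \<inter> B)"
proof -
  have "finite A" "finite B" using assms finite_subset by auto
  then have "card A + card B = card (A \<union> B) + card (A \<inter> B)" by (rule card_Un_Int)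
  moreover have "card (A \<union> B) \<le> card V" using assms by (intro card_mono) auto
  ultimately show ?thesis by linarith
qed

lemma card_Int_restrict:
  assumes "finite V" and "X \<subseteq> V"
  shows "card (A \<inter> V) \<le> card (A \<inter> X) + card (V - X)"
proof -
  have "card (A \<inter> V) \<le> card ((A \<inter> X) \<union> (V - X))" using assms by (intro card_mono) (auto intro: finite_subset)
  also have "\<dots> \<le> card (A \<inter> X) + card (V - X)" by (rule card_Un_le)
  finally show ?thesis .
qed

locale dense_graph =
  fixes E :: "('a \<times> 'a) set" and V :: "'a set" and \<eta> :: real
  assumes finV: "finite V" and symE: "sym E" and irrefl: "\<And>v. (v, v) \<notin> E"
    and \<eta>: "0 < \<eta>" "\<eta> \<le> 1"
    and deg: "\<And>v. v \<in> V \<Longrightarrow> (1/2 + \<eta>) * real (card V) \<le> real (card (E `` {v} \<inter> V))"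
begin

lemma deg_in_large_subset:
  assumes "X \<subseteq> V" and "v \<in> V" and "2 * real (card (V - X)) \<le> \<eta> * real (card V)"
  shows "(1/2 + \<eta>/2) * real (card V) \<le> real (card (E `` {v} \<inter> X))"
proof -
  have "real (card (E `` {v} \<inter> V)) \<le> real (card (E `` {v} \<inter> X)) + real (card (V - X))"
    using card_Int_restrict[OF finV assms(1), of "E `` {v}"] by linarith
  then show ?thesis using deg[OF assms(2)] assms(3) by (simp add: algebra_simps)
qed

text \<open>
  A large vertex set splits into equal parts in each of which every vertex of the graph has more
  than half of the part as neighbours: the surplus \<open>\<eta>\<close> exceeds both the loss by the removed vertices
  and the error of the partition.
\<close>

lemma rich_partition:
  assumes X: "X \<subseteq> V" "2 * real (card (V - X)) \<le> \<eta> * real (card V)" "card X = q * M" and "q > 0"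
    and M: "4 * ln (real (card V * q)) \<le> (\<eta>/4)\<^sup>2 * real M"
  obtains P where "\<And>p. p < q \<Longrightarrow> P p \<subseteq> X" and "(\<Union>p<q. P p) = X"
    and "\<And>p p'. p < q \<Longrightarrow> p' < q \<Longrightarrow> p \<noteq> p' \<Longrightarrow> P p \<inter> P p' = {}"
    and "\<And>p. p < q \<Longrightarrow> card (P p) = M"
    and "\<And>v p. v \<in> V \<Longrightarrow> p < q \<Longrightarrow> (1/2 + \<eta>/4) * real M \<le> real (card (E `` {v} \<inter> P p))"
proof -
  obtain P where P: "\<And>p. p < q \<Longrightarrow> P p \<subseteq> X" "(\<Union>p<q. P p) = X"
      "\<And>p p'. p < q \<Longrightarrow> p' < q \<Longrightarrow> p \<noteq> p' \<Longrightarrow> P p \<inter> P p' = {}"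
      "\<And>p. p < q \<Longrightarrow> card (P p) = M"
      "\<And>v p. v \<in> V \<Longrightarrow> p < q \<Longrightarrow>
        real (card (E `` {v} \<inter> X)) / real q - \<eta>/4 * real M \<le> real (card (E `` {v} \<inter> P p))"
    using equitable_partition[where E = E and X = X and q = q and M = M and W = V and \<epsilon> = "\<eta>/4"]
      finite_subset[OF X(1) finV] X(3) assms(4) finV M \<eta> by auto
  show thesis
  proof (rule that[of P])
    fix v p assume v: "v \<in> V" and p: "p < q"
    have "card X \<le> card V" using X finV by (intro card_mono)
    then have "(1/2 + \<eta>/2) * (real q * real M) \<le> (1/2 + \<eta>/2) * real (card V)"
      using \<eta> X(3) by (intro mult_left_mono) (auto simp flip: of_nat_mult)
    also have "\<dots> \<le> real (card (E `` {v} \<inter> X))"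
      using X v by (intro deg_in_large_subset)
    finally have "(1/2 + \<eta>/2) * real M \<le> real (card (E `` {v} \<inter> X)) / real q"
      using assms(4) by (simp add: field_simps)
    with P(5)[OF v p] show "(1/2 + \<eta>/4) * real M \<le> real (card (E `` {v} \<inter> P p))"
      by (simp add: algebra_simps)
  qed (use P in auto)
qed

text \<open>
  Layers of equal size in which every vertex has at least half of the layer as neighbours admit
  perfect matchings between any two of them. Along a tree of layers these matchings give
  \<open>card J\<close> disjoint copies of the tree.
\<close>

lemma matched_layers:
  fixes \<Lambda> :: "nat \<Rightarrow> 'a set" and J :: "'j set"
  assumes "q > 0" and \<Lambda>: "\<And>i. i < q \<Longrightarrow> \<Lambda> i \<subseteq> V" "\<And>i. i < q \<Longrightarrow> card (\<Lambda> i) = card J"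
    and rich: "\<And>v i. v \<in> V \<Longrightarrow> i < q \<Longrightarrow> card J \<le> 2 * card (E `` {v} \<inter> \<Lambda> i)"
    and \<tau>\<^sub>0: "bij_betw \<tau>\<^sub>0 J (\<Lambda> 0)" and \<pi>: "\<And>i. 0 < i \<Longrightarrow> i < q \<Longrightarrow> \<pi> i < i"
  shows "\<exists>\<tau>. \<tau> 0 = \<tau>\<^sub>0 \<and> (\<forall>i<q. bij_betw (\<tau> i) J (\<Lambda> i)) \<and>
    (\<forall>i. 0 < i \<longrightarrow> i < q \<longrightarrow> (\<forall>j\<in>J. (\<tau> (\<pi> i) j, \<tau> i j) \<in> E))"
  using assms
proof (induction q rule: nat_induct_non_zero)
  case 1
  then show ?case by (intro exI[of _ "\<lambda>_. \<tau>\<^sub>0"]) auto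
next
  case (Suc q)
  have "\<exists>\<tau>. \<tau> 0 = \<tau>\<^sub>0 \<and> (\<forall>i<q. bij_betw (\<tau> i) J (\<Lambda> i)) \<and>
    (\<forall>i. 0 < i \<longrightarrow> i < q \<longrightarrow> (\<forall>j\<in>J. (\<tau> (\<pi> i) j, \<tau> i j) \<in> E))"
    by (rule Suc.IH) (use Suc.prems in auto)
  then obtain \<tau> where \<tau>: "\<tau> 0 = \<tau>\<^sub>0" "\<And>i. i < q \<Longrightarrow> bij_betw (\<tau> i) J (\<Lambda> i)"
    "\<And>i j. 0 < i \<Longrightarrow> i < q \<Longrightarrow> j \<in> J \<Longrightarrow> (\<tau> (\<pi> i) j, \<tau> i j) \<in> E" by blast
  have pq: "\<pi> q < q" using Suc by simp
  have "\<exists>f. bij_betw f (\<Lambda> (\<pi> q)) (\<Lambda> q) \<and> (\<forall>x\<in>\<Lambda> (\<pi> q). (x, f x) \<in> E)"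
  proof (rule perfect_matching_of_half_degrees[OF symE])
    show "finite (\<Lambda> (\<pi> q))" "finite (\<Lambda> q)" 
      using Suc.prems(1)[of "\<pi> q"] Suc.prems(1)[of q] pq finV finite_subset by auto
    show "card (\<Lambda> (\<pi> q)) = card (\<Lambda> q)" using Suc.prems(2) pq by auto
    show "card (\<Lambda> q) \<le> 2 * card (E `` {x} \<inter> \<Lambda> q)" if "x \<in> \<Lambda> (\<pi> q)" for x
      using Suc.prems(1)[of "\<pi> q"] Suc.prems(2)[of q] Suc.prems(3)[of x q] that pq by auto
    show "card (\<Lambda> (\<pi> q)) \<le> 2 * card (E `` {y} \<inter> \<Lambda> (\<pi> q))" if "y \<in> \<Lambda> q" for y
      using Suc.prems(1)[of q] Suc.prems(2)[of "\<pi> q"] Suc.prems(3)[of y "\<pi> q"] that pq by auto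
  qed
  then obtain f where f: "bij_betw f (\<Lambda> (\<pi> q)) (\<Lambda> q)" "\<And>x. x \<in> \<Lambda> (\<pi> q) \<Longrightarrow> (x, f x) \<in> E" by blast
  have g: "bij_betw (f \<circ> \<tau> (\<pi> q)) J (\<Lambda> q)" using \<tau>(2)[OF pq] f(1) by (rule bij_betw_trans)
  have g': "(\<tau> (\<pi> q) j, (f \<circ> \<tau> (\<pi> q)) j) \<in> E" if "j \<in> J" for j
    using f(2) \<tau>(2)[OF pq] that by (auto simp: bij_betw_def)
  show ?case
  proof (intro exI[of _ "\<tau>(q := f \<circ> \<tau> (\<pi> q))"] conjI allI impI ballI)
    show "(\<tau>(q := f \<circ> \<tau> (\<pi> q))) 0 = \<tau>\<^sub>0" using \<tau>(1) Suc.hyps by simp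
    show "bij_betw ((\<tau>(q := f \<circ> \<tau> (\<pi> q))) i) J (\<Lambda> i)" if "i < Suc q" for i
      using g \<tau>(2) that by (cases "i = q") auto
    show "((\<tau>(q := f \<circ> \<tau> (\<pi> q))) (\<pi> i) j, (\<tau>(q := f \<circ> \<tau> (\<pi> q))) i j) \<in> E"
      if i: "0 < i" "i < Suc q" and j: "j \<in> J" for i j
    proof (cases "i = q")
      case True
      then show ?thesis using g'[OF j] pq by auto
    next
      case False
      then have "i < q" "\<pi> i \<noteq> q" using i Suc.prems(5)[of i] by auto
      then show ?thesis using \<tau>(3) i j by simp
    qed
  qed
qed

text \<open>
  Many brooms with at least two path vertices. Only the first vertices meet the roots, whose
  position is not under control. So the second layer is chosen first, as one part of a rich
  partition, and the first vertices are chosen greedily as common neighbours of the roots and the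
  second vertices. All other layers, including the layers of leaves, come from a rich partition of
  the remaining vertices, and are matched with their predecessors.
\<close>

lemma brooms_by_layers:
  fixes J :: "'j set"
  assumes J: "finite J" "J \<noteq> {}" and \<phi>: "inj_on \<phi> J" "\<phi> ` J \<subseteq> V"
    and n: "card V = card J * (1 + t + d)" and t: "t \<ge> 2"
    and small: "6 * real (card J) \<le> \<eta> * real (card V)"
    and large: "8 * ln (real (card V)) \<le> (\<eta>/4)\<^sup>2 * real (card J)"
  shows "\<exists>\<tau>. brooms_at E (V - \<phi> ` J) J \<phi> t d \<tau>"
proof -
  let ?m = "card J" and ?n = "card V"
  have m: "?m > 0" using J by auto
  have npos: "?n > 0" using n m by simp
  \<comment> \<open>The number of tests in a partition into \<open>q\<close> parts is at most the square of \<open>card V\<close>.\<close>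
  have ln_le: "4 * ln (real (?n * q)) \<le> (\<eta>/4)\<^sup>2 * real ?m" if "q \<le> ?n" "q > 0" for q
  proof -
    have "ln (real (?n * q)) = ln (real ?n) + ln (real q)" using that npos by (simp add: ln_mult)
    moreover have "ln (real q) \<le> ln (real ?n)" using that npos by simp
    ultimately show ?thesis using large by linarith
  qed
  define V' where "V' = V - \<phi> ` J"
  have cV': "card V' = (t + d) * ?m"
    unfolding V'_def using \<phi> J n by (simp add: card_Diff_subset card_image algebra_simps)
  have "V - V' = \<phi> ` J" using \<phi> by (auto simp: V'_def)
  then have rem': "card (V - V') = ?m" using \<phi> by (simp add: card_image)
  have "1 * (1 + t + d) \<le> ?m * (1 + t + d)" using m by (intro mult_right_mono) auto
  then have tdn: "t + d \<le> ?n" using n by simp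
  obtain P where P: "\<And>p. p < t + d \<Longrightarrow> P p \<subseteq> V'" "\<And>p. p < t + d \<Longrightarrow> card (P p) = ?m"
    "\<And>v p. v \<in> V \<Longrightarrow> p < t + d \<Longrightarrow> (1/2 + \<eta>/4) * real ?m \<le> real (card (E `` {v} \<inter> P p))"
  proof (rule rich_partition[of V' "t + d" ?m])
    show "2 * real (card (V - V')) \<le> \<eta> * real ?n" using rem' small by simp
    show "4 * ln (real (?n * (t + d))) \<le> (\<eta>/4)\<^sup>2 * real ?m" by (rule ln_le) (use tdn t in auto)
  qed (use cV' t in \<open>auto simp: V'_def\<close>)
  define X where "X = P 0"
  have X: "X \<subseteq> V'" "card X = ?m" using P t by (auto simp: X_def)
  have finX: "finite X" by (rule finite_subset[OF _ finV]) (use X in \<open>auto simp: V'_def\<close>)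
  obtain x where x: "bij_betw x J X" using finite_same_card_bij[OF J(1) finX] X by auto
  have "\<exists>f. inj_on f J \<and> (\<forall>j\<in>J. f j \<in> E `` {\<phi> j} \<inter> E `` {x j} \<inter> (V' - X))"
  proof (rule sdr_of_large_sets[OF J(1)])
    show "finite (E `` {\<phi> j} \<inter> E `` {x j} \<inter> (V' - X))" for j using finV by (simp add: V'_def)
    fix j assume j: "j \<in> J"
    have jV: "\<phi> j \<in> V" "x j \<in> V" using j \<phi> x X by (auto simp: bij_betw_def V'_def)
    have "real (card (E `` {\<phi> j} \<inter> V)) + real (card (E `` {x j} \<inter> V)) \<le>
      real ?n + real (card ((E `` {\<phi> j} \<inter> V) \<inter> (E `` {x j} \<inter> V)))"
      using card_Int_lower_bound[OF finV, of "E `` {\<phi> j} \<inter> V" "E `` {x j} \<inter> V"] by simp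
    moreover have "(E `` {\<phi> j} \<inter> V) \<inter> (E `` {x j} \<inter> V) = (E `` {\<phi> j} \<inter> E `` {x j}) \<inter> V" by auto
    moreover have "card ((E `` {\<phi> j} \<inter> E `` {x j}) \<inter> V) \<le>
        card ((E `` {\<phi> j} \<inter> E `` {x j}) \<inter> (V' - X)) + card (V - (V' - X))"
      by (rule card_Int_restrict[OF finV]) (auto simp: V'_def)
    moreover have "card (V - (V' - X)) \<le> ?m + ?m"
    proof -
      have "V - (V' - X) \<subseteq> (V - V') \<union> X" by auto
      then have "card (V - (V' - X)) \<le> card ((V - V') \<union> X)"
        by (rule card_mono[rotated]) (simp add: finV finX)
      also have "\<dots> \<le> ?m + ?m" using card_Un_le[of "V - V'" X] rem' X by simp
      finally show ?thesis .
    qed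
    ultimately have "real ?n + 2 * \<eta> * real ?n \<le> real ?n +
        (real (card (E `` {\<phi> j} \<inter> E `` {x j} \<inter> (V' - X))) + 2 * real ?m)"
      using deg[OF jV(1)] deg[OF jV(2)] by (simp add: algebra_simps)
    then show "?m \<le> card (E `` {\<phi> j} \<inter> E `` {x j} \<inter> (V' - X))" using small by linarith
  qed
  then obtain f where f: "inj_on f J" "\<And>j. j \<in> J \<Longrightarrow> f j \<in> E `` {\<phi> j} \<inter> E `` {x j} \<inter> (V' - X)" by blast
  define V'' where "V'' = V' - X - f ` J"
  have cV'': "card V'' = (t + d - 2) * ?m"
  proof -
    have "card V'' = card V' - card X - card (f ` J)"
    proof -
      have "f ` J \<subseteq> V' - X" using f(2) by auto
      then show ?thesis unfolding V''_def using X(1) finX J(1) by (simp add: card_Diff_subset)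
    qed
    also have "\<dots> = (t + d) * ?m - 2 * ?m" using cV' X f by (simp add: card_image)
    finally show ?thesis by (simp add: diff_mult_distrib)
  qed
  have rem'': "card (V - V'') \<le> 3 * ?m"
  proof -
    have "V - V'' \<subseteq> (V - V') \<union> (X \<union> f ` J)" by (auto simp: V''_def)
    then have "card (V - V'') \<le> card ((V - V') \<union> (X \<union> f ` J))"
      by (rule card_mono[rotated]) (simp add: finV finX J(1))
    also have "\<dots> \<le> card (V - V') + (card X + card (f ` J))"
      using card_Un_le[of "V - V'" "X \<union> f ` J"] card_Un_le[of X "f ` J"] by linarith
    finally show ?thesis using rem' X f by (simp add: card_image)
  qed
  obtain Y where Y: "\<And>p. p < t + d - 2 \<Longrightarrow> Y p \<subseteq> V''"
    "\<And>p p'. p < t + d - 2 \<Longrightarrow> p' < t + d - 2 \<Longrightarrow> p \<noteq> p' \<Longrightarrow> Y p \<inter> Y p' = {}"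
    "\<And>p. p < t + d - 2 \<Longrightarrow> card (Y p) = ?m"
    "\<And>v p. v \<in> V \<Longrightarrow> p < t + d - 2 \<Longrightarrow> (1/2 + \<eta>/4) * real ?m \<le> real (card (E `` {v} \<inter> Y p))"
  proof (cases "t + d - 2 = 0")
    case False
    have "V'' \<subseteq> V" by (auto simp: V''_def V'_def)
    moreover have "2 * real (card (V - V'')) \<le> \<eta> * real ?n" using rem'' small by linarith
    moreover have "4 * ln (real (?n * (t + d - 2))) \<le> (\<eta>/4)\<^sup>2 * real ?m"
      by (rule ln_le) (use tdn False in auto)
    moreover have "0 < t + d - 2" using False by simp
    ultimately obtain Y where "\<And>p. p < t + d - 2 \<Longrightarrow> Y p \<subseteq> V''"
      "\<And>p p'. p < t + d - 2 \<Longrightarrow> p' < t + d - 2 \<Longrightarrow> p \<noteq> p' \<Longrightarrow> Y p \<inter> Y p' = {}"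
      "\<And>p. p < t + d - 2 \<Longrightarrow> card (Y p) = ?m"
      "\<And>v p. v \<in> V \<Longrightarrow> p < t + d - 2 \<Longrightarrow>
        (1/2 + \<eta>/4) * real ?m \<le> real (card (E `` {v} \<inter> Y p))"
      using rich_partition[of V'' "t + d - 2" ?m] cV'' by metis
    then show ?thesis by (rule that)
  qed (use that in auto)
  have half: "?m \<le> 2 * k" if "(1/2 + \<eta>/4) * real ?m \<le> real k" for k
  proof -
    have "(1/2) * real ?m \<le> (1/2 + \<eta>/4) * real ?m" using \<eta> by (intro mult_right_mono) auto
    then show ?thesis using that by linarith
  qed
  have pred: "i - 1 < t + d - 2" if "0 < i" "i < t + d - 1" for i using that by linarith
  \<comment> \<open>The layers are numbered from the second vertices of the paths on; \<open>\<pi>\<close> is the parent in the broom.\<close>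
  define \<Lambda> where "\<Lambda> i = (if i = 0 then X else Y (i - 1))" for i
  define \<pi> where "\<pi> i = (if i < t - 1 then i - 1 else t - 2)" for i
  have "\<exists>\<tau>. \<tau> 0 = x \<and> (\<forall>i<t + d - 1. bij_betw (\<tau> i) J (\<Lambda> i)) \<and>
    (\<forall>i. 0 < i \<longrightarrow> i < t + d - 1 \<longrightarrow> (\<forall>j\<in>J. (\<tau> (\<pi> i) j, \<tau> i j) \<in> E))"
  proof (rule matched_layers)
    show "t + d - 1 > 0" using t by simp
    show "\<Lambda> i \<subseteq> V" if "i < t + d - 1" for i
      using that X Y(1)[of "i - 1"] pred[of i] by (auto simp: \<Lambda>_def V''_def V'_def)
    show "card (\<Lambda> i) = card J" if "i < t + d - 1" for i 
      using that X Y(3)[of "i - 1"] pred[of i] by (auto simp: \<Lambda>_def)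
    show "card J \<le> 2 * card (E `` {v} \<inter> \<Lambda> i)" if "v \<in> V" "i < t + d - 1" for v i
      using that half P(3)[of v 0] Y(4)[of v "i - 1"] pred[of i] t by (auto simp: \<Lambda>_def X_def)
    show "bij_betw x J (\<Lambda> 0)" using x by (simp add: \<Lambda>_def)
    show "\<pi> i < i" if "0 < i" "i < t + d - 1" for i using that t by (auto simp: \<pi>_def)
  qed
  then obtain \<tau> where \<tau>: "\<tau> 0 = x" "\<And>i. i < t + d - 1 \<Longrightarrow> bij_betw (\<tau> i) J (\<Lambda> i)"
    "\<And>i j. 0 < i \<Longrightarrow> i < t + d - 1 \<Longrightarrow> j \<in> J \<Longrightarrow> (\<tau> (\<pi> i) j, \<tau> i j) \<in> E" by blast
  have \<Lambda>_disj: "\<Lambda> i \<inter> \<Lambda> i' = {}" if "i < t + d - 1" "i' < t + d - 1" "i \<noteq> i'" for i i'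
    using that Y(1)[of "i - 1"] Y(1)[of "i' - 1"] Y(2)[of "i - 1" "i' - 1"] pred[of i] pred[of i']
    by (cases "i = 0"; cases "i' = 0") (auto simp: \<Lambda>_def V''_def)
  have \<Lambda>_sub: "\<Lambda> i \<subseteq> V' - f ` J" if "i < t + d - 1" for i
    using that X Y(1)[of "i - 1"] f(2) pred[of i] by (auto simp: \<Lambda>_def V''_def)
  define \<sigma> where "\<sigma> j i = (case i of 0 \<Rightarrow> f j | Suc i \<Rightarrow> \<tau> i j)" for j i
  have \<tau>_in: "\<tau> i j \<in> \<Lambda> i" if "i < t + d - 1" "j \<in> J" for i j
    using \<tau>(2)[OF that(1)] that by (auto simp: bij_betw_def)
  have "brooms_at E (V - \<phi> ` J) J \<phi> t d \<sigma>"
    unfolding brooms_at_def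
  proof (intro conjI ballI allI impI)
    show "inj_on (\<lambda>(j, i). \<sigma> j i) (J \<times> {..<t + d})"
    proof (rule inj_onI, safe)
      fix j i j' i' assume *: "j \<in> J" "j' \<in> J" "i < t + d" "i' < t + d" "\<sigma> j i = \<sigma> j' i'"
      have "j = j' \<and> i = i'"
      proof (cases i)
        case 0
        show ?thesis
        proof (cases i')
          case 0
          then show ?thesis using \<open>i = 0\<close> * f(1) by (auto simp: \<sigma>_def inj_on_def)
        next
          case (Suc k)
          have k: "k < t + d - 1" using Suc * by linarith
          then have "f j \<in> \<Lambda> k" using Suc * \<open>i = 0\<close> \<tau>_in[of k j'] by (auto simp: \<sigma>_def)
          then show ?thesis using \<Lambda>_sub[OF k] * by auto
        qed
      next
        case (Suc k)
        then have k: "\<tau> k j \<in> \<Lambda> k" "k < t + d - 1" using \<tau>_in[of k j] * by (auto simp: less_diff_conv)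
        show ?thesis
        proof (cases i')
          case 0
          then have "f j' \<in> \<Lambda> k" using k * Suc by (auto simp: \<sigma>_def)
          then show ?thesis using \<Lambda>_sub[OF k(2)] * by auto
        next
          case (Suc k')
          then have k': "\<tau> k' j' \<in> \<Lambda> k'" "k' < t + d - 1" "\<tau> k j = \<tau> k' j'"
            using \<tau>_in[of k' j'] * \<open>i = Suc k\<close> by (auto simp: \<sigma>_def less_diff_conv)
          have kk: "k = k'" using \<Lambda>_disj[of k k'] k k' by auto
          then have "j = j'" using \<tau>(2)[OF k(2)] k' * by (auto simp: bij_betw_def inj_on_def)
          then show ?thesis using kk Suc \<open>i = Suc k\<close> by simp
        qed
      qed
      then show "j = j'" "i = i'" by auto
    qed
    show "\<sigma> j i \<in> V - \<phi> ` J" if "j \<in> J" "i < t + d" for j i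
      using that f(2)[of j] \<tau>_in[of "i - 1" j] \<Lambda>_sub[of "i - 1"]
      by (cases i) (auto simp: \<sigma>_def V'_def less_diff_conv)
    show "(\<phi> j, \<sigma> j 0) \<in> E" if "j \<in> J" for j using f(2)[OF that] by (simp add: \<sigma>_def)
    show "(\<sigma> j i, \<sigma> j (Suc i)) \<in> E" if "j \<in> J" "Suc i < t" for j i
    proof (cases i)
      case 0
      then show ?thesis using f(2)[OF that(1)] \<tau>(1) symE by (auto simp: \<sigma>_def dest: symD)
    next
      case (Suc k)
      moreover have "0 < i" "i < t + d - 1" "\<pi> i = k" using Suc that by (auto simp: \<pi>_def)
      ultimately show ?thesis using \<tau>(3)[of i j] that by (auto simp: \<sigma>_def)
    qed
    show "(\<sigma> j (t - 1), \<sigma> j i) \<in> E" if "j \<in> J" "t \<le> i" "i < t + d" for j i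
    proof -
      obtain k where k: "t = Suc (Suc k)" using t by (metis add_2_eq_Suc le_Suc_ex)
      define l where "l = i - 1"
      have l: "i = Suc l" using k that(2) by (simp add: l_def)
      have "\<pi> l = k" using k l that by (auto simp: \<pi>_def)
      then show ?thesis using \<tau>(3)[of l j] that k l by (auto simp: \<sigma>_def)
    qed
  qed
  then show ?thesis by blast
qed

end

context dense_graph begin

text \<open>
  Few brooms with long paths. The last vertices and the leaves are so few that they can be chosen
  greedily. A rich partition splits the remaining vertices into one part for each broom, and
  inside its part the rest of the path is a Hamiltonian path that starts at a neighbour of the
  root and ends at a neighbour of the last vertex.
\<close>

lemma brooms_by_hamilton_paths:
  fixes J :: "'j set"
  assumes J: "finite J" "J \<noteq> {}" and \<phi>: "inj_on \<phi> J" "\<phi> ` J \<subseteq> V"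
    and n: "card V = card J * (1 + t + d)"
    and small: "2 * real (card J * (2 + d)) \<le> \<eta> * real (card V)"
    and long: "2 \<le> \<eta> * (real t - 1)" "8 * ln (real (card V)) \<le> (\<eta>/4)\<^sup>2 * (real t - 1)"
  shows "\<exists>\<tau>. brooms_at E (V - \<phi> ` J) J \<phi> t d \<tau>"
proof -
  let ?m = "card J" and ?n = "card V"
  define M where "M = t - 1"
  have "1 * (real t - 1) \<ge> 2"
  proof (cases "real t - 1 \<ge> 0")
    case True
    then have "\<eta> * (real t - 1) \<le> 1 * (real t - 1)" using \<eta> by (intro mult_right_mono) auto
    then show ?thesis using long(1) by linarith
  next
    case False
    then have "\<eta> * (real t - 1) \<le> 0" using \<eta> by (intro mult_nonneg_nonpos) auto
    then show ?thesis using long(1) by linarith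
  qed
  then have t: "t \<ge> 3" by simp
  have M: "real M = real t - 1" "M \<ge> 2" "t = Suc M" using t by (auto simp: M_def)
  have m: "?m > 0" using J by auto
  have npos: "?n > 0" using n m by simp
  have mn: "?m \<le> ?n" using n by simp
  define V' where "V' = V - \<phi> ` J"
  have finV': "finite V'" using finV by (simp add: V'_def)
  have rem': "card V' + ?m = ?n"
    unfolding V'_def using \<phi> J card_mono[OF finV \<phi>(2)] by (simp add: card_Diff_subset card_image)
  have cV': "?m \<le> card V'" using rem' n t by simp
  have "\<exists>z. inj_on z J \<and> (\<forall>j\<in>J. z j \<in> V')"
    by (rule sdr_of_large_sets) (use J finV' cV' in auto)
  then obtain z where z: "inj_on z J" "\<And>j. j \<in> J \<Longrightarrow> z j \<in> V'" by blast
  have "\<exists>l. inj_on l (J \<times> {..<d}) \<and> (\<forall>ji\<in>J \<times> {..<d}. l ji \<in> E `` {z (fst ji)} \<inter> (V' - z ` J))"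
  proof (rule sdr_of_large_sets)
    fix ji assume ji: "ji \<in> J \<times> {..<d}"
    then have zV: "z (fst ji) \<in> V" using z by (auto simp: V'_def)
    have "V - (V' - z ` J) \<subseteq> \<phi> ` J \<union> z ` J" by (auto simp: V'_def)
    then have "card (V - (V' - z ` J)) \<le> card (\<phi> ` J \<union> z ` J)" using J by (intro card_mono) auto
    also have "\<dots> \<le> ?m + ?m" using card_Un_le[of "\<phi> ` J" "z ` J"] \<phi> z by (simp add: card_image)
    finally have rem: "real (card (V - (V' - z ` J))) \<le> 2 * real ?m" by linarith
    have "2 * real (card (V - (V' - z ` J))) \<le> \<eta> * real ?n"
    proof -
      have "?m * 2 \<le> ?m * (2 + d)" by simp
      then have "2 * real ?m \<le> real (?m * (2 + d))" by linarith
      then show ?thesis using rem small by linarith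
    qed
    then have "(1/2 + \<eta>/2) * real ?n \<le> real (card (E `` {z (fst ji)} \<inter> (V' - z ` J)))"
      using zV by (intro deg_in_large_subset) (auto simp: V'_def)
    moreover have "0 \<le> (1/2) * real ?n" "(1/2 + \<eta>/2) * real ?n = (1/2) * real ?n + (1/2) * (\<eta> * real ?n)"
      by (auto simp: algebra_simps)
    ultimately have "real (?m * (2 + d)) \<le> real (card (E `` {z (fst ji)} \<inter> (V' - z ` J)))"
      using small by linarith
    moreover have "?m * d \<le> ?m * (2 + d)" by simp
    ultimately have "?m * d \<le> card (E `` {z (fst ji)} \<inter> (V' - z ` J))" by linarith
    then show "card (J \<times> {..<d}) \<le> card (E `` {z (fst ji)} \<inter> (V' - z ` J))"
      by (simp add: card_cartesian_product)
  qed (use J finV' in auto)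
  then obtain l where l: "inj_on l (J \<times> {..<d})"
    "\<And>j i. j \<in> J \<Longrightarrow> i < d \<Longrightarrow> (z j, l (j, i)) \<in> E \<and> l (j, i) \<in> V' - z ` J" by fastforce
  let ?L = "l ` (J \<times> {..<d})"
  have cL: "card ?L = ?m * d" using l(1) by (simp add: card_image card_cartesian_product)
  have L_sub: "?L \<subseteq> V' - z ` J" using l(2) by auto
  define R where "R = V' - z ` J - ?L"
  have VR: "V - R = \<phi> ` J \<union> (z ` J \<union> ?L)" 
  proof -
    have "z ` J \<subseteq> V'" using z(2) by blast
    moreover have "?L \<subseteq> V'" using L_sub by blast
    moreover have "V - V' = \<phi> ` J" using \<phi> by (auto simp: V'_def)
    moreover have "V' \<subseteq> V" by (auto simp: V'_def)
    ultimately show ?thesis unfolding R_def by blast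
  qed
  have cR: "card R = ?m * M"
  proof -
    have "card R = card V' - ?m - ?m * d"
    proof -
      have "z ` J \<subseteq> V'" "finite ?L" using z(2) J(1) by auto
      then show ?thesis unfolding R_def using L_sub z(1) J(1) by (simp add: card_Diff_subset card_image cL)
    qed
    also have "\<dots> = ?m * M" using rem' n M(3) by (simp add: algebra_simps)
    finally show ?thesis .
  qed
  have remR: "card (V - R) \<le> ?m * (2 + d)"
    unfolding VR using card_Un_le[of "\<phi> ` J" "z ` J \<union> ?L"] card_Un_le[of "z ` J" ?L] cL \<phi> z
    by (simp add: card_image algebra_simps)
  have RV: "R \<subseteq> V" by (auto simp: R_def V'_def)
  moreover have "2 * real (card (V - R)) \<le> \<eta> * real ?n" using remR small by linarith
  moreover have "4 * ln (real (?n * ?m)) \<le> (\<eta>/4)\<^sup>2 * real M"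
  proof -
    have "ln (real (?n * ?m)) = ln (real ?n) + ln (real ?m)" using m npos by (simp add: ln_mult)
    moreover have "ln (real ?m) \<le> ln (real ?n)" using m mn by simp
    ultimately show ?thesis using long(2) unfolding M(1) by linarith
  qed
  ultimately obtain P where P: "\<And>p. p < ?m \<Longrightarrow> P p \<subseteq> R"
    "\<And>p p'. p < ?m \<Longrightarrow> p' < ?m \<Longrightarrow> p \<noteq> p' \<Longrightarrow> P p \<inter> P p' = {}" "\<And>p. p < ?m \<Longrightarrow> card (P p) = M"
    "\<And>v p. v \<in> V \<Longrightarrow> p < ?m \<Longrightarrow> (1/2 + \<eta>/4) * real M \<le> real (card (E `` {v} \<inter> P p))"
    using rich_partition[of R ?m M] cR m by metis
  have half: "M + 1 \<le> 2 * card (E `` {v} \<inter> P p)" if "v \<in> V" "p < ?m" for v p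
  proof -
    have "2 \<le> \<eta> * real M" using long(1) M(1) by simp
    then have "real M + 1 \<le> 2 * ((1/2 + \<eta>/4) * real M)" by (simp add: algebra_simps)
    then show ?thesis using P(4)[OF that] by linarith
  qed
  obtain e where e: "bij_betw e J {..<?m}"
    using ex_bij_betw_finite_nat[OF J(1)] by (auto simp: atLeast0LessThan)
  have e_lt: "e j < ?m" if "j \<in> J" for j using e that by (auto simp: bij_betw_def)
  have "\<forall>j\<in>J. \<exists>xs. distinct xs \<and> set xs = P (e j) \<and> (\<phi> j, hd xs) \<in> E \<and> (last xs, z j) \<in> E \<and>
    successively (\<lambda>x y. (x, y) \<in> E) xs"
  proof
    fix j assume j: "j \<in> J"
    let ?P = "P (e j)"
    have P_sub: "?P \<subseteq> V" using P(1)[OF e_lt[OF j]] by (auto simp: R_def V'_def)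
    have finP: "finite ?P" using P_sub finV finite_subset by blast
    have jV: "\<phi> j \<in> V" "z j \<in> V" using j \<phi> z by (auto simp: V'_def)
    have c: "2 \<le> card (E `` {z j} \<inter> ?P)" "1 \<le> card (E `` {\<phi> j} \<inter> ?P)"
      using half[OF jV(2) e_lt[OF j]] half[OF jV(1) e_lt[OF j]] M(2) by linarith+
    then have "E `` {\<phi> j} \<inter> ?P \<noteq> {}" by (metis card.empty not_one_le_zero)
    then obtain a where a: "a \<in> E `` {\<phi> j} \<inter> ?P" by blast
    have "card (E `` {z j} \<inter> ?P) - 1 \<le> card (E `` {z j} \<inter> ?P - {a})"
      using finP by (simp add: card_Diff_singleton_if)
    then have "1 \<le> card (E `` {z j} \<inter> ?P - {a})" using c(1) by linarith
    then have "E `` {z j} \<inter> ?P - {a} \<noteq> {}" by (metis card.empty not_one_le_zero)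
    then obtain b where b: "b \<in> E `` {z j} \<inter> ?P" "b \<noteq> a" by blast
    have "\<exists>xs. distinct xs \<and> set xs = ?P \<and> hd xs = a \<and> last xs = b \<and> successively (\<lambda>x y. (x, y) \<in> E) xs"
    proof (rule hamilton_connected[OF finP symE])
      show "card ?P + 1 \<le> 2 * card (E `` {v} \<inter> ?P)" if "v \<in> ?P" for v
        using half[of v "e j"] P(3)[OF e_lt[OF j]] that P_sub e_lt[OF j] by auto
    qed (use irrefl a b in auto)
    then show "\<exists>xs. distinct xs \<and> set xs = ?P \<and> (\<phi> j, hd xs) \<in> E \<and> (last xs, z j) \<in> E \<and>
        successively (\<lambda>x y. (x, y) \<in> E) xs"
      using a b symE by (auto dest: symD)
  qed
  then obtain xs where xs: "\<And>j. j \<in> J \<Longrightarrow> distinct (xs j)" "\<And>j. j \<in> J \<Longrightarrow> set (xs j) = P (e j)"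
    "\<And>j. j \<in> J \<Longrightarrow> (\<phi> j, hd (xs j)) \<in> E" "\<And>j. j \<in> J \<Longrightarrow> (last (xs j), z j) \<in> E"
    "\<And>j. j \<in> J \<Longrightarrow> successively (\<lambda>x y. (x, y) \<in> E) (xs j)" by metis
  have len: "length (xs j) = M" if "j \<in> J" for j
    using xs(1,2)[OF that] P(3)[OF e_lt[OF that]] by (metis distinct_card)
  define \<sigma> where "\<sigma> j i = (if i < M then xs j ! i else if i = M then z j else l (j, i - t))" for j i
  have xs_in: "xs j ! i \<in> P (e j)" if "j \<in> J" "i < M" for j i
    using xs(2) len that nth_mem by metis
  have P_R: "P (e j) \<subseteq> R" if "j \<in> J" for j using P(1) e_lt[OF that] by blast
  have \<sigma>_cases: "(i < M \<and> \<sigma> j i \<in> R) \<or> (i = M \<and> \<sigma> j i \<in> z ` J) \<or> (t \<le> i \<and> \<sigma> j i \<in> ?L)"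
    if "j \<in> J" "i < t + d" for j i
    using that xs_in[of j i] P_R[of j] M(3) by (auto simp: \<sigma>_def)
  have disj: "R \<inter> z ` J = {}" "R \<inter> ?L = {}" "z ` J \<inter> ?L = {}" using L_sub by (auto simp: R_def)
  have "brooms_at E (V - \<phi> ` J) J \<phi> t d \<sigma>"
    unfolding brooms_at_def
  proof (intro conjI ballI allI impI)
    show "inj_on (\<lambda>(j, i). \<sigma> j i) (J \<times> {..<t + d})"
    proof (rule inj_onI, safe)
      fix j i j' i' assume *: "j \<in> J" "j' \<in> J" "i < t + d" "i' < t + d" "\<sigma> j i = \<sigma> j' i'"
      consider "i < M" "i' < M" | "i = M" "i' = M" | "t \<le> i" "t \<le> i'"
        using \<sigma>_cases[of j i] \<sigma>_cases[of j' i'] * disj by auto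
      then have "j = j' \<and> i = i'"
      proof cases
        case 1
        then have eq: "xs j ! i = xs j' ! i'" using * by (simp add: \<sigma>_def)
        have "e j = e j'"
        proof (rule ccontr)
          assume "e j \<noteq> e j'"
          then have "P (e j) \<inter> P (e j') = {}" using P(2) e_lt * by auto
          then show False using xs_in[of j i] xs_in[of j' i'] eq 1 * by auto
        qed
        then have jj: "j = j'" using e * by (auto simp: bij_betw_def inj_on_def)
        then have "i = i'" using eq nth_eq_iff_index_eq[OF xs(1)[OF *(1)]] len[OF *(1)] 1 by auto
        then show ?thesis using jj by simp
      next
        case 2
        then show ?thesis using * z(1) by (auto simp: \<sigma>_def inj_on_def)
      next
        case 3
        then have "l (j, i - t) = l (j', i' - t)" using * M(3) by (auto simp: \<sigma>_def)
        then have "(j, i - t) = (j', i' - t)" using * 3 by (intro inj_onD[OF l(1)]) auto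
        then show ?thesis using 3 by auto
      qed
      then show "j = j'" "i = i'" by auto
    qed
    show "\<sigma> j i \<in> V - \<phi> ` J" if "j \<in> J" "i < t + d" for j i
    proof -
      have "R \<union> (z ` J \<union> ?L) = V'" using L_sub z(2) unfolding R_def by blast
      then have "\<sigma> j i \<in> V'" using \<sigma>_cases[OF that] by blast
      then show ?thesis by (simp add: V'_def)
    qed
    show "(\<phi> j, \<sigma> j 0) \<in> E" if "j \<in> J" for j
    proof -
      have "xs j \<noteq> []" using len[OF that] M(2) by (metis list.size(3) not_numeral_le_zero)
      then have "hd (xs j) = \<sigma> j 0" using M(2) by (simp add: \<sigma>_def hd_conv_nth)
      then show ?thesis using xs(3)[OF that] by simp
    qed
    show "(\<sigma> j i, \<sigma> j (Suc i)) \<in> E" if "j \<in> J" "Suc i < t" for j i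
    proof (cases "Suc i < M")
      case True
      then have "(xs j ! i, xs j ! Suc i) \<in> E"
        using xs(5)[OF that(1)] len[OF that(1)] unfolding successively_conv_nth by metis
      then show ?thesis using True by (simp add: \<sigma>_def)
    next
      case False
      then have i: "Suc i = M" using that M(3) by simp
      moreover have "last (xs j) = xs j ! i"
        using last_conv_nth[of "xs j"] len[OF that(1)] i
        by (metis Suc_neq_Zero diff_Suc_1 list.size(3))
      moreover have "i < M" using i by simp
      ultimately show ?thesis using xs(4)[OF that(1)] by (simp add: \<sigma>_def)
    qed
    show "(\<sigma> j (t - 1), \<sigma> j i) \<in> E" if "j \<in> J" "t \<le> i" "i < t + d" for j i
      using l(2)[of j "i - t"] that M(3) by (auto simp: \<sigma>_def)
  qed
  then show ?thesis by blast
qed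

end

text \<open>
  A vertex \<open>z\<close> distributes one unit among its neighbours. If a random \<open>v \<in> X\<close> picks a random
  neighbour in \<open>A\<close>, then \<open>z\<close> is picked with probability \<open>w z / card X\<close>, and \<open>c z\<close> is the
  distribution of \<open>v\<close> conditioned on the choice of \<open>z\<close>. So every \<open>v\<close> receives \<open>1 / card X\<close>
  on average, whatever the shape of \<open>A\<close>, and for any weights \<open>y\<close> some donor \<open>z\<close> attains the
  weighted average. A uniformly random \<open>z \<in> A\<close> would not do:
  many vertices may have to share the same few neighbours in \<open>A\<close>.

  No set \<open>W\<close> of at most half of the vertices receives everything from one \<open>z\<close>, since more than
  half of all vertices are neighbours of \<open>z\<close>. This loss is what makes the condition of Hall
  hold with room to spare.
\<close>

lemma balanced_donor:
  fixes E :: "('a \<times> 'a) set" and \<alpha> :: real and y :: "'a \<Rightarrow> real"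
  assumes E: "sym E" and X: "finite X" "X \<noteq> {}" and A: "A \<subseteq> X" and \<alpha>: "0 < \<alpha>"
    and into_A: "\<And>v. v \<in> X \<Longrightarrow> \<alpha> * real (card X) \<le> real (card (E `` {v} \<inter> A))"
    and from_A: "\<And>z. z \<in> A \<Longrightarrow> (1/2 + \<alpha>) * real (card X) \<le> real (card (E `` {z} \<inter> X))"
    and y: "\<And>v. v \<in> X \<Longrightarrow> 0 \<le> y v"
  shows "\<exists>z\<in>A. \<exists>c. (\<Sum>v\<in>X. y v) \<le> real (card X) * (\<Sum>v\<in>X. y v * c v) \<and>
    (\<forall>v\<in>X. 0 \<le> c v \<and> c v \<le> 2 / (\<alpha> * real (card X))) \<and> (\<forall>v. (z, v) \<notin> E \<longrightarrow> c v = 0) \<and>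
    (\<Sum>v\<in>X. c v) = 1 \<and> (\<forall>W\<subseteq>X. 2 * card W \<le> card X \<longrightarrow> (\<Sum>v\<in>W. c v) \<le> 1 - \<alpha>\<^sup>2)"
proof -
  let ?N = "real (card X)"
  have N: "?N > 0" using X by (simp add: card_gt_0_iff)
  have finA: "finite A" using A X finite_subset by blast
  define a where "a v = real (card (E `` {v} \<inter> A))" for v
  have a: "\<alpha> * ?N \<le> a v" "a v \<le> ?N" if "v \<in> X" for v
    using into_A[OF that] A X card_mono[of X "E `` {v} \<inter> A"] by (auto simp: a_def)
  have \<alpha>N: "0 < \<alpha> * ?N" using \<alpha> N by simp
  have a_pos: "0 < a v" if "v \<in> X" for v using a(1)[OF that] \<alpha>N by linarith
  define w where "w z = (\<Sum>v\<in>E `` {z} \<inter> X. 1 / a v)" for z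
  define c where "c z v = (if (z, v) \<in> E then 1 / a v / w z else 0)" for z v
  \<comment> \<open>Bounds on \<open>w\<close> in both directions control the size of the gifts and the loss outside \<open>W\<close>.\<close>
  have w_low: "1/2 \<le> w z" if z: "z \<in> A" for z
  proof -
    have "?N / 2 \<le> real (card (E `` {z} \<inter> X))"
      using from_A[OF z] \<alpha>N by (simp add: distrib_right)
    then have "1/2 \<le> real (card (E `` {z} \<inter> X)) * (1 / ?N)"
      using N by (simp add: field_simps)
    also have "\<dots> \<le> w z"
      unfolding w_def using a a_pos N by (intro sum_bounded_below) (auto intro!: divide_left_mono mult_pos_pos)
    finally show ?thesis .
  qed
  have w_high: "w z \<le> 1 / \<alpha>" for z
  proof -
    have "w z \<le> real (card (E `` {z} \<inter> X)) * (1 / (\<alpha> * ?N))"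
      unfolding w_def using a a_pos \<alpha>N N \<alpha> by (intro sum_bounded_above) (auto intro!: divide_left_mono mult_pos_pos)
    also have "\<dots> \<le> ?N * (1 / (\<alpha> * ?N))"
      using X \<alpha>N card_mono[of X "E `` {z} \<inter> X"] by (intro mult_right_mono) auto
    finally show ?thesis using N by simp
  qed
  have c_sum: "(\<Sum>v\<in>W. y v * c z v) = (\<Sum>v\<in>E `` {z} \<inter> W. y v / a v) / w z" if "finite W" for y z W
  proof -
    have "(\<Sum>v\<in>W. y v * c z v) = (\<Sum>v\<in>W. if v \<in> E `` {z} then y v / a v / w z else 0)"
      by (intro sum.cong) (auto simp: c_def)
    also have "\<dots> = (\<Sum>v\<in>E `` {z} \<inter> W. y v / a v / w z)"
      using that by (simp add: sum.If_cases Int_commute Image_singleton)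
    finally show ?thesis by (simp add: sum_divide_distrib)
  qed
  have mean: "(\<Sum>z\<in>A. w z * (\<Sum>v\<in>X. y v * c z v)) = (\<Sum>v\<in>X. y v)" for y
  proof -
    have "(\<Sum>z\<in>A. w z * (\<Sum>v\<in>X. y v * c z v)) = (\<Sum>z\<in>A. \<Sum>v\<in>E `` {z} \<inter> X. y v / a v)"
    proof (intro sum.cong refl)
      fix z assume "z \<in> A"
      then have "w z \<noteq> 0" using w_low[of z] by auto
      then show "w z * (\<Sum>v\<in>X. y v * c z v) = (\<Sum>v\<in>E `` {z} \<inter> X. y v / a v)"
        by (simp add: c_sum[OF X(1)])
    qed
    also have "\<dots> = (\<Sum>z\<in>A. \<Sum>v\<in>X. if (z, v) \<in> E then y v / a v else 0)"
      by (subst Int_commute) (simp add: sum.inter_restrict[OF X(1)])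
    also have "\<dots> = (\<Sum>v\<in>X. \<Sum>z\<in>A. if (z, v) \<in> E then y v / a v else 0)" by (rule sum.swap)
    also have "\<dots> = (\<Sum>v\<in>X. a v * (y v / a v))"
    proof (intro sum.cong refl)
      fix v
      have "{z \<in> A. (z, v) \<in> E} = E `` {v} \<inter> A" using symD[OF E] by blast
      then show "(\<Sum>z\<in>A. if (z, v) \<in> E then y v / a v else 0) = a v * (y v / a v)"
        using finA by (simp add: sum.If_cases a_def Int_def)
    qed
    also have "\<dots> = (\<Sum>v\<in>X. y v)" 
      by (intro sum.cong refl) (use a_pos in \<open>simp add: less_imp_neq[THEN not_sym]\<close>)
    finally show ?thesis .
  qed
  have A_ne: "A \<noteq> {}"
    using into_A X \<alpha>N by fastforce
  have c_one: "(\<Sum>v\<in>X. c z v) = 1" if "z \<in> A" for z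
    using c_sum[OF X(1), of "\<lambda>_. 1" z] w_low[OF that] by (simp add: w_def)
  have w_total: "(\<Sum>z\<in>A. w z) = ?N"
    using mean[of "\<lambda>_. 1"] c_one by simp
  have "\<exists>z\<in>A. (\<Sum>v\<in>X. y v) \<le> ?N * (\<Sum>v\<in>X. y v * c z v)"
  proof (rule ccontr)
    assume "\<not> ?thesis"
    then have less: "?N * (\<Sum>v\<in>X. y v * c z v) < (\<Sum>v\<in>X. y v)" if "z \<in> A" for z using that by auto
    have "?N * (\<Sum>z\<in>A. w z * (\<Sum>v\<in>X. y v * c z v)) = (\<Sum>z\<in>A. w z * (?N * (\<Sum>v\<in>X. y v * c z v)))"
      by (simp add: sum_distrib_left algebra_simps)
    also have "\<dots> < (\<Sum>z\<in>A. w z * (\<Sum>v\<in>X. y v))"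
    proof (rule sum_strict_mono[OF finA A_ne])
      fix z assume z: "z \<in> A"
      have "0 < w z" using w_low[OF z] by linarith
      then show "w z * (?N * (\<Sum>v\<in>X. y v * c z v)) < w z * (\<Sum>v\<in>X. y v)"
        using less[OF z] by (rule mult_strict_left_mono[rotated])
    qed
    also have "\<dots> = ?N * (\<Sum>v\<in>X. y v)" by (simp add: sum_distrib_right[symmetric] w_total)
    finally show False by (simp add: mean)
  qed
  then obtain z where z: "z \<in> A" "(\<Sum>v\<in>X. y v) \<le> ?N * (\<Sum>v\<in>X. y v * c z v)" by blast
  have w_pos: "0 < w z" using w_low[OF z(1)] by linarith
  have c_nonneg: "0 \<le> c z v" if "v \<in> X" for v using a_pos[OF that] w_pos by (simp add: c_def)
  have bounded: "c z v \<le> 2 / (\<alpha> * ?N)" if v: "v \<in> X" for v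
  proof -
    have "1 / a v / w z \<le> (1 / (\<alpha> * ?N)) / (1/2)"
      using a(1)[OF v] \<alpha>N \<alpha> N w_low[OF z(1)] w_pos a_pos[OF v] by (intro frac_le) (auto intro!: divide_left_mono mult_pos_pos)
    then show ?thesis using \<alpha>N by (auto simp: c_def)
  qed
  have loss: "(\<Sum>v\<in>W. c z v) \<le> 1 - \<alpha>\<^sup>2" if W: "W \<subseteq> X" "2 * card W \<le> card X" for W
  proof -
    have finW: "finite W" using W X finite_subset by blast
    have "card (E `` {z} \<inter> X) \<le> card (E `` {z} \<inter> (X - W)) + card W"
      using card_Int_restrict[OF X(1), of "X - W" "E `` {z}"] W by (simp add: double_diff)
    then have out: "\<alpha> * ?N \<le> real (card (E `` {z} \<inter> (X - W)))"
      using from_A[OF z(1)] W(2) by (simp add: algebra_simps)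
    have "\<alpha>\<^sup>2 \<le> (\<alpha> * ?N * (1 / ?N)) / w z"
      using w_high[of z] w_pos N \<alpha> by (simp add: field_simps power2_eq_square)
    also have "\<dots> \<le> (real (card (E `` {z} \<inter> (X - W))) * (1 / ?N)) / w z"
      using out w_pos by (intro divide_right_mono mult_right_mono) auto
    also have "\<dots> \<le> (\<Sum>v\<in>E `` {z} \<inter> (X - W). 1 / a v) / w z"
      using w_pos a a_pos N by (intro divide_right_mono sum_bounded_below) (auto intro!: divide_left_mono mult_pos_pos)
    also have "\<dots> = (\<Sum>v\<in>X - W. c z v)"
      using c_sum[of "X - W" "\<lambda>_. 1" z] X by simp
    also have "\<dots> = 1 - (\<Sum>v\<in>W. c z v)"
      using c_one[OF z(1)] W X by (simp add: sum_diff)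
    finally show ?thesis by simp
  qed
  show ?thesis
    using z c_nonneg bounded loss c_one[OF z(1)]
    by (intro bexI[of _ z] exI[of _ "c z"]) (auto simp: c_def)
qed

context dense_graph begin

text \<open>
  Brooms without a path: the centre of each star has to be a neighbour of the root, and the stars
  cover everything else. The centres are chosen one after the other, as donors that keep the
  amounts received by all vertices balanced. In the end every vertex receives almost its fair share
  from the centres. For a set \<open>W\<close> of at most half of the vertices, the loss of the donors then
  shows that \<open>W\<close> has at least \<open>card W / d\<close> neighbours among the centres, and a larger \<open>W\<close>
  is adjacent to all centres. So the theorem of Hall assigns the leaves.
\<close>

lemma stars_at_roots:
  fixes J :: "'j set"
  assumes J: "finite J" "J \<noteq> {}" and \<phi>: "inj_on \<phi> J" "\<phi> ` J \<subseteq> V"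
    and n: "card V = card J * (1 + 1 + d)"
    and small: "2 * real (card J) \<le> \<eta> * real (card V)" and d: "8 \<le> \<eta>\<^sup>2 * real d"
    and large: "4 * ln (real (card V)) \<le> (\<eta> ^ 3 / 32)\<^sup>2 * real (card J)"
  shows "\<exists>\<tau>. brooms_at E (V - \<phi> ` J) J \<phi> 1 d \<tau>"
proof -
  let ?m = "card J"
  define \<alpha> where "\<alpha> = \<eta> / 2"
  have \<alpha>: "0 < \<alpha>" "\<alpha> \<le> 1/2" using \<eta> by (auto simp: \<alpha>_def)
  have m: "?m > 0" using J by auto
  define X where "X = V - \<phi> ` J"
  have finX: "finite X" using finV by (simp add: X_def)
  have XV: "X \<subseteq> V" by (auto simp: X_def)
  have VX: "V - X = \<phi> ` J" using \<phi> by (auto simp: X_def)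
  have cX: "card X = ?m * (1 + d)"
    using \<phi> J n by (simp add: X_def card_Diff_subset card_image)
  define N where "N = real (card X)"
  have N: "N = real ?m * (1 + real d)" by (simp add: N_def cX distrib_left)
  have Npos: "N > 0" using m unfolding N by (intro mult_pos_pos) auto
  have nN: "real (card V) = N + real ?m" using n by (simp add: N algebra_simps)
  have \<alpha>N: "0 < \<alpha> * N" using \<alpha> Npos by simp
  have degX: "(1/2 + \<alpha>) * real (card V) \<le> real (card (E `` {v} \<inter> X))" if "v \<in> V" for v
  proof -
    have "(1/2 + \<eta>/2) * real (card V) \<le> real (card (E `` {v} \<inter> X))"
      by (rule deg_in_large_subset[OF XV that]) (simp add: VX card_image \<phi> small)
    then show ?thesis by (simp add: \<alpha>_def)
  qed
  obtain e where e: "bij_betw e {..<?m} J"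
    using ex_bij_betw_nat_finite[OF J(1)] by (auto simp: atLeast0LessThan)
  define p where "p i = \<phi> (e i)" for i
  have pV: "p i \<in> V" if "i < ?m" for i using e that \<phi> by (auto simp: p_def bij_betw_def)
  define good where "good z c \<longleftrightarrow> (\<forall>v. (z, v) \<notin> E \<longrightarrow> c v = 0) \<and> (\<forall>v\<in>X. 0 \<le> c v) \<and>
      (\<forall>W\<subseteq>X. 2 * card W \<le> card X \<longrightarrow> (\<Sum>v\<in>W. c v) \<le> 1 - \<alpha>\<^sup>2)" for z and c :: "'a \<Rightarrow> real"
  \<comment> \<open>The factor \<open>\<alpha> * N / 2\<close> scales the deviations from the fair share \<open>1 / N\<close> to size at most \<open>1\<close>.\<close>
  define Q where "Q j z A \<longleftrightarrow> inj_on z {..<j} \<and> (\<forall>i<j. z i \<in> X \<and> (p i, z i) \<in> E) \<and>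
      (\<exists>c. (\<forall>i<j. good (z i) (c i)) \<and> A = (\<lambda>v. \<Sum>i<j. (c i v - 1 / N) * (\<alpha> * N / 2)))"
    for j z and A :: "'a \<Rightarrow> real"
  \<comment> \<open>After rescaling, the relative error is \<open>\<alpha>\<^sup>2 / 2\<close>, half of the loss \<open>\<alpha>\<^sup>2\<close> of the donors.\<close>
  define \<epsilon> where "\<epsilon> = \<alpha> ^ 3 / 4"
  have \<epsilon>: "0 < \<epsilon>" "\<epsilon> \<le> 1"
  proof -
    have "\<alpha> ^ 3 \<le> 1" using \<alpha> by (intro power_le_one) auto
    then show "\<epsilon> \<le> 1" by (simp add: \<epsilon>_def)
  qed (use \<alpha> in \<open>simp add: \<epsilon>_def\<close>)
  have "\<exists>z A. Q ?m z A \<and> (\<forall>v\<in>X. - (\<epsilon> * real ?m) \<le> A v)"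
  proof (rule multiplicative_weights[OF finX \<epsilon>])
    have "ln N \<le> ln (real (card V))" using Npos nN by simp
    then show "4 * ln (real (card X)) \<le> \<epsilon>\<^sup>2 * real ?m"
      using large by (simp add: \<epsilon>_def \<alpha>_def N_def[symmetric] power_divide)
    show "Q 0 (\<lambda>_. undefined) (\<lambda>_. 0)" by (auto simp: Q_def)
    fix j z A and y :: "'a \<Rightarrow> real"
    assume j: "j < ?m" and Qj: "Q j z A" and y: "\<And>v. v \<in> X \<Longrightarrow> 0 \<le> y v"
    obtain c where c: "\<And>i. i < j \<Longrightarrow> good (z i) (c i)" "A = (\<lambda>v. \<Sum>i<j. (c i v - 1 / N) * (\<alpha> * N / 2))"
      and z: "inj_on z {..<j}" "\<And>i. i < j \<Longrightarrow> z i \<in> X \<and> (p i, z i) \<in> E"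
      using Qj unfolding Q_def by blast
    define B where "B = E `` {p j} \<inter> X - z ` {..<j}"
    have "\<exists>x\<in>B. \<exists>c. (\<Sum>v\<in>X. y v) \<le> real (card X) * (\<Sum>v\<in>X. y v * c v) \<and>
      (\<forall>v\<in>X. 0 \<le> c v \<and> c v \<le> 2 / (\<alpha> * real (card X))) \<and> (\<forall>v. (x, v) \<notin> E \<longrightarrow> c v = 0) \<and>
      (\<Sum>v\<in>X. c v) = 1 \<and> (\<forall>W\<subseteq>X. 2 * card W \<le> card X \<longrightarrow> (\<Sum>v\<in>W. c v) \<le> 1 - \<alpha>\<^sup>2)"
    proof (rule balanced_donor[OF symE finX _ _ \<alpha>(1)])
      show "X \<noteq> {}" using Npos by (auto simp: N_def)
      show "B \<subseteq> X" by (auto simp: B_def)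
      show "(1/2 + \<alpha>) * real (card X) \<le> real (card (E `` {x} \<inter> X))" if "x \<in> B" for x
      proof -
        have "x \<in> V" using that XV by (auto simp: B_def)
        moreover have "(1/2 + \<alpha>) * real (card X) \<le> (1/2 + \<alpha>) * real (card V)"
          using \<alpha> nN by (intro mult_left_mono) (auto simp: N_def)
        ultimately show ?thesis using degX[of x] by linarith
      qed
      show "\<alpha> * real (card X) \<le> real (card (E `` {v} \<inter> B))" if v: "v \<in> X" for v
      proof -
        have "card (E `` {v} \<inter> X) + card (E `` {p j} \<inter> X)
            \<le> card X + card ((E `` {v} \<inter> X) \<inter> (E `` {p j} \<inter> X))"
          by (rule card_Int_lower_bound[OF finX]) auto
        moreover have "card ((E `` {v} \<inter> X) \<inter> (E `` {p j} \<inter> X)) \<le> card ((E `` {v} \<inter> B) \<union> z ` {..<j})"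
          using finX by (intro card_mono) (auto simp: B_def)
        moreover have "card ((E `` {v} \<inter> B) \<union> z ` {..<j}) \<le> card (E `` {v} \<inter> B) + card (z ` {..<j})"
          by (rule card_Un_le)
        moreover have "card (z ` {..<j}) \<le> ?m" using card_image_le[of "{..<j}" z] j by simp
        ultimately have "real (card (E `` {v} \<inter> X)) + real (card (E `` {p j} \<inter> X))
            \<le> N + real ?m + real (card (E `` {v} \<inter> B))" unfolding N_def by linarith
        moreover have "(1/2 + \<alpha>) * real (card V) \<le> real (card (E `` {v} \<inter> X))"
          using degX v XV by auto
        moreover have "(1/2 + \<alpha>) * real (card V) \<le> real (card (E `` {p j} \<inter> X))"
          using degX pV[OF j] by auto
        ultimately have "2 * (\<alpha> * real (card V)) \<le> real (card (E `` {v} \<inter> B))"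
          using nN unfolding distrib_right by linarith
        moreover have "\<alpha> * N \<le> \<alpha> * real (card V)" using \<alpha> nN by (intro mult_left_mono) auto
        ultimately show ?thesis using \<alpha>N unfolding N_def by linarith
      qed
    qed (use y in auto)
    then obtain x c' where x: "x \<in> B" and c'0: "(\<Sum>v\<in>X. y v) \<le> real (card X) * (\<Sum>v\<in>X. y v * c' v)"
      "\<forall>v\<in>X. 0 \<le> c' v \<and> c' v \<le> 2 / (\<alpha> * real (card X))" "\<forall>v. (x, v) \<notin> E \<longrightarrow> c' v = 0"
      "\<forall>W\<subseteq>X. 2 * card W \<le> card X \<longrightarrow> (\<Sum>v\<in>W. c' v) \<le> 1 - \<alpha>\<^sup>2"
      by (elim bexE exE conjE) (rule that)
    then have c': "(\<Sum>v\<in>X. y v) \<le> N * (\<Sum>v\<in>X. y v * c' v)"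
      "\<And>v. v \<in> X \<Longrightarrow> 0 \<le> c' v \<and> c' v \<le> 2 / (\<alpha> * N)" "good x c'"
      by (simp_all add: N_def good_def)
    define g where "g v = (c' v - 1 / N) * (\<alpha> * N / 2)" for v
    have "Q (Suc j) (z(j := x)) (\<lambda>v. A v + g v)"
      unfolding Q_def
    proof (intro conjI allI impI)
      show "inj_on (z(j := x)) {..<Suc j}"
        using z(1) x by (auto simp: lessThan_Suc B_def inj_on_def)
      show "(z(j := x)) i \<in> X" if "i < Suc j" for i using that z(2) x by (auto simp: B_def less_Suc_eq)
      show "(p i, (z(j := x)) i) \<in> E" if "i < Suc j" for i using that z(2) x by (auto simp: B_def less_Suc_eq)
      show "\<exists>c. (\<forall>i<Suc j. good ((z(j := x)) i) (c i)) \<and>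
          (\<lambda>v. A v + g v) = (\<lambda>v. \<Sum>i<Suc j. (c i v - 1 / N) * (\<alpha> * N / 2))"
        using c(1) c'(3) by (intro exI[of _ "c(j := c')"]) (auto simp: c(2) g_def less_Suc_eq)
    qed
    moreover have "\<bar>g v\<bar> \<le> 1" if v: "v \<in> X" for v
    proof -
      have "c' v * (\<alpha> * N / 2) \<le> 2 / (\<alpha> * N) * (\<alpha> * N / 2)"
        using c'(2)[OF v] \<alpha>N by (intro mult_right_mono) auto
      moreover have "0 \<le> c' v * (\<alpha> * N / 2)" using c'(2)[OF v] \<alpha>N by simp
      moreover have "g v = c' v * (\<alpha> * N / 2) - \<alpha> / 2" using Npos by (simp add: g_def field_simps)
      ultimately show ?thesis using \<alpha> \<alpha>N Npos by auto
    qed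
    moreover have "0 \<le> (\<Sum>v\<in>X. y v * g v)"
    proof -
      have "y v * g v = (\<alpha> / 2) * (N * (y v * c' v) - y v)" for v
        using Npos by (simp add: g_def field_simps)
      then have "(\<Sum>v\<in>X. y v * g v) = (\<alpha> / 2) * (N * (\<Sum>v\<in>X. y v * c' v) - (\<Sum>v\<in>X. y v))"
        by (simp only: sum_distrib_left[symmetric] sum_subtractf)
      also have "\<dots> \<ge> 0" using c'(1) \<alpha> by (intro mult_nonneg_nonneg) auto
      finally show ?thesis .
    qed
    ultimately show "\<exists>s' g. Q (Suc j) s' (\<lambda>v. A v + g v) \<and> (\<forall>v\<in>X. \<bar>g v\<bar> \<le> 1) \<and> 0 \<le> (\<Sum>v\<in>X. y v * g v)"
      by blast
  qed
  then obtain z A where zA: "Q ?m z A" "\<And>v. v \<in> X \<Longrightarrow> - (\<epsilon> * real ?m) \<le> A v" by blast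
  obtain c where c: "\<And>i. i < ?m \<Longrightarrow> good (z i) (c i)" "A = (\<lambda>v. \<Sum>i<?m. (c i v - 1 / N) * (\<alpha> * N / 2))"
    and z: "inj_on z {..<?m}" "\<And>i. i < ?m \<Longrightarrow> z i \<in> X \<and> (p i, z i) \<in> E"
    using zA(1) unfolding Q_def by blast
  have share: "(1 - \<alpha>\<^sup>2 / 2) * (real ?m / N) \<le> (\<Sum>i<?m. c i v)" if v: "v \<in> X" for v
  proof -
    have "A v = (\<Sum>i<?m. c i v - 1 / N) * (\<alpha> * N / 2)" by (simp only: c(2) sum_distrib_right)
    then have "A v = (\<alpha> * N / 2) * ((\<Sum>i<?m. c i v) - real ?m / N)"
      by (simp add: sum_subtractf mult.commute)
    then have "- (\<epsilon> * real ?m) \<le> (\<alpha> * N / 2) * ((\<Sum>i<?m. c i v) - real ?m / N)" using zA(2)[OF v] by simp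
    moreover have "\<epsilon> * real ?m = (\<alpha> * N / 2) * (\<alpha>\<^sup>2 / 2 * (real ?m / N))"
      using Npos by (simp add: \<epsilon>_def power3_eq_cube power2_eq_square)
    ultimately have "(\<alpha> * N / 2) * (real ?m / N - \<alpha>\<^sup>2 / 2 * (real ?m / N)) \<le> (\<alpha> * N / 2) * (\<Sum>i<?m. c i v)"
      by (simp add: right_diff_distrib)
    then have "real ?m / N - \<alpha>\<^sup>2 / 2 * (real ?m / N) \<le> (\<Sum>i<?m. c i v)"
      by (rule mult_left_le_imp_le) (use \<alpha>N in simp)
    then show ?thesis by (simp only: left_diff_distrib mult_1)
  qed
  define L where "L = X - z ` {..<?m}"
  have finL: "finite L" using finX by (simp add: L_def)
  have cL: "card L = ?m * d"
    unfolding L_def using z by (subst card_Diff_subset) (auto simp: card_image cX)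
  have "\<exists>R. inj_on R L \<and> (\<forall>v\<in>L. R v \<in> {i. i < ?m \<and> (z i, v) \<in> E} \<times> {..<d})"
  proof (rule hall[OF finL])
    show "finite ({i. i < ?m \<and> (z i, v) \<in> E} \<times> {..<d})" for v by auto
    fix W assume W: "W \<subseteq> L"
    define T where "T = {i. i < ?m \<and> (\<exists>v\<in>W. (z i, v) \<in> E)}"
    have finT: "finite T" by (simp add: T_def)
    have WX: "W \<subseteq> X" using W by (auto simp: L_def)
    have finW: "finite W" using WX finX finite_subset by blast
    have U: "(\<Union>v\<in>W. {i. i < ?m \<and> (z i, v) \<in> E} \<times> {..<d}) = T \<times> {..<d}" by (auto simp: T_def)
    have "card W \<le> card T * d"
    proof (cases "2 * card W \<le> card X")
      case True
      have "real (card W) * ((1 - \<alpha>\<^sup>2 / 2) * (real ?m / N)) \<le> (\<Sum>v\<in>W. \<Sum>i<?m. c i v)"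
        using share WX by (intro sum_bounded_below) auto
      also have "\<dots> = (\<Sum>i<?m. \<Sum>v\<in>W. c i v)" by (rule sum.swap)
      also have "\<dots> = (\<Sum>i\<in>T. \<Sum>v\<in>W. c i v)"
      proof (rule sum.mono_neutral_right)
        show "\<forall>i\<in>{..<?m} - T. (\<Sum>v\<in>W. c i v) = 0"
          using c(1) by (auto simp: T_def good_def intro!: sum.neutral)
      qed (auto simp: T_def)
      also have "\<dots> \<le> real (card T) * (1 - \<alpha>\<^sup>2)"
        using c(1) True WX by (intro sum_bounded_above) (auto simp: T_def good_def)
      finally have "real (card W) * ((1 - \<alpha>\<^sup>2 / 2) * (real ?m / N)) \<le> real (card T) * (1 - \<alpha>\<^sup>2)" .
      moreover have "real ?m / N = 1 / (1 + real d)" using m by (simp add: N)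
      ultimately have "real (card W) * (1 - \<alpha>\<^sup>2 / 2) / (1 + real d) \<le> real (card T) * (1 - \<alpha>\<^sup>2)"
        by simp
      then have "real (card W) * (1 - \<alpha>\<^sup>2 / 2) \<le> real (card T) * (1 - \<alpha>\<^sup>2) * (1 + real d)"
        by (subst (asm) pos_divide_le_eq) auto
      then have "real (card W) * (1 - \<alpha>\<^sup>2 / 2) \<le> real (card T) * ((1 - \<alpha>\<^sup>2) * (1 + real d))"
        by (simp only: mult.assoc)
      also have "\<dots> \<le> real (card T) * (real d * (1 - \<alpha>\<^sup>2 / 2))"
      proof (rule mult_left_mono)
        have "2 \<le> \<alpha>\<^sup>2 * real d" using d by (simp add: \<alpha>_def power_divide)
        moreover have "real d * (1 - \<alpha>\<^sup>2 / 2) - (1 - \<alpha>\<^sup>2) * (1 + real d) = \<alpha>\<^sup>2 * real d / 2 + \<alpha>\<^sup>2 - 1"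
          by (simp add: algebra_simps)
        ultimately show "(1 - \<alpha>\<^sup>2) * (1 + real d) \<le> real d * (1 - \<alpha>\<^sup>2 / 2)"
          using zero_le_power2[of \<alpha>] by linarith
      qed simp
      finally have "(real (card W)) * (1 - \<alpha>\<^sup>2 / 2) \<le> (real (card T) * real d) * (1 - \<alpha>\<^sup>2 / 2)"
        by (simp add: mult.assoc)
      moreover have "0 < 1 - \<alpha>\<^sup>2 / 2"
        using \<alpha> power_le_one[of \<alpha> 2] by simp
      ultimately have "real (card W) \<le> real (card T) * real d" by (rule mult_right_le_imp_le)
      then show ?thesis by (simp flip: of_nat_mult)
    next
      case False
      have "{..<?m} \<subseteq> T"
      proof
        fix i assume i: "i \<in> {..<?m}"
        then have zi: "z i \<in> X" using z(2) by auto
        have "(1/2 + \<alpha>) * N \<le> (1/2 + \<alpha>) * real (card V)" using \<alpha> nN by (intro mult_left_mono) auto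
        then have "N / 2 \<le> real (card (E `` {z i} \<inter> X))"
          using degX[of "z i"] zi XV \<alpha>N by (auto simp: distrib_right)
        moreover have "card (E `` {z i} \<inter> X) + card W \<le> card X + card ((E `` {z i} \<inter> X) \<inter> W)"
          using WX by (intro card_Int_lower_bound[OF finX]) auto
        ultimately have "card ((E `` {z i} \<inter> X) \<inter> W) \<noteq> 0" using False unfolding N_def by linarith
        then have "(E `` {z i} \<inter> X) \<inter> W \<noteq> {}" by (metis card.empty)
        then show "i \<in> T" using i by (auto simp: T_def)
      qed
      then have "card {..<?m} \<le> card T" by (rule card_mono[OF finT])
      then have "?m \<le> card T" by simp
      moreover have "card W \<le> ?m * d" using card_mono[OF finL W] cL by simp
      ultimately show ?thesis by (meson le_trans mult_le_mono1)
    qed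
    then show "card W \<le> card (\<Union>v\<in>W. {i. i < ?m \<and> (z i, v) \<in> E} \<times> {..<d})"
      unfolding U by (simp add: card_cartesian_product)
  qed
  then obtain R where R: "inj_on R L" "\<And>v. v \<in> L \<Longrightarrow> R v \<in> {i. i < ?m \<and> (z i, v) \<in> E} \<times> {..<d}" by blast
  have "R ` L = {..<?m} \<times> {..<d}"
  proof (rule card_subset_eq)
    show "R ` L \<subseteq> {..<?m} \<times> {..<d}"
    proof (rule image_subsetI)
      fix v assume "v \<in> L"
      from R(2)[OF this] show "R v \<in> {..<?m} \<times> {..<d}" by (simp add: mem_Times_iff)
    qed
  qed (use R(1) in \<open>simp_all add: card_image cL card_cartesian_product\<close>)
  then have "bij_betw R L ({..<?m} \<times> {..<d})" using R(1) by (simp add: bij_betw_def)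
  then have inv: "bij_betw (inv_into L R) ({..<?m} \<times> {..<d}) L" by (rule bij_betw_inv_into)
  define l where "l = inv_into L R"
  have l: "l (i, k) \<in> L" "(z i, l (i, k)) \<in> E" if "i < ?m" "k < d" for i k
  proof -
    have "(i, k) \<in> R ` L" using that \<open>R ` L = _\<close> by simp
    then show "l (i, k) \<in> L" "(z i, l (i, k)) \<in> E"
      using inv_into_into[of "(i, k)" R L] f_inv_into_f[of "(i, k)" R L] R(2)[of "l (i, k)"]
      by (simp_all add: l_def)
  qed
  define h where "h = inv_into {..<?m} e"
  have h: "bij_betw h J {..<?m}" unfolding h_def using e by (rule bij_betw_inv_into)
  have h_lt: "h j < ?m" if "j \<in> J" for j using h that by (auto simp: bij_betw_def)
  have eh: "e (h j) = j" if "j \<in> J" for j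
    unfolding h_def using e that by (intro f_inv_into_f) (auto simp: bij_betw_def)
  define \<sigma> where "\<sigma> j i = (if i = 0 then z (h j) else l (h j, i - 1))" for j and i :: nat
  have "brooms_at E (V - \<phi> ` J) J \<phi> 1 d \<sigma>"
    unfolding brooms_at_def
  proof (intro conjI ballI allI impI)
    have h_inj: "j = j'" if "h j = h j'" "j \<in> J" "j' \<in> J" for j j'
      using h that by (auto simp: bij_betw_def inj_on_def)
    have zl: "z (h j) \<noteq> l (h j', k)" if "j \<in> J" "j' \<in> J" "k < d" for j j' k
    proof
      assume eq: "z (h j) = l (h j', k)"
      have "z (h j) \<in> z ` {..<?m}" using h_lt[OF that(1)] by simp
      then show False using l(1)[OF h_lt[OF that(2)] that(3)] unfolding L_def eq by blast
    qed
    show "inj_on (\<lambda>(j, i). \<sigma> j i) (J \<times> {..<1 + d})"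
    proof (rule inj_onI, safe)
      fix j i j' i' assume *: "j \<in> J" "j' \<in> J" "i < 1 + d" "i' < 1 + d" "\<sigma> j i = \<sigma> j' i'"
      have "j = j' \<and> i = i'"
      proof (cases i)
        case 0
        then have i': "i' = 0" using * zl[of j j' "i' - 1"] by (cases i') (auto simp: \<sigma>_def)
        then have "z (h j) = z (h j')" using 0 * by (simp add: \<sigma>_def)
        then have "h j = h j'" using inj_onD[OF z(1)] h_lt * by auto
        then show ?thesis using h_inj * 0 i' by simp
      next
        case (Suc k)
        then obtain k' where k': "i' = Suc k'" using * zl[of j' j k] by (cases i') (auto simp: \<sigma>_def)
        then have "l (h j, k) = l (h j', k')" using Suc * by (simp add: \<sigma>_def)
        then have "(h j, k) = (h j', k')"
          unfolding l_def
        proof (rule inj_onD[OF bij_betw_imp_inj_on[OF inv]])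
          show "(h j, k) \<in> {..<?m} \<times> {..<d}" using h_lt[OF *(1)] *(3) Suc by simp
          show "(h j', k') \<in> {..<?m} \<times> {..<d}" using h_lt[OF *(2)] *(4) k' by simp
        qed
        then show ?thesis using h_inj * Suc k' by simp
      qed
      then show "j = j'" "i = i'" by auto
    qed
    show "\<sigma> j i \<in> V - \<phi> ` J" if "j \<in> J" "i < 1 + d" for j i
      using z(2)[OF h_lt[OF that(1)]] l(1)[OF h_lt[OF that(1)], of "i - 1"] that
      unfolding X_def[symmetric] by (auto simp: \<sigma>_def L_def)
    show "(\<phi> j, \<sigma> j 0) \<in> E" if "j \<in> J" for j
      using z(2)[OF h_lt[OF that]] eh[OF that] by (simp add: \<sigma>_def p_def)
    show "(\<sigma> j (1 - 1), \<sigma> j i) \<in> E" if "j \<in> J" "1 \<le> i" "i < 1 + d" for j i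
      using l(2)[OF h_lt[OF that(1)], of "i - 1"] that by (simp add: \<sigma>_def)
  qed auto
  then show ?thesis by blast
qed

end

text \<open>
  The three constructions cover all cases for large \<open>card V\<close>. If \<open>card J\<close> is at least a large
  multiple of \<open>ln (card V)\<close>, the estimates of concentration apply to sets of size \<open>card J\<close>.
  Otherwise, as \<open>d\<close> is bounded, almost all vertices lie on the paths, and every path
  is much longer than \<open>ln (card V)\<close>.
\<close>

lemma attach_brooms:
  fixes \<eta> :: real and D :: nat
  assumes \<eta>: "0 < \<eta>" "\<eta> \<le> 1"
  shows "\<exists>n\<^sub>0. \<forall>(E :: ('a \<times> 'a) set) V (J :: 'j set) \<phi> t d.
    dense_graph E V \<eta> \<longrightarrow> n\<^sub>0 \<le> card V \<longrightarrow> finite J \<longrightarrow> J \<noteq> {} \<longrightarrow> inj_on \<phi> J \<longrightarrow> \<phi> ` J \<subseteq> V \<longrightarrow>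
    card V = card J * (1 + t + d) \<longrightarrow> 1 \<le> t \<longrightarrow> d \<le> D \<longrightarrow> 27 * real (card J) \<le> \<eta> ^ 3 * real (card V) \<longrightarrow>
    (\<exists>\<tau>. brooms_at E (V - \<phi> ` J) J \<phi> t d \<tau>)"
proof -
  \<comment> \<open>The threshold \<open>L * ln (card V)\<close> for \<open>card J\<close> is the one that the stars require.\<close>
  define L where "L = 4096 / \<eta> ^ 6"
  define D' where "D' = real D + 2"
  define e where "e = (\<eta>/4)\<^sup>2"
  have pos: "L > 0" "D' > 0" "e > 0" using \<eta> by (auto simp: L_def D'_def e_def)
  have "\<forall>\<^sub>F n::nat in sequentially. 2 * (L * ln (real n) * D') \<le> \<eta> * real n"
    using \<eta> pos by real_asymp
  moreover have "\<forall>\<^sub>F n::nat in sequentially. 2 \<le> \<eta> * (real n / (L * ln (real n)) - D')"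
    using \<eta> pos by real_asymp
  moreover have "\<forall>\<^sub>F n::nat in sequentially. 8 * ln (real n) \<le> e * (real n / (L * ln (real n)) - D')"
    using \<eta> pos by real_asymp
  moreover have "\<forall>\<^sub>F n::nat in sequentially. n \<ge> 2" by (rule eventually_ge_at_top)
  ultimately have "\<forall>\<^sub>F n::nat in sequentially. 2 * (L * ln (real n) * D') \<le> \<eta> * real n \<and>
      2 \<le> \<eta> * (real n / (L * ln (real n)) - D') \<and>
      8 * ln (real n) \<le> e * (real n / (L * ln (real n)) - D') \<and> n \<ge> 2"
    by eventually_elim simp
  then obtain n\<^sub>0 where n\<^sub>0: "\<And>n. n \<ge> n\<^sub>0 \<Longrightarrow> 2 * (L * ln (real n) * D') \<le> \<eta> * real n"
    "\<And>n. n \<ge> n\<^sub>0 \<Longrightarrow> 2 \<le> \<eta> * (real n / (L * ln (real n)) - D')"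
    "\<And>n. n \<ge> n\<^sub>0 \<Longrightarrow> 8 * ln (real n) \<le> e * (real n / (L * ln (real n)) - D')"
    "\<And>n. n \<ge> n\<^sub>0 \<Longrightarrow> n \<ge> 2"
    unfolding eventually_sequentially by blast
  show ?thesis
  proof (intro exI[of _ n\<^sub>0] allI impI)
    fix E :: "('a \<times> 'a) set" and V and J :: "'j set" and \<phi> t d
    assume G: "dense_graph E V \<eta>" and n0: "n\<^sub>0 \<le> card V" and J: "finite J" "J \<noteq> {}"
      and \<phi>: "inj_on \<phi> J" "\<phi> ` J \<subseteq> V" and n: "card V = card J * (1 + t + d)"
      and t: "1 \<le> t" and d: "d \<le> D" and few: "27 * real (card J) \<le> \<eta> ^ 3 * real (card V)"
    interpret dense_graph E V \<eta> by (rule G)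
    let ?m = "real (card J)" and ?n = "real (card V)"
    have m: "?m > 0" using J by (simp add: card_gt_0_iff)
    have ln_pos: "ln ?n > 0" using n\<^sub>0(4)[OF n0] by simp
    have "\<eta> ^ 3 \<le> \<eta> ^ 1" using \<eta> by (intro power_decreasing) auto
    then have "\<eta> ^ 3 * ?n \<le> \<eta> * ?n" by (intro mult_right_mono) auto
    then have few': "27 * ?m \<le> \<eta> * ?n" using few by linarith
    show "\<exists>\<tau>. brooms_at E (V - \<phi> ` J) J \<phi> t d \<tau>"
    proof (cases "L * ln ?n \<le> ?m")
      case True
      have L: "4 * ln ?n \<le> (\<eta> ^ 3 / 32)\<^sup>2 * ?m"
      proof -
        have "4 * ln ?n = (\<eta> ^ 3 / 32)\<^sup>2 * (L * ln ?n)"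
          using \<eta> by (simp add: L_def power_divide flip: power_mult)
        also have "\<dots> \<le> (\<eta> ^ 3 / 32)\<^sup>2 * ?m" using True by (intro mult_left_mono) auto
        finally show ?thesis .
      qed
      show ?thesis
      proof (cases "t = 1")
        case True
        have "27 * ?m \<le> \<eta> ^ 3 * (2 + real d) * ?m" using few n True by (simp add: algebra_simps)
        then have "27 \<le> \<eta> ^ 3 * (2 + real d)" using m by simp
        moreover have "\<eta> ^ 3 \<le> 1" using \<eta> by (intro power_le_one) auto
        moreover have "\<eta> ^ 3 * real d \<le> \<eta>\<^sup>2 * real d"
          using \<eta> by (intro mult_right_mono power_decreasing) auto
        ultimately have "8 \<le> \<eta>\<^sup>2 * real d" unfolding distrib_left by linarith
        then have "\<exists>\<tau>. brooms_at E (V - \<phi> ` J) J \<phi> 1 d \<tau>"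
          using L few' m n True by (intro stars_at_roots J \<phi>) auto
        then show ?thesis using True by simp
      next
        case False
        have "8 * ln ?n \<le> 2 * ((\<eta> ^ 3 / 32)\<^sup>2 * ?m)" using L by linarith
        also have "2 * (\<eta> ^ 3 / 32)\<^sup>2 \<le> (\<eta> / 4)\<^sup>2"
        proof -
          have "\<eta> ^ 6 \<le> \<eta> ^ 2" using \<eta> by (intro power_decreasing) auto
          moreover have "0 \<le> \<eta>\<^sup>2" by simp
          ultimately have "\<eta> ^ 6 / 512 \<le> \<eta>\<^sup>2 / 16" by linarith
          then show ?thesis by (simp add: power_divide flip: power_mult)
        qed
        then have "2 * ((\<eta> ^ 3 / 32)\<^sup>2 * ?m) \<le> (\<eta> / 4)\<^sup>2 * ?m"
          unfolding mult.assoc[symmetric] by (intro mult_right_mono) auto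
        finally show ?thesis using few' m t False by (intro brooms_by_layers J \<phi> n) auto
      qed
    next
      case False
      have "?n = ?m * (1 + real t + real d)" using n by (simp add: algebra_simps)
      then have "real t - 1 = ?n / ?m - 2 - real d" using m by (simp add: field_simps)
      moreover have "?n / (L * ln ?n) \<le> ?n / ?m"
        using False m by (intro divide_left_mono mult_pos_pos pos ln_pos) auto
      ultimately have t_ge: "?n / (L * ln ?n) - D' \<le> real t - 1" using d by (simp add: D'_def)
      show ?thesis
      proof (rule brooms_by_hamilton_paths[OF J \<phi> n])
        have "?m * (2 + real d) \<le> L * ln ?n * D'"
          using False d m pos ln_pos by (intro mult_mono) (auto simp: D'_def)
        moreover have "real (card J * (2 + d)) = ?m * (2 + real d)" by (simp add: distrib_left)
        ultimately show "2 * real (card J * (2 + d)) \<le> \<eta> * ?n"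
          using n\<^sub>0(1)[OF n0] by linarith
        have "\<eta> * (?n / (L * ln ?n) - D') \<le> \<eta> * (real t - 1)" using t_ge \<eta> by (intro mult_left_mono) auto
        then show "2 \<le> \<eta> * (real t - 1)" using n\<^sub>0(2)[OF n0] by linarith
        have "e * (?n / (L * ln ?n) - D') \<le> e * (real t - 1)" using t_ge pos by (intro mult_left_mono) auto
        then show "8 * ln ?n \<le> (\<eta>/4)\<^sup>2 * (real t - 1)" using n\<^sub>0(3)[OF n0] by (simp add: e_def)
      qed
    qed
  qed
qed

section \<open>Embedding a small bipartite graph\<close>

text \<open>The power mean inequality; the inequality of Bernoulli bounds the power by its tangent at \<open>\<mu>\<close>.\<close>

lemma sum_power_lower_bound:
  fixes a :: "'i \<Rightarrow> real"
  assumes "finite I" and a: "\<And>i. i \<in> I \<Longrightarrow> 0 \<le> a i" and \<mu>: "0 < \<mu>"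
    and sum: "real (card I) * \<mu> \<le> (\<Sum>i\<in>I. a i)"
  shows "real (card I) * \<mu> ^ p \<le> (\<Sum>i\<in>I. a i ^ p)"
proof -
  have "(\<Sum>i\<in>I. \<mu> ^ p * (1 + real p * (a i / \<mu> - 1))) \<le> (\<Sum>i\<in>I. a i ^ p)"
  proof (rule sum_mono)
    fix i assume i: "i \<in> I"
    have "0 \<le> a i / \<mu>" using a[OF i] \<mu> by simp
    then have "1 + real p * (a i / \<mu> - 1) \<le> (1 + (a i / \<mu> - 1)) ^ p"
      by (intro Bernoulli_inequality) linarith
    then have "1 + real p * (a i / \<mu> - 1) \<le> a i ^ p / \<mu> ^ p" by (simp add: power_divide)
    then show "\<mu> ^ p * (1 + real p * (a i / \<mu> - 1)) \<le> a i ^ p"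
      using \<mu> by (simp add: field_simps)
  qed
  moreover have "(\<Sum>i\<in>I. \<mu> ^ p * (1 + real p * (a i / \<mu> - 1)))
      = \<mu> ^ p * (real (card I) + real p * ((\<Sum>i\<in>I. a i) / \<mu> - real (card I)))"
    by (simp add: sum.distrib sum_subtractf flip: sum_distrib_left sum_divide_distrib)
  moreover have "\<mu> ^ p * real (card I) \<le> \<mu> ^ p * (real (card I) + real p * ((\<Sum>i\<in>I. a i) / \<mu> - real (card I)))"
  proof -
    have "real (card I) \<le> (\<Sum>i\<in>I. a i) / \<mu>" using sum \<mu> by (simp add: field_simps)
    then show ?thesis using \<mu> by (intro mult_left_mono) auto
  qed
  ultimately show ?thesis by (simp add: mult.commute)
qed

lemma power_add_le_power_of_sum:
  fixes a b :: real
  assumes "0 \<le> a" and "0 \<le> b" and "0 < p"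
  shows "a ^ p + b ^ p \<le> (a + b) ^ p"
  using assms(3)
proof (induction p rule: nat_induct_non_zero)
  case (Suc p)
  have "a ^ Suc p + b ^ Suc p \<le> (a + b) * (a ^ p + b ^ p)"
    using assms by (simp add: algebra_simps)
  also have "\<dots> \<le> (a + b) * (a + b) ^ p" using assms Suc.IH by (intro mult_left_mono) auto
  finally show ?case by simp
qed simp

definition common_nbrs :: "('a \<times> 'a) set \<Rightarrow> 'a set \<Rightarrow> 'a set \<Rightarrow> 'a set" where
  "common_nbrs E V B = {u \<in> V. \<forall>v\<in>B. (v, u) \<in> E}"

definition poor_tuples :: "('a \<times> 'a) set \<Rightarrow> 'a set \<Rightarrow> nat \<Rightarrow> 'a set \<Rightarrow> nat \<Rightarrow> 'a set \<Rightarrow> 'a list set" where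
  "poor_tuples E V \<kappa> A s B =
     {w. set w \<subseteq> A \<and> length w = s \<and> card (common_nbrs E V (B \<union> set w)) < \<kappa>}"

lemma finite_poor_tuples: "finite A \<Longrightarrow> finite (poor_tuples E V \<kappa> A s B)"
  by (rule finite_subset[OF _ finite_lists_length_eq[of A s]]) (auto simp: poor_tuples_def)

text \<open>
  Dependent random choice. \<open>A\<close> is the common neighbourhood of a random sequence of \<open>\<Delta>\<close>
  vertices: it is large on average, but a sequence with few common neighbours is unlikely to lie
  in it. The constant \<open>c\<close> is the price of such a sequence.
\<close>

lemma dependent_random_choice:
  fixes c :: real
  assumes V: "finite V" "V \<noteq> {}" and E: "sym E" and c: "0 \<le> c"
    and deg: "\<And>v. v \<in> V \<Longrightarrow> card V \<le> 2 * card (E `` {v} \<inter> V)"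
  shows "\<exists>A\<subseteq>V. (real (card V) / 2 ^ \<Delta>) ^ \<Delta> + c * real (card (poor_tuples E V \<kappa> A \<Delta> {}))
    \<le> real (card A) ^ \<Delta> + c * real \<kappa> ^ \<Delta>"
proof -
  let ?n = "real (card V)" and ?cn = "common_nbrs E V"
  define T where "T = {w. set w \<subseteq> V \<and> length w = \<Delta>}"
  have n: "?n > 0" using V by (simp add: card_gt_0_iff)
  have finT: "finite T" unfolding T_def using V by (simp add: finite_lists_length_eq)
  have cT: "card T = card V ^ \<Delta>" unfolding T_def using V by (simp add: card_lists_length_eq)
  have fincn: "finite (?cn B)" for B using V by (simp add: common_nbrs_def)
  have cn_sub: "?cn B \<subseteq> V" for B by (auto simp: common_nbrs_def)
  have swap: "(set w \<subseteq> ?cn (set w')) \<longleftrightarrow> (set w' \<subseteq> ?cn (set w))" if "w \<in> T" "w' \<in> T" for w w'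
  proof -
    have *: "set w \<subseteq> ?cn (set w') \<longleftrightarrow> (\<forall>u\<in>set w. \<forall>v\<in>set w'. (v, u) \<in> E)" if "w \<in> T" for w w'
      using that by (auto simp: common_nbrs_def T_def)
    show ?thesis unfolding *[OF that(1)] *[OF that(2)] by (auto intro: symD[OF E])
  qed
  have count: "card {w \<in> T. set w \<subseteq> S} = card S ^ \<Delta>" if "S \<subseteq> V" for S
  proof -
    have "{w \<in> T. set w \<subseteq> S} = {w. set w \<subseteq> S \<and> length w = \<Delta>}" using that by (auto simp: T_def)
    then show ?thesis by (simp add: card_lists_length_eq[OF finite_subset[OF that V(1)]])
  qed
  have "(\<Sum>w\<in>T. real (card (?cn (set w)))) = (\<Sum>w\<in>T. \<Sum>v\<in>V. of_bool (v \<in> ?cn (set w)))"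
  proof (intro sum.cong refl)
    fix w
    have "V \<inter> {v. v \<in> ?cn (set w)} = ?cn (set w)" using cn_sub by auto
    then show "real (card (?cn (set w))) = (\<Sum>v\<in>V. of_bool (v \<in> ?cn (set w)))" using V(1) by simp
  qed
  also have "\<dots> = (\<Sum>v\<in>V. \<Sum>w\<in>T. of_bool (v \<in> ?cn (set w)))" by (rule sum.swap)
  also have "\<dots> = (\<Sum>v\<in>V. real (card (E `` {v} \<inter> V)) ^ \<Delta>)"
  proof (intro sum.cong refl)
    fix v assume v: "v \<in> V"
    have "{w \<in> T. v \<in> ?cn (set w)} = {w \<in> T. set w \<subseteq> E `` {v} \<inter> V}"
      using v by (auto simp: common_nbrs_def T_def intro: symD[OF E])
    then have "card {w \<in> T. v \<in> ?cn (set w)} = card (E `` {v} \<inter> V) ^ \<Delta>"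
      using count[of "E `` {v} \<inter> V"] by (metis inf_le2)
    then show "(\<Sum>w\<in>T. of_bool (v \<in> ?cn (set w))) = real (card (E `` {v} \<inter> V)) ^ \<Delta>"
      using finT by (simp add: Int_def)
  qed
  also have "\<dots> \<ge> (\<Sum>v\<in>V. (?n / 2) ^ \<Delta>)"
  proof (intro sum_mono power_mono)
    show "?n / 2 \<le> real (card (E `` {v} \<inter> V))" if "v \<in> V" for v using deg[OF that] by linarith
  qed simp
  finally have "real (card T) * (?n / 2 ^ \<Delta>) \<le> (\<Sum>w\<in>T. real (card (?cn (set w))))"
    by (simp add: cT power_divide mult.commute)
  then have large: "real (card T) * (?n / 2 ^ \<Delta>) ^ \<Delta> \<le> (\<Sum>w\<in>T. real (card (?cn (set w))) ^ \<Delta>)"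
    using n by (intro sum_power_lower_bound[OF finT]) auto
  have "(\<Sum>w\<in>T. real (card (poor_tuples E V \<kappa> (?cn (set w)) \<Delta> {})))
      = (\<Sum>w\<in>T. \<Sum>w'\<in>T. of_bool (set w' \<subseteq> ?cn (set w) \<and> card (?cn (set w')) < \<kappa>))"
  proof (intro sum.cong refl)
    fix w assume w: "w \<in> T"
    have "poor_tuples E V \<kappa> (?cn (set w)) \<Delta> {} = {w' \<in> T. set w' \<subseteq> ?cn (set w) \<and> card (?cn (set w')) < \<kappa>}"
      using cn_sub by (auto simp: poor_tuples_def T_def)
    then show "real (card (poor_tuples E V \<kappa> (?cn (set w)) \<Delta> {}))
        = (\<Sum>w'\<in>T. of_bool (set w' \<subseteq> ?cn (set w) \<and> card (?cn (set w')) < \<kappa>))"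
      using finT by (simp add: Int_def)
  qed
  also have "\<dots> = (\<Sum>w'\<in>T. \<Sum>w\<in>T. of_bool (set w' \<subseteq> ?cn (set w) \<and> card (?cn (set w')) < \<kappa>))"
    by (rule sum.swap)
  also have "\<dots> \<le> (\<Sum>w'\<in>T. real \<kappa> ^ \<Delta>)"
  proof (rule sum_mono)
    fix w' assume w': "w' \<in> T"
    show "(\<Sum>w\<in>T. of_bool (set w' \<subseteq> ?cn (set w) \<and> card (?cn (set w')) < \<kappa>)) \<le> real \<kappa> ^ \<Delta>"
    proof (cases "card (?cn (set w')) < \<kappa>")
      case True
      have "(\<Sum>w\<in>T. of_bool (set w' \<subseteq> ?cn (set w) \<and> card (?cn (set w')) < \<kappa>))
          = real (card {w \<in> T. set w \<subseteq> ?cn (set w')})"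
        using True swap[OF w'] finT by (auto simp: Int_def intro!: arg_cong[of _ _ card])
      also have "\<dots> = real (card (?cn (set w'))) ^ \<Delta>" using count[OF cn_sub] by simp
      also have "\<dots> \<le> real \<kappa> ^ \<Delta>" using True by (intro power_mono) auto
      finally show ?thesis .
    qed simp
  qed
  finally have poor: "(\<Sum>w\<in>T. real (card (poor_tuples E V \<kappa> (?cn (set w)) \<Delta> {}))) \<le> real (card T) * real \<kappa> ^ \<Delta>"
    by simp
  have "\<exists>w\<in>T. (?n / 2 ^ \<Delta>) ^ \<Delta> + c * real (card (poor_tuples E V \<kappa> (?cn (set w)) \<Delta> {}))
      \<le> real (card (?cn (set w))) ^ \<Delta> + c * real \<kappa> ^ \<Delta>"
  proof (rule ccontr)
    assume "\<not> ?thesis"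
    then have less: "real (card (?cn (set w))) ^ \<Delta> + c * real \<kappa> ^ \<Delta>
        < (?n / 2 ^ \<Delta>) ^ \<Delta> + c * real (card (poor_tuples E V \<kappa> (?cn (set w)) \<Delta> {}))" if "w \<in> T" for w
      using that by auto
    have "T \<noteq> {}" using cT n by auto
    then have "(\<Sum>w\<in>T. real (card (?cn (set w))) ^ \<Delta> + c * real \<kappa> ^ \<Delta>)
        < (\<Sum>w\<in>T. (?n / 2 ^ \<Delta>) ^ \<Delta> + c * real (card (poor_tuples E V \<kappa> (?cn (set w)) \<Delta> {})))"
      using less finT by (intro sum_strict_mono) auto
    also have "\<dots> = real (card T) * (?n / 2 ^ \<Delta>) ^ \<Delta> + c * (\<Sum>w\<in>T. real (card (poor_tuples E V \<kappa> (?cn (set w)) \<Delta> {})))"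
      by (simp add: sum.distrib sum_distrib_left)
    also have "\<dots> \<le> (\<Sum>w\<in>T. real (card (?cn (set w))) ^ \<Delta>) + c * (real (card T) * real \<kappa> ^ \<Delta>)"
      using large poor c by (intro add_mono mult_left_mono)
    finally show False by (simp add: sum.distrib)
  qed
  then show ?thesis using cn_sub by blast
qed

text \<open>
  A partial image \<open>B\<close> of the neighbourhood of a vertex, \<open>s\<close> of whose neighbours are still to be
  embedded, is safe if a random choice of the missing images yields at least \<open>\<kappa>\<close> common
  neighbours except with probability less than \<open>(2 * \<Delta>) ^ - s\<close>. By averaging, fewer than
  \<open>card A / (2 * \<Delta>)\<close> choices of the next image make \<open>B\<close> unsafe, so that all
  \<open>\<Delta>\<close> neighbourhoods of a new vertex can be kept safe at once.
\<close>

definition safe :: "('a \<times> 'a) set \<Rightarrow> 'a set \<Rightarrow> nat \<Rightarrow> nat \<Rightarrow> 'a set \<Rightarrow> nat \<Rightarrow> 'a set \<Rightarrow> bool" where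
  "safe E V \<kappa> \<Delta> A s B \<longleftrightarrow> card (poor_tuples E V \<kappa> A s B) * (2 * \<Delta>) ^ s < card A ^ s"

lemma card_unsafe_extensions:
  assumes A: "finite A" and safe: "safe E V \<kappa> \<Delta> A (Suc s) B"
  shows "card {a \<in> A. \<not> safe E V \<kappa> \<Delta> A s (insert a B)} * (2 * \<Delta>) < card A"
proof -
  let ?f = "\<lambda>s B. card (poor_tuples E V \<kappa> A s B)"
  let ?Z = "{a \<in> A. \<not> safe E V \<kappa> \<Delta> A s (insert a B)}"
  have "poor_tuples E V \<kappa> A (Suc s) B = (\<lambda>(a, w). a # w) ` (SIGMA a:A. poor_tuples E V \<kappa> A s (insert a B))"
    by (force simp: poor_tuples_def length_Suc_conv image_iff)
  moreover have "inj_on (\<lambda>(a, w). a # w) (SIGMA a:A. poor_tuples E V \<kappa> A s (insert a B))"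
    by (auto simp: inj_on_def)
  ultimately have f: "?f (Suc s) B = (\<Sum>a\<in>A. ?f s (insert a B))"
    using A by (simp add: card_image card_SigmaI finite_poor_tuples)
  have "card ?Z * card A ^ s \<le> (\<Sum>a\<in>?Z. ?f s (insert a B) * (2 * \<Delta>) ^ s)"
  proof -
    have "card ?Z * card A ^ s = (\<Sum>a\<in>?Z. card A ^ s)" by simp
    also have "\<dots> \<le> (\<Sum>a\<in>?Z. ?f s (insert a B) * (2 * \<Delta>) ^ s)"
      by (rule sum_mono) (auto simp: safe_def not_less)
    finally show ?thesis .
  qed
  also have "\<dots> \<le> (\<Sum>a\<in>A. ?f s (insert a B) * (2 * \<Delta>) ^ s)"
    using A by (intro sum_mono2) auto
  also have "\<dots> = ?f (Suc s) B * (2 * \<Delta>) ^ s" by (simp add: f sum_distrib_right)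
  finally have "card ?Z * (2 * \<Delta>) * card A ^ s \<le> ?f (Suc s) B * (2 * \<Delta>) ^ Suc s"
    using mult_le_mono1[of "card ?Z * card A ^ s" _ "2 * \<Delta>"] by (simp add: algebra_simps)
  also have "\<dots> < card A * card A ^ s" using safe by (simp add: safe_def)
  finally show ?thesis by simp
qed

text \<open>
  One side is embedded vertex by vertex, keeping the partial image of the neighbourhood of every
  vertex of the other side safe. In the end each of these neighbourhoods has so many common
  neighbours that the other side can be embedded greedily.
\<close>

theorem embed_bipartite:
  fixes P :: "'p set" and Y :: "'y set"
  assumes V: "finite V" and E: "sym E"
    and deg: "\<And>v. v \<in> V \<Longrightarrow> card V \<le> 2 * card (E `` {v} \<inter> V)"
    and P: "finite P" "card P \<le> k" and Y: "finite Y" "card Y \<le> k"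
    and \<Gamma>: "\<And>y. y \<in> Y \<Longrightarrow> \<Gamma> y \<subseteq> P" "\<And>y. y \<in> Y \<Longrightarrow> card (\<Gamma> y) = \<Delta>"
      "\<And>x. x \<in> P \<Longrightarrow> card {y \<in> Y. x \<in> \<Gamma> y} \<le> \<Delta>"
    and k: "0 < k" "0 < \<Delta>" "6 * \<Delta> * 2 ^ \<Delta> * k \<le> card V"
  shows "\<exists>\<phi> \<psi>. inj_on \<phi> P \<and> inj_on \<psi> Y \<and> \<phi> ` P \<subseteq> V \<and> \<psi> ` Y \<subseteq> V \<and> \<phi> ` P \<inter> \<psi> ` Y = {} \<and>
    (\<forall>y\<in>Y. \<forall>x\<in>\<Gamma> y. (\<phi> x, \<psi> y) \<in> E)"
proof -
  \<comment> \<open>Up to \<open>k\<close> common neighbours may be occupied by the first side, and \<open>k\<close> must remain.\<close>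
  define \<kappa> where "\<kappa> = 2 * k"
  let ?safe = "safe E V \<kappa> \<Delta>"
  have "0 < 6 * \<Delta> * 2 ^ \<Delta> * k" using k by simp
  then have "V \<noteq> {}" using k(3) by auto
  then obtain A where A: "A \<subseteq> V" "(real (card V) / 2 ^ \<Delta>) ^ \<Delta>
      + (2 * real \<Delta>) ^ \<Delta> * real (card (poor_tuples E V \<kappa> A \<Delta> {}))
    \<le> real (card A) ^ \<Delta> + (2 * real \<Delta>) ^ \<Delta> * real \<kappa> ^ \<Delta>"
    using dependent_random_choice[OF V _ E _ deg, of "(2 * real \<Delta>) ^ \<Delta>" \<Delta> \<kappa>] by auto
  have finA: "finite A" using A V finite_subset by blast
  have "real (6 * \<Delta> * 2 ^ \<Delta> * k) \<le> real (card V)" using k(3) by (simp only: of_nat_le_iff)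
  then have "6 * real \<Delta> * real k \<le> real (card V) / 2 ^ \<Delta>" by (simp add: field_simps)
  then have "(6 * real \<Delta> * real k) ^ \<Delta> \<le> (real (card V) / 2 ^ \<Delta>) ^ \<Delta>" by (intro power_mono) auto
  moreover have "(4 * real \<Delta> * real k) ^ \<Delta> + (2 * real \<Delta> * real k) ^ \<Delta> \<le> (6 * real \<Delta> * real k) ^ \<Delta>"
  proof -
    have "(4 * real \<Delta> * real k) ^ \<Delta> + (2 * real \<Delta> * real k) ^ \<Delta>
        \<le> (4 * real \<Delta> * real k + 2 * real \<Delta> * real k) ^ \<Delta>"
      by (rule power_add_le_power_of_sum) (use k in auto)
    also have "4 * real \<Delta> * real k + 2 * real \<Delta> * real k = 6 * real \<Delta> * real k" by simp
    finally show ?thesis .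
  qed
  moreover have "(2 * real \<Delta>) ^ \<Delta> * real \<kappa> ^ \<Delta> = (4 * real \<Delta> * real k) ^ \<Delta>"
  proof -
    have "(2 * real \<Delta>) ^ \<Delta> * real \<kappa> ^ \<Delta> = (2 * real \<Delta> * real \<kappa>) ^ \<Delta>" by (simp only: power_mult_distrib)
    also have "2 * real \<Delta> * real \<kappa> = 4 * real \<Delta> * real k" by (simp add: \<kappa>_def)
    finally show ?thesis .
  qed
  ultimately have A': "(2 * real \<Delta> * real k) ^ \<Delta> + (2 * real \<Delta>) ^ \<Delta> * real (card (poor_tuples E V \<kappa> A \<Delta> {}))
      \<le> real (card A) ^ \<Delta>" using A(2) by linarith
  have "0 \<le> (2 * real \<Delta>) ^ \<Delta> * real (card (poor_tuples E V \<kappa> A \<Delta> {}))" by simp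
  then have "(2 * real \<Delta> * real k) ^ \<Delta> \<le> real (card A) ^ \<Delta>" using A' by linarith
  then have "2 * real \<Delta> * real k \<le> real (card A)" using k by (simp add: power_mono_iff)
  then have "real (2 * \<Delta> * k) \<le> real (card A)" by simp
  then have "2 * \<Delta> * k \<le> card A" by (simp only: of_nat_le_iff)
  moreover have "2 * 1 * k \<le> 2 * \<Delta> * k" using k by (intro mult_le_mono) auto
  ultimately have cA: "2 * k \<le> card A" by linarith
  have "0 < (2 * real \<Delta> * real k) ^ \<Delta>" using k by simp
  then have "(2 * real \<Delta>) ^ \<Delta> * real (card (poor_tuples E V \<kappa> A \<Delta> {})) < real (card A) ^ \<Delta>" using A' by linarith
  moreover have "real (card (poor_tuples E V \<kappa> A \<Delta> {}) * (2 * \<Delta>) ^ \<Delta>)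
      = (2 * real \<Delta>) ^ \<Delta> * real (card (poor_tuples E V \<kappa> A \<Delta> {}))" by simp
  moreover have "real (card A ^ \<Delta>) = real (card A) ^ \<Delta>" by simp
  ultimately have "real (card (poor_tuples E V \<kappa> A \<Delta> {}) * (2 * \<Delta>) ^ \<Delta>) < real (card A ^ \<Delta>)"
    by linarith
  then have start: "?safe A \<Delta> {}" unfolding safe_def of_nat_less_iff .
  have "\<exists>\<phi>. inj_on \<phi> P' \<and> \<phi> ` P' \<subseteq> A \<and> (\<forall>y\<in>Y. ?safe A (card (\<Gamma> y - P')) (\<phi> ` (\<Gamma> y \<inter> P')))"
    if "P' \<subseteq> P" for P'
    using finite_subset[OF that P(1)] that
  proof (induction P' rule: finite_induct)
    case empty
    then show ?case using start \<Gamma>(2) by simp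
  next
    case (insert x P')
    then obtain \<phi> where \<phi>: "inj_on \<phi> P'" "\<phi> ` P' \<subseteq> A"
      "\<And>y. y \<in> Y \<Longrightarrow> ?safe A (card (\<Gamma> y - P')) (\<phi> ` (\<Gamma> y \<inter> P'))" by auto
    define Y\<^sub>x where "Y\<^sub>x = {y \<in> Y. x \<in> \<Gamma> y}"
    define Z where "Z y = {a \<in> A. \<not> ?safe A (card (\<Gamma> y - insert x P')) (insert a (\<phi> ` (\<Gamma> y \<inter> P')))}" for y
    have finY: "finite Y\<^sub>x" using Y by (simp add: Y\<^sub>x_def)
    have card_Suc: "card (\<Gamma> y - P') = Suc (card (\<Gamma> y - insert x P'))" if "y \<in> Y\<^sub>x" for y
    proof -
      have "finite (\<Gamma> y)" using that finite_subset[OF \<Gamma>(1) P(1)] by (auto simp: Y\<^sub>x_def)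
      moreover have "\<Gamma> y - P' = insert x (\<Gamma> y - insert x P')" using that insert.hyps by (auto simp: Y\<^sub>x_def)
      ultimately show ?thesis by (metis Diff_iff card_insert_disjoint finite_Diff insertI1)
    qed
    have Zy: "card (Z y) * (2 * \<Delta>) \<le> card A" if "y \<in> Y\<^sub>x" for y
      using card_unsafe_extensions[OF finA, of E V \<kappa> \<Delta> "card (\<Gamma> y - insert x P')" "\<phi> ` (\<Gamma> y \<inter> P')"]
        \<phi>(3)[of y] card_Suc[OF that] that by (auto simp: Z_def Y\<^sub>x_def)
    have "card (\<Union>y\<in>Y\<^sub>x. Z y) * (2 * \<Delta>) \<le> (\<Sum>y\<in>Y\<^sub>x. card (Z y)) * (2 * \<Delta>)"
      using finY by (intro mult_right_mono card_UN_le) auto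
    also have "\<dots> = (\<Sum>y\<in>Y\<^sub>x. card (Z y) * (2 * \<Delta>))" by (rule sum_distrib_right)
    also have "\<dots> \<le> card Y\<^sub>x * card A" using sum_bounded_above[of Y\<^sub>x _ "card A"] Zy by simp
    also have "\<dots> \<le> \<Delta> * card A" using \<Gamma>(3)[of x] insert.prems by (intro mult_right_mono) (auto simp: Y\<^sub>x_def)
    finally have "\<Delta> * (2 * card (\<Union>y\<in>Y\<^sub>x. Z y)) \<le> \<Delta> * card A" by (simp add: algebra_simps)
    then have UZ: "2 * card (\<Union>y\<in>Y\<^sub>x. Z y) \<le> card A" using k by simp
    have "card (insert x P') \<le> k" using insert.prems P card_mono[of P "insert x P'"] by linarith
    then have "card (\<phi> ` P') < k" using insert.hyps card_image_le[of P' \<phi>] by simp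
    then have "card ((\<Union>y\<in>Y\<^sub>x. Z y) \<union> \<phi> ` P') < card A"
      using card_Un_le[of "\<Union>y\<in>Y\<^sub>x. Z y" "\<phi> ` P'"] UZ cA by linarith
    then have "\<not> A \<subseteq> (\<Union>y\<in>Y\<^sub>x. Z y) \<union> \<phi> ` P'"
      using card_mono[of "(\<Union>y\<in>Y\<^sub>x. Z y) \<union> \<phi> ` P'" A] finY finA insert.hyps
      by (auto simp: Z_def not_less[symmetric])
    then obtain a where a: "a \<in> A" "a \<notin> \<phi> ` P'" "\<And>y. y \<in> Y\<^sub>x \<Longrightarrow> a \<notin> Z y" by blast
    have same: "(\<phi>(x := a)) ` S = \<phi> ` S" if "S \<subseteq> P'" for S using that insert.hyps by auto
    have ins: "(\<phi>(x := a)) ` insert x S = insert a (\<phi> ` S)" if "S \<subseteq> P'" for S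
      using same[OF that] by (metis fun_upd_same image_insert)
    show ?case
    proof (intro exI[of _ "\<phi>(x := a)"] conjI ballI)
      show "inj_on (\<phi>(x := a)) (insert x P')" using \<phi>(1) a insert.hyps by (auto simp: inj_on_def)
      show "(\<phi>(x := a)) ` insert x P' \<subseteq> A" using \<phi>(2) a(1) ins[of P'] by auto
      fix y assume y: "y \<in> Y"
      show "?safe A (card (\<Gamma> y - insert x P')) ((\<phi>(x := a)) ` (\<Gamma> y \<inter> insert x P'))"
      proof (cases "x \<in> \<Gamma> y")
        case True
        then have "\<Gamma> y \<inter> insert x P' = insert x (\<Gamma> y \<inter> P')" by auto
        then have "(\<phi>(x := a)) ` (\<Gamma> y \<inter> insert x P') = insert a (\<phi> ` (\<Gamma> y \<inter> P'))"
          using ins[of "\<Gamma> y \<inter> P'"] by (metis inf_le2)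
        then show ?thesis using a(3)[of y] a(1) y True by (simp add: Y\<^sub>x_def Z_def)
      next
        case False
        then have "\<Gamma> y \<inter> insert x P' = \<Gamma> y \<inter> P'" "\<Gamma> y - insert x P' = \<Gamma> y - P'" by auto
        then show ?thesis using \<phi>(3)[OF y] same[of "\<Gamma> y \<inter> P'"] by (metis inf_le2)
      qed
    qed
  qed
  from this[of P] obtain \<phi> where \<phi>: "inj_on \<phi> P" "\<phi> ` P \<subseteq> A"
    "\<And>y. y \<in> Y \<Longrightarrow> ?safe A (card (\<Gamma> y - P)) (\<phi> ` (\<Gamma> y \<inter> P))" by auto
  have rich: "2 * k \<le> card (common_nbrs E V (\<phi> ` \<Gamma> y))" if y: "y \<in> Y" for y
  proof (rule ccontr)
    assume "\<not> 2 * k \<le> card (common_nbrs E V (\<phi> ` \<Gamma> y))"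
    then have "poor_tuples E V \<kappa> A 0 (\<phi> ` \<Gamma> y) = {[]}" by (auto simp: poor_tuples_def \<kappa>_def)
    moreover have "card (\<Gamma> y - P) = 0" "\<Gamma> y \<inter> P = \<Gamma> y"
      using \<Gamma>(1)[OF y] by (metis Diff_eq_empty_iff card.empty, blast)
    ultimately show False using \<phi>(3)[OF y] by (simp add: safe_def)
  qed
  have "\<exists>\<psi>. inj_on \<psi> Y \<and> (\<forall>y\<in>Y. \<psi> y \<in> common_nbrs E V (\<phi> ` \<Gamma> y) - \<phi> ` P)"
  proof (rule sdr_of_large_sets[OF Y(1)])
    show "finite (common_nbrs E V (\<phi> ` \<Gamma> y) - \<phi> ` P)" for y using V by (simp add: common_nbrs_def)
    show "card Y \<le> card (common_nbrs E V (\<phi> ` \<Gamma> y) - \<phi> ` P)" if "y \<in> Y" for y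
      using rich[OF that] Y(2) P card_image_le[of P \<phi>]
        diff_card_le_card_Diff[of "\<phi> ` P" "common_nbrs E V (\<phi> ` \<Gamma> y)"] by simp
  qed
  then obtain \<psi> where \<psi>: "inj_on \<psi> Y" "\<And>y. y \<in> Y \<Longrightarrow> \<psi> y \<in> common_nbrs E V (\<phi> ` \<Gamma> y) - \<phi> ` P" by blast
  have "\<psi> y \<notin> \<phi> ` P" if "y \<in> Y" for y using \<psi>(2)[OF that] by blast
  then have "\<phi> ` P \<inter> \<psi> ` Y = {}" unfolding disjoint_iff by blast
  then show ?thesis
    using \<phi>(1,2) A(1) \<psi> by (intro exI[of _ \<phi>] exI[of _ \<psi>]) (auto simp: common_nbrs_def)
qed

section \<open>The structure of the graphs of the class\<close>

lemma spanning_copyI: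
  assumes H: "pair_graph H" and G: "pair_graph G"
    and f: "inj_on f (pverts H)" "f ` pverts H = pverts G"
    and edges: "\<And>u v. (u, v) \<in> parcs H \<Longrightarrow> (f u, f v) \<in> parcs G"
  shows "\<exists>K. spanning K (with_proj G) \<and> digraph_iso (with_proj H) K"
proof -
  interpret H: pair_graph H by (rule H)
  interpret G: pair_graph G by (rule G)
  define h where "h = \<lparr>iso_verts = f, iso_arcs = map_prod f f, iso_head = snd, iso_tail = fst\<rparr>"
  have "inj_on (map_prod f f) (parcs H)"
  proof (rule inj_on_subset)
    show "inj_on (map_prod f f) (pverts H \<times> pverts H)" using f(1) f(1) by (rule map_prod_inj_on)
    show "parcs H \<subseteq> pverts H \<times> pverts H" by (auto dest: H.in_arcsD1 H.in_arcsD2)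
  qed
  then have iso: "pre_digraph.digraph_isomorphism (with_proj H) h"
    unfolding pre_digraph.digraph_isomorphism_def h_def using H.wf_digraph f(1) by (simp add: map_prod_def split_beta)
  let ?K = "app_iso h (with_proj H)"
  have "wf_digraph ?K" using H.wf_digraphI_app_iso[OF iso] .
  moreover have "arcs ?K \<subseteq> parcs G" using edges by (auto simp: h_def)
  ultimately have "spanning ?K (with_proj G)"
    using f(2) G.wf_digraph by (auto simp: spanning_def subgraph_def compatible_def h_def)
  then show ?thesis using iso by (auto simp: digraph_iso_def)
qed

text \<open>
  In a symmetric digraph, the two ends of an arc reach each other. So the strongly connected
  components partition not only the vertices, but also the arcs.
\<close>

lemma components_of_induced_subgraph:
  assumes H: "pair_graph H" and W: "W \<subseteq> pverts H"
  defines "comps \<equiv> pre_digraph.sccs (with_proj H \<restriction> W)"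
  shows "\<And>K K' v. K \<in> comps \<Longrightarrow> K' \<in> comps \<Longrightarrow> v \<in> verts K \<Longrightarrow> v \<in> verts K' \<Longrightarrow> K = K'"
    and "\<And>v. v \<in> W \<Longrightarrow> \<exists>K\<in>comps. v \<in> verts K"
    and "\<And>u v. (u, v) \<in> parcs H \<Longrightarrow> u \<in> W \<Longrightarrow> v \<in> W \<Longrightarrow> \<exists>K\<in>comps. (u, v) \<in> arcs K"
    and "\<And>K. K \<in> comps \<Longrightarrow> verts K \<subseteq> W \<and> tail K = fst \<and> head K = snd"
proof -
  interpret H: pair_graph H by (rule H)
  interpret R: wf_digraph "with_proj H \<restriction> W"
    by (rule H.wellformed_induce_subgraph)
  interpret Rsym: sym_digraph "with_proj H \<restriction> W"
  proof
    show "symmetric (with_proj H \<restriction> W)"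
      using H.sym_arcs unfolding symmetric_conv by fastforce
  qed
  have ends: "tail (with_proj H \<restriction> W) = fst" "head (with_proj H \<restriction> W) = snd" by auto
  have conv: "comps = (\<lambda>u. (with_proj H \<restriction> W) \<restriction> R.scc_of u) ` W"
    unfolding comps_def R.sccs_conv_sccs_verts R.sccs_verts_conv_scc_of by auto
  show "K = K'" if "K \<in> comps" "K' \<in> comps" "v \<in> verts K" "v \<in> verts K'" for K K' v
  proof (rule ccontr)
    assume "K \<noteq> K'"
    then have "verts K \<inter> verts K' = {}" using that unfolding comps_def by (intro R.scc_disj)
    then show False using that by blast
  qed
  show "\<exists>K\<in>comps. v \<in> verts K" if "v \<in> W" for v
    using that R.in_scc_of_self[of v] unfolding conv by auto
  show "\<exists>K\<in>comps. (u, v) \<in> arcs K" if uv: "(u, v) \<in> parcs H" "u \<in> W" "v \<in> W" for u v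
  proof -
    have "(u, v) \<in> arcs_ends (with_proj H \<restriction> W)"
      using uv by (auto simp: arcs_ends_conv intro!: rev_image_eqI[of "(u, v)"])
    then have "v \<in> R.scc_of u" by (intro Rsym.scc_ofI_reachable' R.reachable_adjI) 
    moreover have "u \<in> R.scc_of u" using uv R.in_scc_of_self by simp
    ultimately show ?thesis using uv unfolding conv by auto
  qed
  show "verts K \<subseteq> W \<and> tail K = fst \<and> head K = snd" if "K \<in> comps" for K
    using that R.sccs_verts_subsets R.sccs_verts_conv_scc_of unfolding conv by fastforce
qed

text \<open>
  An isomorphism of digraphs acts on vertices and on arcs separately. If the arcs of the image are
  pairs of vertices, its action on vertices determines that on arcs.
\<close>

lemma iso_onto_pairs:
  assumes "iso_onto h (with_proj B) K" and "tail K = fst" and "head K = snd"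
  shows "verts K = iso_verts h ` pverts B" and "inj_on (iso_verts h) (pverts B)"
    and "\<And>u v. (u, v) \<in> arcs K \<Longrightarrow> \<exists>i j. (i, j) \<in> parcs B \<and> u = iso_verts h i \<and> v = iso_verts h j"
proof -
  have iso: "pre_digraph.digraph_isomorphism (with_proj B) h" and K: "K = app_iso h (with_proj B)"
    using assms(1) by (auto simp: iso_onto_def)
  show "verts K = iso_verts h ` pverts B" by (simp add: K)
  show "inj_on (iso_verts h) (pverts B)"
    using iso by (simp add: pre_digraph.digraph_isomorphism_def)
  fix u v assume "(u, v) \<in> arcs K"
  then obtain i j where ij: "(i, j) \<in> parcs B" "iso_arcs h (i, j) = (u, v)" by (auto simp: K)
  have "iso_tail h = fst" "iso_head h = snd" using assms(2,3) by (auto simp: K)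
  then have "iso_verts h i = u" "iso_verts h j = v"
    using iso ij by (fastforce simp: pre_digraph.digraph_isomorphism_def)+
  then show "\<exists>i j. (i, j) \<in> parcs B \<and> u = iso_verts h i \<and> v = iso_verts h j" using ij by blast
qed

text \<open>
  A graph of the class in coordinates. The vertices outside \<open>S\<close> are \<open>\<beta> x i\<close>, where the broom
  with vertices \<open>\<beta> x 0, \<beta> x 1, \<dots>\<close> hangs from \<open>x \<in> S\<close>, and \<open>g\<close> identifies the bipartite
  graph of \<open>U i\<close> with the edges inside \<open>S\<close>.
\<close>

lemma H_class_structure:
  assumes "H \<in> H_class C r t U n" and "t \<ge> 1"
  obtains i S g \<beta> where "pair_graph H" and "card (pverts H) = n"
    and "real (max_degree H) \<le> C * real r * 2 ^ r"
    and "2 * real (card (pverts (U i))) \<le> gam r * real n"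
    and "S \<subseteq> pverts H" and "bij_betw g (Inl ` pverts (U i) \<union> Inr ` pverts (U i)) S"
    and "card S = 2 * card (pverts (U i))"
    and "\<And>u v. (u, v) \<in> parcs H \<Longrightarrow> u \<in> S \<Longrightarrow> v \<in> S \<Longrightarrow>
      \<exists>p q. (p, q) \<in> parcs (F_graph (U i)) \<and> u = g p \<and> v = g q"
    and "bij_betw (\<lambda>(x, k). \<beta> x k) (S \<times> {..<t + (max_degree H - 1)}) (pverts H - S)"
    and "\<And>x v. (x, v) \<in> parcs H \<Longrightarrow> x \<in> S \<Longrightarrow> v \<notin> S \<Longrightarrow> v = \<beta> x 0"
    and "\<And>u v. (u, v) \<in> parcs H \<Longrightarrow> u \<notin> S \<Longrightarrow> v \<notin> S \<Longrightarrow>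
      \<exists>x\<in>S. \<exists>k l. (k, l) \<in> parcs (broom t (max_degree H - 1)) \<and> u = \<beta> x k \<and> v = \<beta> x l"
proof -
  let ?d = "max_degree H - 1"
  obtain i S\<^sub>A S\<^sub>B where H: "pair_graph H" "card (pverts H) = n"
      "real (max_degree H) \<le> C * real r * 2 ^ r"
    and k: "2 * real (card (pverts (U i))) \<le> gam r * real n"
    and S: "S\<^sub>A \<union> S\<^sub>B \<subseteq> pverts H" "S\<^sub>A \<inter> S\<^sub>B = {}" "card S\<^sub>A = card (pverts (U i))" "card S\<^sub>B = card (pverts (U i))"
      "arcs (with_proj H \<restriction> S\<^sub>A) = {}" "arcs (with_proj H \<restriction> S\<^sub>B) = {}"
    and F: "\<exists>h. iso_onto h (with_proj (F_graph (U i))) (with_proj (bip_subgraph H S\<^sub>A S\<^sub>B)) \<and>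
               iso_verts h ` Inl ` pverts (U i) = S\<^sub>A \<and> iso_verts h ` Inr ` pverts (U i) = S\<^sub>B"
    and tr: "\<exists>first.
       (\<forall>K \<in> pre_digraph.sccs (with_proj H \<restriction> (pverts H - (S\<^sub>A \<union> S\<^sub>B))).
          \<exists>h. iso_onto h (with_proj (broom t ?d)) K \<and> iso_verts h 0 = first K) \<and>
       (\<forall>x \<in> S\<^sub>A \<union> S\<^sub>B. \<exists>K \<in> pre_digraph.sccs (with_proj H \<restriction> (pverts H - (S\<^sub>A \<union> S\<^sub>B))).
          {y \<in> pverts H - (S\<^sub>A \<union> S\<^sub>B). (x, y) \<in> parcs H} = {first K}) \<and>
       (\<forall>K \<in> pre_digraph.sccs (with_proj H \<restriction> (pverts H - (S\<^sub>A \<union> S\<^sub>B))).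
          \<exists>!x. x \<in> S\<^sub>A \<union> S\<^sub>B \<and> (x, first K) \<in> parcs H)"
    using assms(1) unfolding H_class_def Let_def mem_Collect_eq
    by (elim conjE, elim exE, elim conjE) (rule that)
  interpret H: pair_graph H by (rule H(1))
  define S where "S = S\<^sub>A \<union> S\<^sub>B"
  define comps where "comps = pre_digraph.sccs (with_proj H \<restriction> (pverts H - S))"
  note S_sub = S(1)[folded S_def]
  note comp = components_of_induced_subgraph[OF H(1) Diff_subset[of "pverts H" S], folded comps_def]
  obtain h where h: "iso_onto h (with_proj (F_graph (U i))) (with_proj (bip_subgraph H S\<^sub>A S\<^sub>B))"
    "iso_verts h ` Inl ` pverts (U i) = S\<^sub>A" "iso_verts h ` Inr ` pverts (U i) = S\<^sub>B" using F by blast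
  define g where "g = iso_verts h"
  have F_verts: "pverts (F_graph (U i)) = Inl ` pverts (U i) \<union> Inr ` pverts (U i)"
    by (simp add: F_graph_def Let_def)
  have "tail (with_proj (bip_subgraph H S\<^sub>A S\<^sub>B)) = fst" "head (with_proj (bip_subgraph H S\<^sub>A S\<^sub>B)) = snd" by auto
  note F_iso = iso_onto_pairs[OF h(1) this, folded g_def]
  have g: "bij_betw g (Inl ` pverts (U i) \<union> Inr ` pverts (U i)) S"
    using F_iso(2) h(2,3) unfolding F_verts bij_betw_def by (simp add: image_Un g_def S_def)
  obtain first where first: "(\<forall>K\<in>comps. \<exists>h. iso_onto h (with_proj (broom t ?d)) K \<and> iso_verts h 0 = first K) \<and>
      (\<forall>x\<in>S. \<exists>K\<in>comps. {y \<in> pverts H - S. (x, y) \<in> parcs H} = {first K}) \<and>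
      (\<forall>K\<in>comps. \<exists>!x. x \<in> S \<and> (x, first K) \<in> parcs H)"
    using tr unfolding S_def[symmetric] comps_def[symmetric] by (elim exE) (rule that)
  note tree = bspec[OF conjunct1[OF first]]
  note S_nbr = bspec[OF conjunct1[OF conjunct2[OF first]]]
  note first_nbr = bspec[OF conjunct2[OF conjunct2[OF first]]]
  obtain b where b: "\<And>K. K \<in> comps \<Longrightarrow> iso_onto (b K) (with_proj (broom t ?d)) K"
    "\<And>K. K \<in> comps \<Longrightarrow> iso_verts (b K) 0 = first K" using tree by metis
  have broom_verts: "pverts (broom t ?d) = {..<t + ?d}" by (simp add: broom_def Let_def)
  have b_verts: "verts K = iso_verts (b K) ` {..<t + ?d}" if "K \<in> comps" for K
    using iso_onto_pairs(1)[OF b(1)[OF that]] comp(4)[OF that] unfolding broom_verts by blast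
  have b_inj: "inj_on (iso_verts (b K)) {..<t + ?d}" if "K \<in> comps" for K
    using iso_onto_pairs(2)[OF b(1)[OF that]] comp(4)[OF that] unfolding broom_verts by blast
  have b_arcs: "\<exists>k l. (k, l) \<in> parcs (broom t ?d) \<and> u = iso_verts (b K) k \<and> v = iso_verts (b K) l"
    if "K \<in> comps" "(u, v) \<in> arcs K" for K u v
    using iso_onto_pairs(3)[OF b(1)[OF that(1)] _ _ that(2)] comp(4)[OF that(1)] by blast
  have first_in: "first K \<in> verts K" if "K \<in> comps" for K
    unfolding b_verts[OF that] b(2)[OF that, symmetric] using assms(2) by (intro imageI) simp
  obtain \<kappa> where \<kappa>: "\<And>x. x \<in> S \<Longrightarrow> \<kappa> x \<in> comps"
    "\<And>x. x \<in> S \<Longrightarrow> {y \<in> pverts H - S. (x, y) \<in> parcs H} = {first (\<kappa> x)}" using S_nbr by metis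
  have \<kappa>_surj: "\<exists>x\<in>S. \<kappa> x = K" if K: "K \<in> comps" for K
  proof -
    obtain x where x: "x \<in> S" "(x, first K) \<in> parcs H" using first_nbr[OF K] by blast
    have "first K \<in> pverts H - S" using first_in[OF K] comp(4)[OF K] by blast
    then have "first K \<in> {first (\<kappa> x)}" using x \<kappa>(2)[OF x(1)] by blast
    then have "\<kappa> x = K" using comp(1)[OF \<kappa>(1)[OF x(1)] K] first_in K \<kappa>(1)[OF x(1)] by (metis singletonD)
    then show ?thesis using x by blast
  qed
  have \<kappa>_inj: "x = y" if xy: "x \<in> S" "y \<in> S" "\<kappa> x = \<kappa> y" for x y
  proof -
    have nbr: "(x, first (\<kappa> x)) \<in> parcs H" if "x \<in> S" for x
    proof -
      have "first (\<kappa> x) \<in> {y \<in> pverts H - S. (x, y) \<in> parcs H}" unfolding \<kappa>(2)[OF that] by simp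
      then show ?thesis by simp
    qed
    have "x \<in> S \<and> (x, first (\<kappa> x)) \<in> parcs H" "y \<in> S \<and> (y, first (\<kappa> x)) \<in> parcs H"
      using nbr[OF xy(1)] nbr[OF xy(2)] xy by simp_all
    with first_nbr[OF \<kappa>(1)[OF xy(1)]] show ?thesis by metis
  qed
  define \<beta> where "\<beta> x = iso_verts (b (\<kappa> x))" for x
  have \<beta>_in: "\<beta> x k \<in> verts (\<kappa> x)" if "x \<in> S" "k < t + ?d" for x k
    unfolding b_verts[OF \<kappa>(1)[OF that(1)]] \<beta>_def using that by simp
  have bij: "bij_betw (\<lambda>(x, k). \<beta> x k) (S \<times> {..<t + ?d}) (pverts H - S)"
    unfolding bij_betw_def
  proof
    show "inj_on (\<lambda>(x, k). \<beta> x k) (S \<times> {..<t + ?d})"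
    proof (rule inj_onI, safe)
      fix x k y l assume *: "x \<in> S" "y \<in> S" "k < t + ?d" "l < t + ?d" "\<beta> x k = \<beta> y l"
      have "\<kappa> x = \<kappa> y" using comp(1)[OF \<kappa>(1)[OF *(1)] \<kappa>(1)[OF *(2)]] \<beta>_in * by metis
      then show xy: "x = y" using \<kappa>_inj * by blast
      have "inj_on (\<beta> x) {..<t + ?d}" unfolding \<beta>_def by (rule b_inj[OF \<kappa>(1)[OF *(1)]])
      then show "k = l" using *(3-5) unfolding xy[symmetric] by (auto dest: inj_onD)
    qed
    show "(\<lambda>(x, k). \<beta> x k) ` (S \<times> {..<t + ?d}) = pverts H - S"
    proof (intro equalityI subsetI)
      fix v assume "v \<in> (\<lambda>(x, k). \<beta> x k) ` (S \<times> {..<t + ?d})"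
      then obtain x k where x: "x \<in> S" "k < t + ?d" "v = \<beta> x k" by auto
      then show "v \<in> pverts H - S" using \<beta>_in[OF x(1,2)] comp(4)[OF \<kappa>(1)[OF x(1)]] by blast
    next
      fix v assume "v \<in> pverts H - S"
      then obtain K where K: "K \<in> comps" "v \<in> verts K" using comp(2) by blast
      then obtain x where x: "x \<in> S" "\<kappa> x = K" using \<kappa>_surj by blast
      obtain k where "k < t + ?d" "v = \<beta> x k" using K(2) unfolding b_verts[OF K(1)] \<beta>_def x(2) by auto
      then show "v \<in> (\<lambda>(x, k). \<beta> x k) ` (S \<times> {..<t + ?d})" using x(1) by (intro image_eqI[of _ _ "(x, k)"]) auto
    qed
  qed
  have cS: "card S = 2 * card (pverts (U i))"
  proof -
    have "finite (S\<^sub>A \<union> S\<^sub>B)" using finite_subset[OF S(1) H.pair_finite_verts] .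
    then have "finite S\<^sub>A" "finite S\<^sub>B" by simp_all
    then show ?thesis using S(2-4) by (simp add: S_def card_Un_disjoint)
  qed
  show thesis
  proof (rule that[OF H k S_sub g cS _ bij])
    fix u v assume uv: "(u, v) \<in> parcs H" "u \<in> S" "v \<in> S"
    then have "(u, v) \<in> arcs (with_proj (bip_subgraph H S\<^sub>A S\<^sub>B))"
      using S(5,6) by (auto simp: bip_subgraph_def S_def)
    then show "\<exists>p q. (p, q) \<in> parcs (F_graph (U i)) \<and> u = g p \<and> v = g q" using F_iso(3) by simp
  next
    fix x v assume xv: "(x, v) \<in> parcs H" "x \<in> S" "v \<notin> S"
    then have "v \<in> {y \<in> pverts H - S. (x, y) \<in> parcs H}" using H.in_arcsD2 by blast
    then show "v = \<beta> x 0" unfolding \<kappa>(2)[OF xv(2)] \<beta>_def using b(2)[OF \<kappa>(1)[OF xv(2)]] by simp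
  next
    fix u v assume uv: "(u, v) \<in> parcs H" "u \<notin> S" "v \<notin> S"
    then have "u \<in> pverts H - S" "v \<in> pverts H - S" using H.in_arcsD1 H.in_arcsD2 by blast+
    then obtain K where K: "K \<in> comps" "(u, v) \<in> arcs K" using comp(3)[OF uv(1)] by blast
    obtain x where x: "x \<in> S" "\<kappa> x = K" using \<kappa>_surj[OF K(1)] by blast
    show "\<exists>x\<in>S. \<exists>k l. (k, l) \<in> parcs (broom t ?d) \<and> u = \<beta> x k \<and> v = \<beta> x l"
      using b_arcs[OF K] x unfolding \<beta>_def by blast
  qed
qed

section \<open>The embedding of the whole graph\<close>

lemma out_degree_eq_card_Image: "out_degree (with_proj G) v = card (parcs G `` {v})"
proof -
  have "out_arcs (with_proj G) v = Pair v ` (parcs G `` {v})" by (auto simp: out_arcs_def)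
  then show ?thesis by (simp add: out_degree_def card_image inj_on_def)
qed

lemma brooms_at_edge:
  assumes "brooms_at E X J \<phi> t d \<tau>" and "sym E" and "x \<in> J" and "(k, l) \<in> parcs (broom t d)"
  shows "(\<tau> x k, \<tau> x l) \<in> E"
proof -
  have forward: "(\<tau> x k, \<tau> x l) \<in> E" if "(l = Suc k \<and> Suc k < t) \<or> (k = t - 1 \<and> t \<le> l \<and> l < t + d)" for k l
    using assms(1,3) that by (auto simp: brooms_at_def)
  have "((l = Suc k \<and> Suc k < t) \<or> (k = t - 1 \<and> t \<le> l \<and> l < t + d)) \<or>
    ((k = Suc l \<and> Suc l < t) \<or> (l = t - 1 \<and> t \<le> k \<and> k < t + d))"
    using assms(4) by (auto simp: broom_def Let_def)
  then show ?thesis using forward symD[OF assms(2)] by blast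
qed

text \<open>
  In the bipartite graph, the neighbours of a vertex on one side are the copies of its closed
  neighbourhood in \<open>U\<close>, which has \<open>r + 1\<close> elements.
\<close>

lemma embed_F_graph:
  fixes E :: "('a \<times> 'a) set" and U :: "'c pair_pre_digraph"
  assumes U: "pair_graph U" "regular r U" "pverts U \<noteq> {}"
    and V: "finite V" "sym E" and deg: "\<And>v. v \<in> V \<Longrightarrow> card V \<le> 2 * card (E `` {v} \<inter> V)"
    and size: "6 * (r + 1) * 2 ^ (r + 1) * card (pverts U) \<le> card V"
  shows "\<exists>f. inj_on f (Inl ` pverts U \<union> Inr ` pverts U) \<and> f ` (Inl ` pverts U \<union> Inr ` pverts U) \<subseteq> V \<and>
    (\<forall>(p, q)\<in>parcs (F_graph U). (f p, f q) \<in> E)"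
proof -
  interpret U: pair_graph U by (rule U(1))
  let ?P = "pverts U"
  have symU: "(x, y) \<in> parcs U \<longleftrightarrow> (y, x) \<in> parcs U" for x y
    using U.pair_sym_arcs by (auto simp: symmetric_def dest: symD)
  define \<Gamma> where "\<Gamma> y = insert y (parcs U `` {y})" for y
  have \<Gamma>_sym: "x \<in> \<Gamma> y \<longleftrightarrow> y \<in> \<Gamma> x" for x y using symU by (auto simp: \<Gamma>_def)
  have \<Gamma>_sub: "\<Gamma> y \<subseteq> ?P" if "y \<in> ?P" for y using that U.in_arcsD2 by (auto simp: \<Gamma>_def)
  have \<Gamma>_card: "card (\<Gamma> y) = r + 1" if "y \<in> ?P" for y
  proof -
    have "y \<notin> parcs U `` {y}" using U.pair_no_loops by fastforce
    moreover have "finite (parcs U `` {y})"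
      by (rule finite_subset[OF _ U.pair_finite_verts]) (auto dest: U.in_arcsD2)
    ultimately show ?thesis
      using U(2) that by (simp add: \<Gamma>_def regular_def flip: out_degree_eq_card_Image)
  qed
  have \<Gamma>_inv: "{y \<in> ?P. x \<in> \<Gamma> y} = \<Gamma> x" if "x \<in> ?P" for x using \<Gamma>_sym \<Gamma>_sub[OF that] by blast
  have "\<exists>\<phi> \<psi>. inj_on \<phi> ?P \<and> inj_on \<psi> ?P \<and> \<phi> ` ?P \<subseteq> V \<and> \<psi> ` ?P \<subseteq> V \<and> \<phi> ` ?P \<inter> \<psi> ` ?P = {} \<and>
      (\<forall>y\<in>?P. \<forall>x\<in>\<Gamma> y. (\<phi> x, \<psi> y) \<in> E)"
  proof (rule embed_bipartite[OF V deg])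
    show "card {y \<in> ?P. x \<in> \<Gamma> y} \<le> r + 1" if "x \<in> ?P" for x using \<Gamma>_inv[OF that] \<Gamma>_card[OF that] by simp
    show "0 < card ?P" using U(3) U.pair_finite_verts by (simp add: card_gt_0_iff)
  qed (use U.pair_finite_verts \<Gamma>_sub \<Gamma>_card size in auto)
  then obtain \<phi> \<psi> where \<phi>: "inj_on \<phi> ?P" "\<phi> ` ?P \<subseteq> V" and \<psi>: "inj_on \<psi> ?P" "\<psi> ` ?P \<subseteq> V"
    and disj: "\<phi> ` ?P \<inter> \<psi> ` ?P = {}" and edge': "\<forall>y\<in>?P. \<forall>x\<in>\<Gamma> y. (\<phi> x, \<psi> y) \<in> E"
    by (elim exE conjE) (rule that)
  note edge = edge'[rule_format]
  show ?thesis
  proof (intro exI[of _ "case_sum \<phi> \<psi>"] conjI)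
    show "inj_on (case_sum \<phi> \<psi>) (Inl ` ?P \<union> Inr ` ?P)"
    proof (rule inj_onI)
      fix p q assume pq: "p \<in> Inl ` ?P \<union> Inr ` ?P" "q \<in> Inl ` ?P \<union> Inr ` ?P" "case_sum \<phi> \<psi> p = case_sum \<phi> \<psi> q"
      have "\<phi> x \<noteq> \<psi> y" if "x \<in> ?P" "y \<in> ?P" for x y using disj that by blast
      then show "p = q" using pq inj_onD[OF \<phi>(1)] inj_onD[OF \<psi>(1)] by (cases p; cases q) force+
    qed
    show "case_sum \<phi> \<psi> ` (Inl ` ?P \<union> Inr ` ?P) \<subseteq> V" using \<phi>(2) \<psi>(2) by auto
    show "\<forall>(p, q)\<in>parcs (F_graph U). (case_sum \<phi> \<psi> p, case_sum \<phi> \<psi> q) \<in> E"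
    proof (clarify)
      fix p q assume "(p, q) \<in> parcs (F_graph U)"
      then obtain x y where "(p = Inl x \<and> q = Inr y) \<or> (q = Inl x \<and> p = Inr y)"
        "(x, y) \<in> parcs U \<or> (x = y \<and> x \<in> ?P)" by (auto simp: F_graph_def Let_def)
      moreover from this(2) have "y \<in> ?P" "x \<in> \<Gamma> y" using U.in_arcsD2 symU by (auto simp: \<Gamma>_def)
      ultimately show "(case_sum \<phi> \<psi> p, case_sum \<phi> \<psi> q) \<in> E"
        using edge[of y x] symD[OF V(2), of "\<phi> x" "\<psi> y"] by auto
    qed
  qed
qed

text \<open>
  The constants of the theorem: \<open>\<eta> = 3 * root 3 (gam r)\<close> gives \<open>\<eta> ^ 3 = 27 * gam r\<close>, so
  that the hypothesis on the size of \<open>S\<close> reads \<open>27 * card S \<le> \<eta> ^ 3 * n\<close>.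
\<close>

lemma gam_bounds:
  assumes "r \<ge> 35"
  shows "0 < 3 * root 3 (gam r)" and "3 * root 3 (gam r) \<le> 1" and "(3 * root 3 (gam r)) ^ 3 = 27 * gam r"
proof -
  have pos: "0 < gam r" using assms by (simp add: gam_def)
  have "27 \<le> 8 * real r * 1" using assms by simp
  also have "\<dots> \<le> 8 * real r * 2 ^ r" by (intro mult_left_mono) auto
  finally have "gam r \<le> 1 / 27" unfolding gam_def using assms by (intro divide_left_mono) auto
  then have "root 3 (gam r) \<le> root 3 ((1 / 3) ^ 3)" by (simp add: power_divide)
  also have "\<dots> = 1 / 3" by (rule real_root_power_cancel) auto
  finally show "3 * root 3 (gam r) \<le> 1" by simp
  show "0 < 3 * root 3 (gam r)" using pos by simp
  have "root 3 (gam r) ^ 3 = gam r" using pos by (intro real_root_pow_pos2) auto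
  then show "(3 * root 3 (gam r)) ^ 3 = 27 * gam r" by (simp add: power_mult_distrib)
qed

lemma dense_graph_of_min_degree:
  assumes G: "pair_graph G" and \<eta>: "0 < \<eta>" "\<eta> \<le> 1"
    and deg: "real (min_degree G) \<ge> (1/2 + \<eta>) * real (card (pverts G))"
  shows "dense_graph (parcs G) (pverts G) \<eta>"
proof -
  interpret G: pair_graph G by (rule G)
  show ?thesis
  proof
    show "sym (parcs G)" using G.pair_sym_arcs by (simp add: symmetric_def)
    show "(v, v) \<notin> parcs G" for v using G.pair_no_loops by fastforce
    fix v assume v: "v \<in> pverts G"
    have "min_degree G \<le> out_degree (with_proj G) v"
      unfolding min_degree_def using v G.pair_finite_verts by (intro Min_le) auto
    moreover have "parcs G `` {v} \<inter> pverts G = parcs G `` {v}" using G.in_arcsD2 by blast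
    ultimately show "(1/2 + \<eta>) * real (card (pverts G)) \<le> real (card (parcs G `` {v} \<inter> pverts G))"
      using deg by (simp add: out_degree_eq_card_Image)
  qed (use \<eta> G.pair_finite_verts in auto)
qed

theorem theorem3:
  fixes r :: nat and C :: real and U :: "nat \<Rightarrow> 'c pair_pre_digraph"
  assumes "r \<ge> 35" and "ramanujan_seq r U"
  shows "\<exists>n\<^sub>0. \<forall>t n. \<forall>(G :: 'a pair_pre_digraph) (H :: 'b pair_pre_digraph).
           t \<ge> 1 \<longrightarrow> n \<ge> n\<^sub>0 \<longrightarrow>
           pair_graph G \<longrightarrow> card (pverts G) = n \<longrightarrow>
           real (min_degree G) \<ge> (1/2 + 3 * root 3 (gam r)) * real n \<longrightarrow>
           H \<in> H_class C r t U n \<longrightarrow>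
           (\<exists>K. spanning K (with_proj G) \<and> digraph_iso (with_proj H) K)"
proof -
  define \<eta> where "\<eta> = 3 * root 3 (gam r)"
  have eta: "0 < \<eta>" "\<eta> \<le> 1" "\<eta> ^ 3 = 27 * gam r"
    using gam_bounds[OF assms(1)] by (simp_all add: \<eta>_def)
  define D where "D = nat \<lceil>C * real r * 2 ^ r\<rceil>"
  obtain n\<^sub>0 where n\<^sub>0: "\<forall>(E :: ('a \<times> 'a) set) V (J :: 'b set) \<phi> t d.
    dense_graph E V \<eta> \<longrightarrow> n\<^sub>0 \<le> card V \<longrightarrow> finite J \<longrightarrow> J \<noteq> {} \<longrightarrow> inj_on \<phi> J \<longrightarrow> \<phi> ` J \<subseteq> V \<longrightarrow>
    card V = card J * (1 + t + d) \<longrightarrow> 1 \<le> t \<longrightarrow> d \<le> D \<longrightarrow> 27 * real (card J) \<le> \<eta> ^ 3 * real (card V) \<longrightarrow>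
    (\<exists>\<tau>. brooms_at E (V - \<phi> ` J) J \<phi> t d \<tau>)"
    using attach_brooms[OF eta(1,2), of D] by (elim exE) (rule that)
  show ?thesis
  proof (intro exI[of _ n\<^sub>0] allI impI)
    fix t n and G :: "'a pair_pre_digraph" and H :: "'b pair_pre_digraph"
    assume t: "t \<ge> 1" and n: "n \<ge> n\<^sub>0" and G: "pair_graph G" "card (pverts G) = n"
      and "real (min_degree G) \<ge> (1/2 + 3 * root 3 (gam r)) * real n" and "H \<in> H_class C r t U n"
    then have dense: "dense_graph (parcs G) (pverts G) \<eta>"
      by (intro dense_graph_of_min_degree eta) (simp_all add: \<eta>_def)
    interpret dense_graph "parcs G" "pverts G" \<eta> by (rule dense)
    let ?d = "max_degree H - 1"
    obtain i S g \<beta> where H: "pair_graph H" "card (pverts H) = n"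
        "real (max_degree H) \<le> C * real r * 2 ^ r" "2 * real (card (pverts (U i))) \<le> gam r * real n"
        "S \<subseteq> pverts H"
      and g: "bij_betw g (Inl ` pverts (U i) \<union> Inr ` pverts (U i)) S"
      and cS: "card S = 2 * card (pverts (U i))"
      and inside: "\<And>u v. (u, v) \<in> parcs H \<Longrightarrow> u \<in> S \<Longrightarrow> v \<in> S \<Longrightarrow>
        \<exists>p q. (p, q) \<in> parcs (F_graph (U i)) \<and> u = g p \<and> v = g q"
      and \<beta>: "bij_betw (\<lambda>(x, k). \<beta> x k) (S \<times> {..<t + ?d}) (pverts H - S)"
      and link: "\<And>x v. (x, v) \<in> parcs H \<Longrightarrow> x \<in> S \<Longrightarrow> v \<notin> S \<Longrightarrow> v = \<beta> x 0"
      and outside: "\<And>u v. (u, v) \<in> parcs H \<Longrightarrow> u \<notin> S \<Longrightarrow> v \<notin> S \<Longrightarrow>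
        \<exists>x\<in>S. \<exists>k l. (k, l) \<in> parcs (broom t ?d) \<and> u = \<beta> x k \<and> v = \<beta> x l"
      by (rule H_class_structure[OF \<open>H \<in> H_class C r t U n\<close> t]) (rule that)
    interpret H: pair_graph H by (rule H(1))
    have U: "pair_graph (U i)" "regular r (U i)" "\<nexists>A B. bipartition (U i) A B"
      using assms(2) by (auto simp: ramanujan_seq_def ramanujan_def)
    have U_ne: "pverts (U i) \<noteq> {}"
    proof
      assume "pverts (U i) = {}"
      then have "bipartition (U i) {} {}"
        using pair_wf_digraph.in_arcsD1[of "U i"] U(1)
        by (auto simp: bipartition_def pair_graph_def pair_digraph_def pair_fin_digraph_def)
      then show False using U(3) by blast
    qed
    let ?Fv = "Inl ` pverts (U i) \<union> Inr ` pverts (U i)"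
    have "\<exists>f. inj_on f ?Fv \<and> f ` ?Fv \<subseteq> pverts G \<and> (\<forall>(p, q)\<in>parcs (F_graph (U i)). (f p, f q) \<in> parcs G)"
    proof (rule embed_F_graph[OF U(1,2) U_ne finV symE])
      show "card (pverts G) \<le> 2 * card (parcs G `` {v} \<inter> pverts G)" if "v \<in> pverts G" for v
      proof -
        have "1/2 * real (card (pverts G)) \<le> (1/2 + \<eta>) * real (card (pverts G))"
          using \<eta> by (intro mult_right_mono) auto
        then show ?thesis using deg[OF that] by linarith
      qed
      \<comment> \<open>Here \<open>gam r\<close> leaves a spare factor of \<open>4 * r / (3 * (r + 1))\<close>.\<close>
      have "2 * real (card (pverts (U i))) * (8 * real r * 2 ^ r) \<le> real n"
        using H(4) assms(1) by (simp add: gam_def field_simps)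
      moreover have "12 * real (r + 1) \<le> 16 * real r" using assms(1) by simp
      then have "12 * real (r + 1) * (2 ^ r * real (card (pverts (U i))))
          \<le> 16 * real r * (2 ^ r * real (card (pverts (U i))))" by (intro mult_right_mono) auto
      ultimately have "real (6 * (r + 1) * 2 ^ (r + 1) * card (pverts (U i))) \<le> real (card (pverts G))"
        using G(2) by (simp add: algebra_simps)
      then show "6 * (r + 1) * 2 ^ (r + 1) * card (pverts (U i)) \<le> card (pverts G)"
        by (simp only: of_nat_le_iff)
    qed
    then obtain e where e: "inj_on e ?Fv" "e ` ?Fv \<subseteq> pverts G"
      "\<forall>(p, q)\<in>parcs (F_graph (U i)). (e p, e q) \<in> parcs G" by (elim exE conjE) (rule that)
    have e_edge: "(e p, e q) \<in> parcs G" if "(p, q) \<in> parcs (F_graph (U i))" for p q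
      using bspec[OF e(3) that] by simp
    define \<phi> where "\<phi> v = e (inv_into ?Fv g v)" for v
    have inv_g: "bij_betw (inv_into ?Fv g) S ?Fv" using g by (rule bij_betw_inv_into)
    have \<phi>_g: "\<phi> (g p) = e p" if "p \<in> ?Fv" for p
      using inv_into_f_f[OF bij_betw_imp_inj_on[OF g] that] by (simp add: \<phi>_def)
    have \<phi>: "inj_on \<phi> S"
      unfolding \<phi>_def using comp_inj_on[OF bij_betw_imp_inj_on[OF inv_g], of e] e(1) inv_g
      by (simp add: bij_betw_def comp_def)
    have \<phi>_in: "\<phi> ` S \<subseteq> pverts G"
      using e(2) bij_betw_apply[OF inv_g] by (auto simp: \<phi>_def)
    have finS: "finite S" using H(5) H.pair_finite_verts finite_subset by blast
    have S_ne: "S \<noteq> {}" using cS U_ne U(1) pair_graph.axioms pair_fin_digraph.pair_finite_verts[of "U i"]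
      by (auto simp: pair_graph_def pair_digraph_def)
    have "card (pverts H - S) = card S * (t + ?d)"
      using bij_betw_same_card[OF \<beta>] by (simp add: card_cartesian_product)
    moreover have "card (pverts H) = card S + card (pverts H - S)"
      using card_Diff_subset[OF finS H(5)] card_mono[OF H.pair_finite_verts H(5)] by simp
    ultimately have cV: "card (pverts G) = card S * (1 + t + ?d)" using H(2) G(2) by simp
    have "real (max_degree H) \<le> of_int \<lceil>C * real r * 2 ^ r\<rceil>" using H(3) by linarith
    then have dD: "?d \<le> D" unfolding D_def by linarith
    have few: "27 * real (card S) \<le> \<eta> ^ 3 * real (card (pverts G))"
      using H(4) cS G(2) eta(3) by simp
    obtain \<tau> where \<tau>: "brooms_at (parcs G) (pverts G - \<phi> ` S) S \<phi> t ?d \<tau>"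
      using n\<^sub>0[rule_format, OF dense _ finS S_ne \<phi> \<phi>_in cV t dD few] n G(2) by blast
    have \<tau>_inj: "inj_on (\<lambda>(x, k). \<tau> x k) (S \<times> {..<t + ?d})"
      and \<tau>_in: "\<And>x k. x \<in> S \<Longrightarrow> k < t + ?d \<Longrightarrow> \<tau> x k \<in> pverts G - \<phi> ` S"
      and \<tau>_link: "\<And>x. x \<in> S \<Longrightarrow> (\<phi> x, \<tau> x 0) \<in> parcs G"
      using \<tau> by (auto simp: brooms_at_def)
    let ?\<beta> = "\<lambda>(x, k). \<beta> x k" and ?\<tau> = "\<lambda>(x, k). \<tau> x k" and ?I = "S \<times> {..<t + ?d}"
    \<comment> \<open>The roots follow \<open>\<phi>\<close>, and every other vertex is carried over by its coordinates in its broom.\<close>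
    define f where "f v = (if v \<in> S then \<phi> v else ?\<tau> (inv_into ?I ?\<beta> v))" for v
    have inv_\<beta>: "bij_betw (inv_into ?I ?\<beta>) (pverts H - S) ?I" using \<beta> by (rule bij_betw_inv_into)
    have f_S: "f v = \<phi> v" if "v \<in> S" for v using that by (simp add: f_def)
    have f_\<beta>: "f (\<beta> x k) = \<tau> x k" if "x \<in> S" "k < t + ?d" for x k
    proof -
      have mem: "(x, k) \<in> ?I" using that by simp
      then have "?\<beta> (x, k) \<in> pverts H - S" by (rule bij_betw_apply[OF \<beta>])
      moreover have "inv_into ?I ?\<beta> (?\<beta> (x, k)) = (x, k)"
        by (rule inv_into_f_f[OF bij_betw_imp_inj_on[OF \<beta>] mem])
      ultimately show ?thesis by (simp add: f_def)
    qed
    have coord: "\<exists>x\<in>S. \<exists>k<t + ?d. v = \<beta> x k" if "v \<in> pverts H - S" for v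
      using that unfolding bij_betw_imp_surj_on[OF \<beta>, symmetric] by auto
    have f_out: "f v \<in> pverts G - \<phi> ` S" if "v \<in> pverts H - S" for v
      using coord[OF that] f_\<beta> \<tau>_in by metis
    have f_in: "f v \<in> \<phi> ` S" if "v \<in> S" for v using that by (simp add: f_S)
    have f_inj: "inj_on f (pverts H)"
    proof (rule inj_onI)
      fix u v assume uv: "u \<in> pverts H" "v \<in> pverts H" "f u = f v"
      show "u = v"
      proof (cases "u \<in> S \<longleftrightarrow> v \<in> S")
        case False
        then show ?thesis using uv f_in[of u] f_in[of v] f_out[of u] f_out[of v] by auto
      next
        case same: True
        show ?thesis
        proof (cases "u \<in> S")
          case True
          then show ?thesis using same uv(3) inj_onD[OF \<phi>] by (simp add: f_S)
        next
          case False
          then obtain x k y l where xy: "x \<in> S" "k < t + ?d" "u = \<beta> x k" "y \<in> S" "l < t + ?d" "v = \<beta> y l"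
            using coord[of u] coord[of v] same uv by blast
          then have "?\<tau> (x, k) = ?\<tau> (y, l)" using uv(3) by (simp add: f_\<beta>)
          then have "(x, k) = (y, l)" by (rule inj_onD[OF \<tau>_inj]) (use xy in auto)
          then show ?thesis using xy by simp
        qed
      qed
    qed
    have "f ` pverts H \<subseteq> pverts G" using f_in f_out \<phi>_in by blast
    then have f_onto: "f ` pverts H = pverts G"
      using card_image[OF f_inj] H(2) G(2) finV by (intro card_subset_eq) auto
    have t0: "0 < t + ?d" using t by simp
    show "\<exists>K. spanning K (with_proj G) \<and> digraph_iso (with_proj H) K"
    proof (rule spanning_copyI[OF H(1) G(1) f_inj f_onto])
      fix u v assume uv: "(u, v) \<in> parcs H"
      have vu: "(v, u) \<in> parcs H" using uv H.pair_sym_arcs by (auto simp: symmetric_def dest: symD)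
      consider "u \<in> S" "v \<in> S" | "u \<in> S" "v \<notin> S" | "u \<notin> S" "v \<in> S" | "u \<notin> S" "v \<notin> S" by blast
      then show "(f u, f v) \<in> parcs G"
      proof cases
        case 1
        then obtain p q where pq: "(p, q) \<in> parcs (F_graph (U i))" "u = g p" "v = g q" using inside[OF uv] by blast
        have "p \<in> ?Fv" "q \<in> ?Fv"
          using pq(1) pair_wf_digraph.in_arcsD1[of "U i"] pair_wf_digraph.in_arcsD2[of "U i"] U(1)
          by (auto simp: F_graph_def Let_def pair_graph_def pair_digraph_def pair_fin_digraph_def)
        then show ?thesis using e_edge[OF pq(1)] 1 pq by (simp add: f_S \<phi>_g)
      next
        case 2
        then have "v = \<beta> u 0" by (rule link[OF uv])
        then show ?thesis using 2 \<tau>_link t0 by (simp add: f_S f_\<beta>)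
      next
        case 3
        then have "u = \<beta> v 0" using link[OF vu] by blast
        then show ?thesis using 3 symD[OF symE \<tau>_link] t0 by (simp add: f_S f_\<beta>)
      next
        case 4
        then obtain x k l where x: "x \<in> S" "(k, l) \<in> parcs (broom t ?d)" "u = \<beta> x k" "v = \<beta> x l"
          using outside[OF uv] by blast
        have "k < t + ?d" "l < t + ?d" using x(2) t by (auto simp: broom_def Let_def)
        then show ?thesis using brooms_at_edge[OF \<tau> symE x(1,2)] x by (simp add: f_\<beta>)
      qed
    qed
  qed
qed

end
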